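(* Let $n\ge 3$, let $0<\theta\le \frac12$, and let $x\in\mathbb{R}^{E_n}$ be a $\theta$-cyclic point. Define $y\in\mathbb{R}^{E_n}$ by $y_e=\frac32-\frac{\theta}{10}$ for $e\in W_x$, $y_e=\frac32 x_e$ for $e\in H_x$, and $y_e=0$ for $e\notin E_x$. Then $y\in \mathrm{TSP}(K_n)$.
   Context: $K_n$ is the complete graph on vertex set $V_n=\{1,\dots,n\}$ with edge set $E_n$. For $U\subseteq V_n$, $\delta(U)$ is the set of edges with exactly one endpoint in $U$, and $x(F)=\sum_{e\in F}x_e$. The subtour elimination polytope is $\mathrm{SUBT}(K_n)=\{x\in[0,1]^{E_n}: x(\delta(\{i\}))=2 \text{ for all } i\in V_n,\ x(\delta(U))\ge 2 \text{ for all } \emptyset\ne U\subsetneq V_n\}$. A tour of $K_n$ is a connected, spanning, Eulerian multigraph on $V_n$ whose edges (possibly repeated) come from $E_n$; its incidence vector $\chi^F\in\mathbb{Z}_{\ge0}^{E_n}$ records edge multiplicities. $\mathrm{TSP}(K_n)$ is the convex hull of incidence vectors of tours of $K_n$. For $x\in\mathrm{SUBT}(K_n)$, its support graph is $G_x=(V_n,E_x)$ with $E_x=\{e:x_e>0\}$. For $0<\theta\le\frac12$, a $\theta$-cyclic point is a vector $x\in \mathrm{SUBT}(K_n)\cap\{0,\theta,1-\theta,1\}^{E_n}$ such that $G_x$ has maximum degree at most $3$ and every vertex is incident to at least one edge $e$ with $x_e=1$. Write $W_x=\{e:x_e=1\}$ and $H_x=\{e\in E_x: x_e<1\}$. *)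

theory Defs
  imports Complex_Main
begin

text \<open>Vertices and edges of the complete graph K_n; an edge is a 2-element set.\<close>
definition Vn :: "nat \<Rightarrow> nat set" where
  "Vn n = {1..n}"

definition En :: "nat \<Rightarrow> nat set set" where
  "En n = {{i, j} | i j. i \<in> Vn n \<and> j \<in> Vn n \<and> i \<noteq> j}"

text \<open>delta(U): edges of K_n with exactly one endpoint in U.\<close>
definition delta :: "nat \<Rightarrow> nat set \<Rightarrow> nat set set" where
  "delta n U = {e \<in> En n. card (e \<inter> U) = 1}"

definition xsum :: "(nat set \<Rightarrow> real) \<Rightarrow> nat set set \<Rightarrow> real" where
  "xsum x F = (\<Sum>e\<in>F. x e)"

text \<open>Subtour elimination polytope (vectors are functions on edges; only values on En n matter).\<close>
definition SUBT :: "nat \<Rightarrow> (nat set \<Rightarrow> real) \<Rightarrow> bool" where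
  "SUBT n x \<longleftrightarrow>
     (\<forall>e\<in>En n. 0 \<le> x e \<and> x e \<le> 1) \<and>
     (\<forall>i\<in>Vn n. xsum x (delta n {i}) = 2) \<and>
     (\<forall>U. U \<noteq> {} \<and> U \<subset> Vn n \<longrightarrow> xsum x (delta n U) \<ge> 2)"

text \<open>A tour: multigraph given by edge multiplicities F on E_n, spanning V_n,
  connected, and Eulerian (every vertex has even degree).\<close>
definition is_tour :: "nat \<Rightarrow> (nat set \<Rightarrow> nat) \<Rightarrow> bool" where
  "is_tour n F \<longleftrightarrow>
     (\<forall>e. e \<notin> En n \<longrightarrow> F e = 0) \<and>
     (\<forall>v\<in>Vn n. even (\<Sum>e\<in>delta n {v}. F e)) \<and>
     (\<forall>u\<in>Vn n. \<forall>v\<in>Vn n.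
        (u, v) \<in> {(a, b). {a, b} \<in> En n \<and> F {a, b} > 0}\<^sup>*)"

text \<open>y \<in> TSP(K_n): y (restricted to E_n) is a convex combination of finitely many
  tour incidence vectors.\<close>
definition TSP :: "nat \<Rightarrow> (nat set \<Rightarrow> real) \<Rightarrow> bool" where
  "TSP n y \<longleftrightarrow>
     (\<exists>(k::nat) (F :: nat \<Rightarrow> nat set \<Rightarrow> nat) (lam :: nat \<Rightarrow> real).
        (\<forall>i<k. is_tour n (F i) \<and> lam i \<ge> 0) \<and>
        (\<Sum>i<k. lam i) = 1 \<and>
        (\<forall>e\<in>En n. y e = (\<Sum>i<k. lam i * real (F i e))))"

definition Wx :: "nat \<Rightarrow> (nat set \<Rightarrow> real) \<Rightarrow> nat set set" where
  "Wx n x = {e \<in> En n. x e = 1}"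

definition Esupp :: "nat \<Rightarrow> (nat set \<Rightarrow> real) \<Rightarrow> nat set set" where
  "Esupp n x = {e \<in> En n. x e > 0}"

definition Hx :: "nat \<Rightarrow> (nat set \<Rightarrow> real) \<Rightarrow> nat set set" where
  "Hx n x = {e \<in> Esupp n x. x e < 1}"

definition theta_cyclic :: "nat \<Rightarrow> real \<Rightarrow> (nat set \<Rightarrow> real) \<Rightarrow> bool" where
  "theta_cyclic n \<theta> x \<longleftrightarrow>
     SUBT n x \<and>
     (\<forall>e\<in>En n. x e \<in> {0, \<theta>, 1 - \<theta>, 1}) \<and>
     (\<forall>v\<in>Vn n. card {e \<in> delta n {v}. e \<in> Esupp n x} \<le> 3) \<and>
     (\<forall>v\<in>Vn n. \<exists>e\<in>delta n {v}. x e = 1)"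

end

(*
  Write W for the edges with x_e = 1 and H for the other support edges; after removing vertices of
  degree two the support graph is cubic, with one W-edge at each vertex.

  Base case: no 2-cut and no nontrivial tight 3-cut.  The conflict graph of the W-edges has
  degeneracy at most 4, so they split into five classes.  For each class M, matroid intersection
  writes x as a convex combination of rooted 1-trees T that have degree two at both ends of every
  edge of M.  On all odd cuts of T the vector x/2 then has enough slack to be lowered by theta/2 on
  M and still lie in the T-join polytope, so each T extends to a tour.  Averaging over the five
  classes saves theta/10 on each W-edge.

  Small cuts are removed by contracting either side and glueing the tours.  The decompositions
  also prescribe the probability that an edge is used an odd number of times; on a cut with at most
  three edges these numbers determine the joint law of the parities, so tours of the two sides can
  be coupled to agree in parity.  Rooting the 1-trees at the contracted vertex keeps one side
  connected inside, hence the multiplicities on the cut may be taken from the other side.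
*)
theory Submission
  imports Defs "HOL-Probability.Probability_Mass_Function"
begin

section \<open>Linear systems, polytopes and finite distributions\<close>

text \<open>The constant \<theta>/10 is one fifth of \<theta>/2, because each W-edge lies in exactly
  one of the five classes; five is one more than the 2 + 2 conflicts that an edge can have, at its
  two ends, with edges coloured before it. Lowering is restricted in two ways. A vertex cut that
  contains a lowered edge keeps only 1 - \<theta>/2, so parity must exempt it: hence the degree-two
  requirement at the ends of M. And a cut of three W-edges could drop below 1 if all of them were
  lowered. The obstacle in the induction is that equal means do not allow tours of two sides to be
  coupled. Parity probabilities can be fixed in advance because the join is drawn after T with the
  same edge probabilities z for every T, so an edge is odd with probability x(1 - z) + (1 - x)z.
  Both polyhedral theorems, on joins and on trees with prescribed pairs, are proved by counting: at
  a point determined by its tight constraints, fractional edges would outnumber the independent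
  tight constraints, which leaves a direction to move in.\<close>

lemma homogeneous_system_nontrivial:
  fixes C :: "('e \<Rightarrow> real) set"
  assumes "finite X" "finite C" "card C < card X"
  shows "\<exists>d. (\<exists>e\<in>X. d e \<noteq> 0) \<and> (\<forall>e. e \<notin> X \<longrightarrow> d e = 0) \<and> (\<forall>a\<in>C. (\<Sum>e\<in>X. a e * d e) = 0)"
  using assms
proof (induction "card X" arbitrary: C X rule: less_induct)
  case less
  show ?case
  proof (cases "\<exists>a\<in>C. \<exists>e\<in>X. a e \<noteq> 0")
    case False
    from less obtain e0 where "e0 \<in> X" by fastforce
    then show ?thesis using False
      by (intro exI[of _ "\<lambda>e. if e = e0 then 1 else 0"]) auto
  next
    case True
    then obtain a e0 where a: "a \<in> C" and e0: "e0 \<in> X" "a e0 \<noteq> 0" by blast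
    define red where "red c = (\<lambda>e. c e - c e0 / a e0 * a e)" for c :: "'e \<Rightarrow> real"
    define D where "D = red ` (C - {a})"
    have fX: "finite (X - {e0})" using less by auto
    have cX: "card (X - {e0}) < card X" using e0 less by (meson card_Diff1_less)
    have fD: "finite D" using less by (auto simp: D_def)
    have "card D \<le> card (C - {a})" using less unfolding D_def by (intro card_image_le) auto
    also have "\<dots> < card (X - {e0})" using less a e0 by (auto simp: card_Diff_singleton)
      (metis Suc_less_eq Suc_pred card_gt_0_iff empty_iff less_or_eq_imp_le)
    finally have "card D < card (X - {e0})" .
    from less.hyps[OF cX fX fD this] obtain d where d:
      "\<exists>e\<in>X-{e0}. d e \<noteq> 0" "\<forall>e. e \<notin> X-{e0} \<longrightarrow> d e = 0" "\<forall>a\<in>D. (\<Sum>e\<in>X-{e0}. a e * d e) = 0" by blast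
    define d' where "d' = d(e0 := - (\<Sum>e\<in>X-{e0}. a e * d e) / a e0)"
    have split: "(\<Sum>e\<in>X. c e * d' e) = c e0 * d' e0 + (\<Sum>e\<in>X-{e0}. c e * d e)" for c
      using less e0 by (subst sum.remove[of X e0]) (auto simp: d'_def intro!: sum.cong)
    have "(\<Sum>e\<in>X. c e * d' e) = 0" if "c \<in> C" for c
    proof (cases "c = a")
      case True
      then show ?thesis using split[of a] e0 by (simp add: d'_def)
    next
      case False
      then have "red c \<in> D" using that by (auto simp: D_def)
      then have "(\<Sum>e\<in>X-{e0}. red c e * d e) = 0" using d by blast
      then have "(\<Sum>e\<in>X-{e0}. c e * d e) = c e0 / a e0 * (\<Sum>e\<in>X-{e0}. a e * d e)"
        by (simp add: red_def left_diff_distrib sum_subtractf sum_distrib_left mult.assoc)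
      then show ?thesis using split[of c] e0 by (simp add: d'_def)
    qed
    moreover have "\<exists>e\<in>X. d' e \<noteq> 0" using d(1) by (auto simp: d'_def)
    moreover have "\<forall>e. e \<notin> X \<longrightarrow> d' e = 0" using d(2) e0 by (auto simp: d'_def)
    ultimately show ?thesis by blast
  qed
qed

section \<open>Rigid points of finite systems of linear inequalities\<close>

definition feasible :: "'e set \<Rightarrow> (('e \<Rightarrow> real) \<times> real) set \<Rightarrow> ('e \<Rightarrow> real) \<Rightarrow> bool" where
  "feasible E C x \<longleftrightarrow> (\<forall>(a, b)\<in>C. (\<Sum>e\<in>E. a e * x e) \<le> b)"

text \<open>These are the vertices of the polyhedron, described by the kernel of the tight
  constraints. Refuting rigidity then means solving a homogeneous system, for which a count of the
  tight constraints suffices.\<close>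

definition rigid :: "'e set \<Rightarrow> (('e \<Rightarrow> real) \<times> real) set \<Rightarrow> ('e \<Rightarrow> real) \<Rightarrow> bool" where
  "rigid E C x \<longleftrightarrow>
     (\<forall>d. (\<forall>(a, b)\<in>C. (\<Sum>e\<in>E. a e * x e) = b \<longrightarrow> (\<Sum>e\<in>E. a e * d e) = 0) \<longrightarrow> (\<forall>e\<in>E. d e = 0))"

definition slack :: "'e set \<Rightarrow> (('e \<Rightarrow> real) \<times> real) set \<Rightarrow> ('e \<Rightarrow> real) \<Rightarrow> (('e \<Rightarrow> real) \<times> real) set" where
  "slack E C x = {(a, b)\<in>C. (\<Sum>e\<in>E. a e * x e) < b}"

text \<open>Tight constraints stay tight along \<open>d\<close>, and boundedness forces some slack
  constraint to be hit; stopping at the first one removes it from \<open>slack\<close>.\<close>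

lemma push_to_boundary:
  assumes fin: "finite E" "finite C" and x: "feasible E C x"
    and bdd: "\<And>x e. feasible E C x \<Longrightarrow> e \<in> E \<Longrightarrow> 0 \<le> x e \<and> x e \<le> 1"
    and d: "\<forall>(a, b)\<in>C. (\<Sum>e\<in>E. a e * x e) = b \<longrightarrow> (\<Sum>e\<in>E. a e * d e) = 0"
    and nz: "\<exists>e\<in>E. d e \<noteq> 0"
  shows "\<exists>t>0. feasible E C (\<lambda>e. x e + t * d e) \<and> card (slack E C (\<lambda>e. x e + t * d e)) < card (slack E C x)"
proof -
  define dot where "dot a y = (\<Sum>e\<in>E. a e * y e)" for a y :: "_ \<Rightarrow> real"
  have lin: "(\<Sum>e\<in>E. a e * (x e + t * d e)) = dot a x + t * dot a d" for a t
    by (simp add: dot_def algebra_simps sum.distrib sum_distrib_left)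
  define P where "P = {(a, b)\<in>C. dot a d > 0}"
  have fP: "finite P" using fin unfolding P_def by (auto intro: rev_finite_subset)
  have "P \<noteq> {}"
  proof
    assume "P = {}"
    then have le: "dot a d \<le> 0" if "(a, b) \<in> C" for a b using that by (force simp: P_def)
    have f: "feasible E C (\<lambda>e. x e + t * d e)" if "t \<ge> 0" for t
      using x le that unfolding feasible_def lin
      by (clarsimp simp: dot_def[symmetric]) (smt (verit) case_prodD mult_nonneg_nonpos)
    obtain e where e: "e \<in> E" "d e \<noteq> 0" using nz by blast
    \<comment> \<open>If no constraint increases along \<open>d\<close>, the whole ray is feasible;
      this step length moves coordinate \<open>e\<close> by 2, out of the unit interval.\<close>
    have "0 \<le> x e + (2 / \<bar>d e\<bar>) * d e \<and> x e + (2 / \<bar>d e\<bar>) * d e \<le> 1"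
      using bdd[OF f[of "2 / \<bar>d e\<bar>"] e(1)] by auto
    moreover have "0 \<le> x e \<and> x e \<le> 1" using bdd[OF x e(1)] .
    ultimately show False using e(2) by (cases "d e > 0") (auto simp: abs_if)
  qed
  define r where "r = (\<lambda>(a, b). (b - dot a x) / dot a d)"
  define t where "t = Min (r ` P)"
  have "t \<in> r ` P" using fP \<open>P \<noteq> {}\<close> by (auto simp: t_def)
  then obtain a0 b0 where ab: "(a0, b0) \<in> P" "t = (b0 - dot a0 x) / dot a0 d" by (auto simp: r_def)
  have abC: "(a0, b0) \<in> C" and pos: "dot a0 d > 0" using ab by (auto simp: P_def)
  have s0: "dot a0 x < b0"
  proof -
    have "dot a0 x \<le> b0" using x abC by (auto simp: feasible_def dot_def)
    moreover have "dot a0 x \<noteq> b0" using d abC pos by (fastforce simp: dot_def)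
    ultimately show ?thesis by simp
  qed
  then have tpos: "t > 0" using ab pos by simp
  have tle: "t * dot a d \<le> b - dot a x" if "(a, b) \<in> C" for a b
  proof (cases "dot a d > 0")
    case True
    then have "(a, b) \<in> P" using that by (auto simp: P_def)
    then have "r (a, b) \<in> r ` P" by blast
    then have "t \<le> r (a, b)" unfolding t_def using fP by (intro Min_le) auto
    then show ?thesis using True by (simp add: r_def field_simps)
  next
    case False
    then have "t * dot a d \<le> 0" using tpos by (simp add: mult_nonneg_nonpos)
    moreover have "dot a x \<le> b" using x that by (auto simp: feasible_def dot_def)
    ultimately show ?thesis by simp
  qed
  have "feasible E C (\<lambda>e. x e + t * d e)"
    unfolding feasible_def lin using tle by fastforce
  moreover have "slack E C (\<lambda>e. x e + t * d e) \<subset> slack E C x"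
  proof
    show "slack E C (\<lambda>e. x e + t * d e) \<subseteq> slack E C x"
    proof (clarsimp simp: slack_def lin)
      fix a b assume ab: "(a, b) \<in> C" "dot a x + t * dot a d < b"
      have "dot a x \<le> b" using x ab by (auto simp: feasible_def dot_def)
      moreover have "dot a x = b \<Longrightarrow> dot a d = 0" using d ab by (auto simp: dot_def)
      ultimately show "(\<Sum>e\<in>E. a e * x e) < b" using ab by (fastforce simp: dot_def)
    qed
    have "(a0, b0) \<in> slack E C x" using abC s0 by (simp add: slack_def dot_def)
    moreover have "(a0, b0) \<notin> slack E C (\<lambda>e. x e + t * d e)"
    proof -
      have "dot a0 x + t * dot a0 d = b0" using ab(2) pos by simp
      then show ?thesis unfolding slack_def lin by simp
    qed
    ultimately show "slack E C (\<lambda>e. x e + t * d e) \<noteq> slack E C x" by blast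
  qed
  moreover have "finite (slack E C x)" using fin unfolding slack_def by (auto intro: rev_finite_subset)
  ultimately show ?thesis using tpos by (meson psubset_card_mono)
qed

text \<open>A point that is not rigid lies between the two points reached by pushing along
  \<open>d\<close> and \<open>- d\<close>, both with fewer slack constraints. Hence a convex
  property need only be checked at rigid points.\<close>

lemma polytope_induct [consumes 3, case_names bounded rigid mix]:
  assumes "finite E" "finite C" "feasible E C x"
    and bdd: "\<And>x e. feasible E C x \<Longrightarrow> e \<in> E \<Longrightarrow> 0 \<le> x e \<and> x e \<le> 1"
    and rig: "\<And>x. feasible E C x \<Longrightarrow> rigid E C x \<Longrightarrow> K x"
    and mix: "\<And>x y t. K x \<Longrightarrow> K y \<Longrightarrow> 0 \<le> t \<Longrightarrow> t \<le> 1 \<Longrightarrow> K (\<lambda>e. t * x e + (1 - t) * y e)"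
  shows "K x"
  using assms(3)
proof (induction "card (slack E C x)" arbitrary: x rule: less_induct)
  case less
  show ?case
  proof (cases "rigid E C x")
    case True
    then show ?thesis using rig less by blast
  next
    case False
    then obtain d where d: "\<forall>(a, b)\<in>C. (\<Sum>e\<in>E. a e * x e) = b \<longrightarrow> (\<Sum>e\<in>E. a e * d e) = 0"
      and nz: "\<exists>e\<in>E. d e \<noteq> 0" by (auto simp: rigid_def)
    obtain s where s: "s > 0" "feasible E C (\<lambda>e. x e + s * d e)"
      "card (slack E C (\<lambda>e. x e + s * d e)) < card (slack E C x)"
      using push_to_boundary[OF assms(1,2) less(2) _ d nz] bdd by blast
    have d': "\<forall>(a, b)\<in>C. (\<Sum>e\<in>E. a e * x e) = b \<longrightarrow> (\<Sum>e\<in>E. a e * - d e) = 0"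
      using d by (auto simp: sum_negf)
    have nz': "\<exists>e\<in>E. - d e \<noteq> 0" using nz by simp
    obtain t where t: "t > 0" "feasible E C (\<lambda>e. x e + t * - d e)"
      "card (slack E C (\<lambda>e. x e + t * - d e)) < card (slack E C x)"
      using push_to_boundary[OF assms(1,2) less(2) _ d' nz'] bdd by blast
    have "K (\<lambda>e. t/(s+t) * (x e + s * d e) + (1 - t/(s+t)) * (x e + t * - d e))"
      using s t less(1) by (intro mix) auto
    moreover have "t/(s+t) * (x e + s * d e) + (1 - t/(s+t)) * (x e + t * - d e) = x e" for e
    proof -
      have "t/(s+t) * s = (1 - t/(s+t)) * t" using s(1) t(1) by (simp add: divide_simps)
      then have "t/(s+t) * s * d e = (1 - t/(s+t)) * t * d e" by simp
      then show ?thesis by (simp add: algebra_simps)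
    qed
    ultimately show ?thesis by simp
  qed
qed

section \<open>Expectations and couplings of finitely supported distributions\<close>

abbreviation mean :: "'a pmf \<Rightarrow> ('a \<Rightarrow> real) \<Rightarrow> real" where
  "mean \<equiv> measure_pmf.expectation"

lemma mean_finite: "finite (set_pmf p) \<Longrightarrow> mean p f = (\<Sum>a\<in>set_pmf p. pmf p a * f a)"
  by (subst integral_measure_pmf[of "set_pmf p"]) auto

lemma mean_cong: "(\<And>a. a \<in> set_pmf p \<Longrightarrow> f a = g a) \<Longrightarrow> mean p f = mean p g"
  by (intro integral_cong_AE) (auto simp: AE_measure_pmf_iff)

lemma mean_bind:
  assumes "finite (set_pmf p)" "\<And>x. x \<in> set_pmf p \<Longrightarrow> finite (set_pmf (q x))"
  shows "mean (bind_pmf p q) f = mean p (\<lambda>x. mean (q x) f)"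
  by (subst pmf_expectation_bind[of "set_pmf p"]) (use assms in \<open>auto simp: mean_finite\<close>)

lemma mean_add: "finite (set_pmf p) \<Longrightarrow> mean p (\<lambda>x. f x + g x) = mean p f + mean p g"
  by (intro Bochner_Integration.integral_add integrable_measure_pmf_finite) auto

lemma mean_diff: "finite (set_pmf p) \<Longrightarrow> mean p (\<lambda>x. f x - g x) = mean p f - mean p g"
  by (intro Bochner_Integration.integral_diff integrable_measure_pmf_finite) auto

lemma mean_sum: "finite (set_pmf p) \<Longrightarrow> mean p (\<lambda>x. \<Sum>i\<in>A. f i x) = (\<Sum>i\<in>A. mean p (f i))"
  by (intro Bochner_Integration.integral_sum integrable_measure_pmf_finite) auto

lemma mean_mix:
  assumes "finite (set_pmf p)" "finite (set_pmf q)" "0 \<le> t" "t \<le> 1"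
  shows "mean (bind_pmf (bernoulli_pmf t) (\<lambda>b. if b then p else q)) f = t * mean p f + (1 - t) * mean q f"
proof -
  have "finite (set_pmf (bernoulli_pmf t))" by (rule finite_subset[of _ UNIV]) auto
  then have "mean (bind_pmf (bernoulli_pmf t) (\<lambda>b. if b then p else q)) f
    = mean (bernoulli_pmf t) (\<lambda>b. mean (if b then p else q) f)"
    using assms by (subst mean_bind) auto
  also have "\<dots> = t * mean p f + (1 - t) * mean q f"
    using assms by simp
  finally show ?thesis .
qed

lemma mean_one_imp_eq_one:
  assumes "finite (set_pmf p)" "mean p f = 1" "\<And>a. a \<in> set_pmf p \<Longrightarrow> f a \<ge> 1" "a \<in> set_pmf p"
  shows "f a = 1"
proof -
  have "(\<Sum>a\<in>set_pmf p. pmf p a * (f a - 1)) = 0"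
    using assms sum_pmf_eq_1[of "set_pmf p" p]
    by (simp add: mean_finite right_diff_distrib sum_subtractf)
  then have "pmf p a * (f a - 1) = 0"
    using assms by (subst (asm) sum_nonneg_eq_0_iff) (auto simp: pmf_nonneg)
  then show ?thesis using assms(4) by (auto simp: set_pmf_iff)
qed

text \<open>Equality of the image laws is \<open>rel_pmf (=)\<close>, and \<open>rel_pmf\<close>
  means that a coupling exists. In the uses \<open>f\<close> and \<open>g\<close> are traces on a
  cut, so that coupled objects agree there.\<close>

lemma pmf_coupling:
  assumes "map_pmf f p = map_pmf g q"
  obtains pq where "map_pmf fst pq = p" "map_pmf snd pq = q"
    "\<And>x y. (x, y) \<in> set_pmf pq \<Longrightarrow> x \<in> set_pmf p \<and> y \<in> set_pmf q \<and> f x = g y"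
proof -
  have "rel_pmf (=) (map_pmf f p) (map_pmf g q)" using assms by (simp add: pmf.rel_eq)
  then have "rel_pmf (\<lambda>x y. f x = g y) p q" by (simp add: pmf.rel_map)
  then obtain pq where pq: "\<And>x y. (x, y) \<in> set_pmf pq \<Longrightarrow> f x = g y"
     "map_pmf fst pq = p" "map_pmf snd pq = q" by (auto elim: rel_pmf.cases)
  have "x \<in> set_pmf p \<and> y \<in> set_pmf q" if "(x, y) \<in> set_pmf pq" for x y
    using that pq(2,3) by (metis fst_conv image_eqI set_map_pmf snd_conv)
  then show ?thesis using pq that by blast
qed

lemma coupling_finite:
  assumes "finite (set_pmf p)" "finite (set_pmf q)" "map_pmf fst pq = p" "map_pmf snd pq = q"
  shows "finite (set_pmf pq)"
proof -
  have "set_pmf pq \<subseteq> set_pmf p \<times> set_pmf q"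
  proof (rule subsetI)
    fix z assume "z \<in> set_pmf pq"
    then have "fst z \<in> set_pmf (map_pmf fst pq)" "snd z \<in> set_pmf (map_pmf snd pq)" by auto
    then show "z \<in> set_pmf p \<times> set_pmf q" unfolding assms(3,4) by (simp add: mem_Times_iff)
  qed
  then show ?thesis using assms finite_subset by blast
qed

lemma pmf_eq_mean: "pmf p a = mean p (\<lambda>x. of_bool (x = a))"
proof -
  have "mean p (\<lambda>x. of_bool (x = a)) = mean p (indicator {a})"
    by (intro mean_cong) (auto simp: indicator_def)
  then show ?thesis by (simp add: measure_pmf_single)
qed

section \<open>Cuts and parity in multigraphs\<close>

definition cut :: "'e set \<Rightarrow> ('e \<Rightarrow> 'v set) \<Rightarrow> 'v set \<Rightarrow> 'e set" where
  "cut E g U = {e \<in> E. g e \<inter> U \<noteq> {} \<and> \<not> g e \<subseteq> U}"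

definition inner :: "'e set \<Rightarrow> ('e \<Rightarrow> 'v set) \<Rightarrow> 'v set \<Rightarrow> 'e set" where
  "inner E g U = {e \<in> E. g e \<subseteq> U}"

text \<open>Edges are names with an end set \<open>g e\<close>. Contraction replaces only
  \<open>g\<close>, by an image: names, values and parallel edges persist, an edge whose ends merge
  becomes a loop and lies in no cut, and by \<open>cut_image\<close> the cuts of the image are cuts
  of the original.\<close>

locale mgraph =
  fixes V :: "'v set" and E :: "'e set" and g :: "'e \<Rightarrow> 'v set"
  assumes finV: "finite V" and finE: "finite E"
    and ends: "e \<in> E \<Longrightarrow> g e \<subseteq> V \<and> g e \<noteq> {} \<and> card (g e) \<le> 2"

lemma cut_sub: "cut E g U \<subseteq> E" by (auto simp: cut_def)

lemma cut_eqI: "(\<And>e. e \<in> E \<Longrightarrow> e \<in> cut E g A \<longleftrightarrow> e \<in> cut E g' B) \<Longrightarrow> cut E g A = cut E g' B"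
  using cut_sub[of E g A] cut_sub[of E g' B] by (intro set_eqI) (meson subsetD)

lemma cut_empty [simp]: "cut E g {} = {}" by (auto simp: cut_def)

lemma inner_sub: "inner E g U \<subseteq> E" by (auto simp: inner_def)

lemma cut_image: "cut E (\<lambda>e. f ` g e) S = cut E g (f -` S)"
  by (auto simp: cut_def)

lemma cut_diff: "cut (E - D) g U = cut E g U - D"
  by (auto simp: cut_def)

lemma card_Int_singleton: "card ({e} \<inter> A) = of_bool (e \<in> A)"
  by (cases "e \<in> A") auto

lemma even_card_sym_diff:
  assumes "finite A" "finite B"
  shows "even (card {x \<in> A \<union> B. (x \<in> A) \<noteq> (x \<in> B)}) \<longleftrightarrow> (even (card A) \<longleftrightarrow> even (card B))"
proof -
  have eq: "{x \<in> A \<union> B. (x \<in> A) \<noteq> (x \<in> B)} = (A - B) \<union> (B - A)" by auto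
  have "card A = card (A - B) + card (A \<inter> B)" "card B = card (B - A) + card (A \<inter> B)"
    using card_Int_Diff[OF assms(1), of B] card_Int_Diff[OF assms(2), of A, unfolded Int_commute[of B A]]
    by linarith+
  moreover have "card {x \<in> A \<union> B. (x \<in> A) \<noteq> (x \<in> B)} = card (A - B) + card (B - A)"
    unfolding eq using assms by (intro card_Un_disjoint) auto
  ultimately show ?thesis by presburger
qed

context mgraph
begin

abbreviation dl :: "'v set \<Rightarrow> 'e set" where "dl \<equiv> cut E g"

lemma fin_cut [simp]: "finite (dl U)"
  using finE cut_sub finite_subset by metis

lemma ends_pair:
  assumes "e \<in> E"
  obtains a b where "g e = {a, b}" "a \<in> V" "b \<in> V"
proof -
  have c: "card (g e) \<le> 2" "g e \<subseteq> V" "g e \<noteq> {}" using ends[OF assms] by auto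
  have "finite (g e)" using c finV finite_subset by blast
  then have "card (g e) = 1 \<or> card (g e) = 2" using c card_0_eq[of "g e"] by linarith
  then show ?thesis
    using that c by (auto simp: card_1_singleton_iff card_2_iff)
qed

lemma mem_cut: "e \<in> E \<Longrightarrow> g e = {a, b} \<Longrightarrow> e \<in> dl U \<longleftrightarrow> (a \<in> U) \<noteq> (b \<in> U)"
  by (auto simp: cut_def)

lemma cut_V: "dl (V \<inter> U) = dl U"
  using ends by (auto simp: cut_def)

lemma cut_whole [simp]: "dl V = {}"
  using ends by (auto simp: cut_def)

lemma cut_compl: "dl (V - U) = dl U"
proof -
  have "e \<in> dl (V - U) \<longleftrightarrow> e \<in> dl U" if e: "e \<in> E" for e
  proof -
    obtain a b where "g e = {a, b}" "a \<in> V" "b \<in> V" by (rule ends_pair[OF e])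
    then show ?thesis using e by (simp add: mem_cut)
  qed
  then show ?thesis by (rule cut_eqI)
qed

lemma cut_disjoint_Un:
  assumes "A \<inter> B = {}" "e \<in> E"
  shows "e \<in> dl (A \<union> B) \<longleftrightarrow> (e \<in> dl A) \<noteq> (e \<in> dl B)"
proof -
  obtain a b where "g e = {a, b}" "a \<in> V" "b \<in> V" by (rule ends_pair[OF assms(2)])
  then show ?thesis using assms by (auto simp: mem_cut)
qed

text \<open>Every edge lies in none or in exactly two of the three cuts, so the three sums add up to
  an even number.\<close>

lemma even_cut_Un:
  fixes F :: "'e \<Rightarrow> nat"
  assumes "A \<inter> B = {}"
  shows "even (sum F (dl (A \<union> B))) \<longleftrightarrow> (even (sum F (dl A)) \<longleftrightarrow> even (sum F (dl B)))"
proof -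
  have s: "sum F (dl U) = (\<Sum>e\<in>E. if e \<in> dl U then F e else 0)" for U
    using finE by (simp add: sum.inter_restrict[symmetric] Int_absorb1 cut_sub)
  have "even (\<Sum>e\<in>E. (if e \<in> dl (A \<union> B) then F e else 0) + (if e \<in> dl A then F e else 0) + (if e \<in> dl B then F e else 0))"
    using cut_disjoint_Un[OF assms] by (intro dvd_sum) auto
  then show ?thesis unfolding s sum.distrib even_add by argo
qed

lemma even_cut_vertices:
  fixes F :: "'e \<Rightarrow> nat"
  assumes "finite U"
  shows "even (sum F (dl U)) \<longleftrightarrow> even (\<Sum>v\<in>U. sum F (dl {v}))"
  using assms
proof (induction U)
  case (insert v U)
  then show ?case using even_cut_Un[of "{v}" U F] by simp
qed auto

lemma card_Int_cut: "card (J \<inter> dl U) = (\<Sum>e\<in>dl U. of_bool (e \<in> J))"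
  by (simp add: Int_commute)

lemma odd_card_cut:
  assumes "finite U"
  shows "odd (card (J \<inter> dl U)) \<longleftrightarrow> odd (card {v\<in>U. odd (card (J \<inter> dl {v}))})"
  using even_cut_vertices[OF assms, of "\<lambda>e. of_bool (e \<in> J)"]
    even_sum_iff[OF assms, of "\<lambda>v. card (J \<inter> dl {v})"]
  unfolding card_Int_cut by simp

lemma mgraph_image: "mgraph (f ` V) E (\<lambda>e. f ` g e)"
proof
  fix e assume e: "e \<in> E"
  have "card (f ` g e) \<le> card (g e)" using ends[OF e] finV card_image_le finite_subset by metis
  then show "f ` g e \<subseteq> f ` V \<and> f ` g e \<noteq> {} \<and> card (f ` g e) \<le> 2" using ends[OF e] by auto
qed (use finV finE in auto)

lemma mgraph_delete: "mgraph V (E - D) g"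
  by standard (use finV finE ends in auto)

end

text \<open>For a 0/1 vector with support J the sum below is the size of the symmetric difference of F and
  the trace of J on the cut; if J is a Q-join, that size is odd.\<close>

definition blossom :: "'v set \<Rightarrow> 'e set \<Rightarrow> ('e \<Rightarrow> 'v set) \<Rightarrow> 'v set \<Rightarrow> ('e \<Rightarrow> real) \<Rightarrow> bool" where
  "blossom V E g Q z \<longleftrightarrow> (\<forall>U\<subseteq>V. \<forall>F\<subseteq>cut E g U. odd (card F + card (U \<inter> Q)) \<longrightarrow>
     1 \<le> (\<Sum>e\<in>cut E g U. if e \<in> F then 1 - z e else z e))"

definition join :: "'v set \<Rightarrow> 'e set \<Rightarrow> ('e \<Rightarrow> 'v set) \<Rightarrow> 'v set \<Rightarrow> 'e set \<Rightarrow> bool" where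
  "join V E g Q J \<longleftrightarrow> J \<subseteq> E \<and> (\<forall>v\<in>V. odd (card (J \<inter> cut E g {v})) \<longleftrightarrow> v \<in> Q)"

definition joinable :: "'v set \<Rightarrow> 'e set \<Rightarrow> ('e \<Rightarrow> 'v set) \<Rightarrow> 'v set \<Rightarrow> ('e \<Rightarrow> real) \<Rightarrow> bool" where
  "joinable V E g Q z \<longleftrightarrow> (\<exists>p. (\<forall>J\<in>set_pmf p. join V E g Q J) \<and>
     (\<forall>e\<in>E. mean p (\<lambda>J. of_bool (e \<in> J)) = z e))"

lemma join_finite: "finite E \<Longrightarrow> \<forall>J\<in>set_pmf p. join V E g Q J \<Longrightarrow> finite (set_pmf p)"
  by (rule finite_subset[of _ "Pow E"]) (auto simp: join_def)

section \<open>The join polytope: reductions at integral edges, degree-two vertices and tight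
  cuts\<close>

context mgraph
begin

lemma joinable_mix:
  assumes "joinable V E g Q x" "joinable V E g Q y" "0 \<le> t" "t \<le> 1"
  shows "joinable V E g Q (\<lambda>e. t * x e + (1 - t) * y e)"
proof -
  obtain p q where p: "\<forall>J\<in>set_pmf p. join V E g Q J" "\<forall>e\<in>E. mean p (\<lambda>J. of_bool (e \<in> J)) = x e"
    and q: "\<forall>J\<in>set_pmf q. join V E g Q J" "\<forall>e\<in>E. mean q (\<lambda>J. of_bool (e \<in> J)) = y e"
    using assms by (auto simp: joinable_def)
  have f: "finite (set_pmf p)" "finite (set_pmf q)" using p q join_finite finE by blast+
  let ?r = "bind_pmf (bernoulli_pmf t) (\<lambda>b. if b then p else q)"
  have "set_pmf ?r \<subseteq> set_pmf p \<union> set_pmf q" by (auto split: if_splits)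
  then have "\<forall>J\<in>set_pmf ?r. join V E g Q J" using p q by blast
  moreover have "\<forall>e\<in>E. mean ?r (\<lambda>J. of_bool (e \<in> J)) = t * x e + (1 - t) * y e"
    unfolding mean_mix[OF f assms(3,4)] using p q by simp
  ultimately show ?thesis unfolding joinable_def by blast
qed

lemma blossom_even:
  assumes "blossom V E g Q z" "Q \<subseteq> V"
  shows "even (card Q)"
proof (rule ccontr)
  assume "odd (card Q)"
  then show False
    using assms(1)[unfolded blossom_def, rule_format, of V "{}"] assms(2) by (simp add: Int_absorb1)
qed

text \<open>The cut of \<open>S\<close> in the image is the cut of the preimage of \<open>S\<close>.
  A point of the image becomes a terminal when its fibre contains an odd number of terminals, so the
  parities of \<open>S\<close> and of its preimage agree.\<close>

lemma blossom_image:
  assumes "blossom V E g Q z"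
  shows "blossom (f ` V) E (\<lambda>e. f ` g e) {w \<in> f ` V. odd (card (V \<inter> f -` {w} \<inter> Q))} z"
  unfolding blossom_def
proof (intro allI impI)
  fix S F assume S: "S \<subseteq> f ` V" and F: "F \<subseteq> cut E (\<lambda>e. f ` g e) S"
    and o: "odd (card F + card (S \<inter> {w \<in> f ` V. odd (card (V \<inter> f -` {w} \<inter> Q))}))"
  have cutS: "cut E (\<lambda>e. f ` g e) S = dl (V \<inter> f -` S)" by (simp add: cut_image cut_V)
  have fS: "finite S" using S finV finite_surj by auto
  have un: "V \<inter> f -` S \<inter> Q = (\<Union>w\<in>S. V \<inter> f -` {w} \<inter> Q)" by auto
  have "card (V \<inter> f -` S \<inter> Q) = (\<Sum>w\<in>S. card (V \<inter> f -` {w} \<inter> Q))"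
    unfolding un by (rule card_UN_disjoint) (use finV fS in auto)
  then have "even (card (V \<inter> f -` S \<inter> Q)) \<longleftrightarrow> even (card {w\<in>S. odd (card (V \<inter> f -` {w} \<inter> Q))})"
    by (simp only: even_sum_iff[OF fS])
  moreover have "{w\<in>S. odd (card (V \<inter> f -` {w} \<inter> Q))} = S \<inter> {w \<in> f ` V. odd (card (V \<inter> f -` {w} \<inter> Q))}"
    using S by auto
  ultimately have "odd (card F + card (V \<inter> f -` S \<inter> Q))" using o by simp
  then show "1 \<le> (\<Sum>e\<in>cut E (\<lambda>e. f ` g e) S. if e \<in> F then 1 - z e else z e)"
    using assms[unfolded blossom_def, rule_format, of "V \<inter> f -` S" F] F unfolding cutS by simp
qed

lemma odd_card_ends:
  assumes "e \<in> E" "finite U"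
  shows "odd (card (U \<inter> {v. e \<in> dl {v}})) \<longleftrightarrow> e \<in> dl U"
proof -
  have "{v\<in>U. odd (card ({e} \<inter> dl {v}))} = U \<inter> {v. e \<in> dl {v}}" by (auto simp: card_Int_singleton)
  then show ?thesis using odd_card_cut[OF assms(2), of "{e}"] by (simp add: card_Int_singleton)
qed

text \<open>An edge of value 0 or 1 is absent from, or present in, every join of the decomposition.
  It can be deleted; if it is present, its ends change their membership in \<open>Q\<close>.\<close>

lemma joinable_delete:
  assumes e: "e \<in> E" and ze: "z e = 0 \<or> z e = 1" and Q: "Q \<subseteq> V" and b: "blossom V E g Q z"
    and IH: "\<And>Q'. Q' \<subseteq> V \<Longrightarrow> blossom V (E - {e}) g Q' z \<Longrightarrow> joinable V (E - {e}) g Q' z"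
  shows "joinable V E g Q z"
proof -
  define I where "I = (if z e = 1 then {e} else {})"
  define Q' where "Q' = {v\<in>V. (v \<in> Q) \<noteq> (z e = 1 \<and> e \<in> dl {v})}"
  have Q'V: "Q' \<subseteq> V" by (auto simp: Q'_def)
  have par: "odd (card (U \<inter> Q')) \<longleftrightarrow> (odd (card (U \<inter> Q)) \<noteq> (z e = 1 \<and> e \<in> dl U))" if "U \<subseteq> V" for U
  proof (cases "z e = 1")
    case True
    have fU: "finite U" using that finV finite_subset by blast
    let ?A = "U \<inter> Q" and ?B = "U \<inter> {v. e \<in> dl {v}}"
    have "U \<inter> Q' = {x \<in> ?A \<union> ?B. (x \<in> ?A) \<noteq> (x \<in> ?B)}"
      using that True by (auto simp: Q'_def)
    then show ?thesis using even_card_sym_diff[of ?A ?B] odd_card_ends[OF e fU] fU True by auto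
  next
    case False
    then have "U \<inter> Q' = U \<inter> Q" using that by (auto simp: Q'_def)
    then show ?thesis using False by simp
  qed
  have "blossom V (E - {e}) g Q' z" unfolding blossom_def
  proof (intro allI impI)
    fix U F assume U: "U \<subseteq> V" and F: "F \<subseteq> cut (E - {e}) g U" and o: "odd (card F + card (U \<inter> Q'))"
    \<comment> \<open>Putting a present edge into the set makes its term 1 - 1 = 0 and changes the
      parity of \<open>F\<close> exactly as \<open>Q'\<close> changes that of
      \<open>Q\<close>.\<close>
    define F' where "F' = F \<union> (I \<inter> dl U)"
    have eF: "e \<notin> F" using F by (auto simp: cut_def)
    have finF: "finite F" using F finE finite_subset cut_sub by (metis finite_Diff)
    have F': "F' \<subseteq> dl U" using F by (auto simp: F'_def cut_diff)
    have "card F' = card F + (if z e = 1 \<and> e \<in> dl U then 1 else 0)"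
      using eF finF by (auto simp: F'_def I_def)
    then have "odd (card F' + card (U \<inter> Q))" using o par[OF U] by (auto split: if_splits)
    then have "1 \<le> (\<Sum>e\<in>dl U. if e \<in> F' then 1 - z e else z e)" using b U F' by (auto simp: blossom_def)
    also have "\<dots> = (\<Sum>e\<in>cut (E - {e}) g U. if e \<in> F' then 1 - z e else z e)"
      by (rule sum.mono_neutral_right) (use ze eF in \<open>auto simp: cut_diff F'_def I_def split: if_splits\<close>)
    also have "\<dots> = (\<Sum>e\<in>cut (E - {e}) g U. if e \<in> F then 1 - z e else z e)"
      by (rule sum.cong) (auto simp: F'_def I_def cut_diff split: if_splits)
    finally show "1 \<le> \<dots>" .
  qed
  from IH[OF Q'V this] obtain p where p: "\<forall>J\<in>set_pmf p. join V (E - {e}) g Q' J"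
    "\<forall>e'\<in>E - {e}. mean p (\<lambda>J. of_bool (e' \<in> J)) = z e'" by (auto simp: joinable_def)
  let ?p = "map_pmf (\<lambda>J. J \<union> I) p"
  have "join V E g Q (J \<union> I)" if J: "J \<in> set_pmf p" for J
    unfolding join_def
  proof (intro conjI ballI)
    have jJ: "join V (E - {e}) g Q' J" using p J by blast
    then show "J \<union> I \<subseteq> E" using e by (auto simp: join_def I_def)
    fix v assume v: "v \<in> V"
    have eJ: "e \<notin> J" and finJ: "finite J" using jJ finE by (auto simp: join_def intro: finite_subset)
    have s: "(J \<union> I) \<inter> dl {v} = (J \<inter> cut (E - {e}) g {v}) \<union> (I \<inter> dl {v})"
      using eJ by (auto simp: cut_diff I_def)
    have "card ((J \<union> I) \<inter> dl {v}) = card (J \<inter> cut (E - {e}) g {v}) + card (I \<inter> dl {v})"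
      unfolding s using eJ finJ by (intro card_Un_disjoint) (auto simp: I_def)
    moreover have "odd (card (J \<inter> cut (E - {e}) g {v})) \<longleftrightarrow> v \<in> Q'" using jJ v by (auto simp: join_def)
    moreover have "odd (card (I \<inter> dl {v})) \<longleftrightarrow> z e = 1 \<and> e \<in> dl {v}" by (simp add: I_def card_Int_singleton)
    ultimately show "odd (card ((J \<union> I) \<inter> dl {v})) \<longleftrightarrow> v \<in> Q" using v by (auto simp: Q'_def)
  qed
  moreover have "mean ?p (\<lambda>J. of_bool (e' \<in> J)) = z e'" if e': "e' \<in> E" for e'
  proof (cases "e' = e")
    case True
    have "mean p (\<lambda>J. of_bool (e \<in> J \<union> I)) = mean p (\<lambda>J. z e)"
      using p(1) ze by (intro mean_cong) (auto simp: join_def I_def)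
    then show ?thesis using True by simp
  next
    case False
    then have "mean p (\<lambda>J. of_bool (e' \<in> J \<union> I)) = mean p (\<lambda>J. of_bool (e' \<in> J))"
      by (intro mean_cong) (auto simp: I_def)
    then show ?thesis using p(2) e' False by simp
  qed
  ultimately show ?thesis unfolding joinable_def by (intro exI[of _ ?p]) auto
qed

end

context mgraph
begin

text \<open>At a vertex of degree two, parity determines membership of \<open>e\<close> from
  membership of \<open>f\<close>, and the blossom inequalities at \<open>v\<close> force
  \<open>z e\<close> to be the matching value. So \<open>e\<close> may be contracted and
  reconstructed afterwards.\<close>

lemma joinable_degree_two:
  assumes v: "v \<in> V" and ef: "dl {v} = {e, f}" "e \<noteq> f" and Q: "Q \<subseteq> V" and b: "blossom V E g Q z"
    and IH: "\<And>(V' :: 'v set) g' Q'. card V' < card V \<Longrightarrow> mgraph V' E g' \<Longrightarrow> Q' \<subseteq> V' \<Longrightarrow> blossom V' E g' Q' z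
      \<Longrightarrow> joinable V' E g' Q' z"
  shows "joinable V E g Q z"
proof -
  have eE: "e \<in> E" and fE: "f \<in> E" using ef cut_sub[of E g "{v}"] by auto
  obtain a where a: "g e = {v, a}" "a \<in> V" "a \<noteq> v"
  proof -
    obtain x y where xy: "g e = {x, y}" "x \<in> V" "y \<in> V" by (rule ends_pair[OF eE])
    have "e \<in> dl {v}" using ef by simp
    then show ?thesis using that[of y] that[of x] xy mem_cut[OF eE xy(1), of "{v}"] by (auto simp: insert_commute)
  qed
  define h where "h = (\<lambda>x. if x = v then a else x)"
  define Q1 where "Q1 = {w \<in> h ` V. odd (card (V \<inter> h -` {w} \<inter> Q))}"
  have hV: "h ` V = V - {v}" using a v by (auto simp: h_def)
  have "card (h ` V) < card V" unfolding hV using card_Diff1_less[OF finV v] .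
  then have "joinable (h ` V) E (\<lambda>e. h ` g e) Q1 z"
    by (rule IH) (use mgraph_image blossom_image[OF b] in \<open>auto simp: Q1_def\<close>)
  then obtain p where p: "\<forall>J\<in>set_pmf p. join (h ` V) E (\<lambda>e. h ` g e) Q1 J"
    "\<forall>e\<in>E. mean p (\<lambda>J. of_bool (e \<in> J)) = z e" by (auto simp: joinable_def)
  have fp: "finite (set_pmf p)" using p join_finite finE by blast
  \<comment> \<open>In the contracted graph \<open>e\<close> is a loop, whose membership in
    \<open>J\<close> carries no parity information; it is overwritten by the value that makes
    \<open>v\<close> correct.\<close>
  define R where "R J = {e' \<in> E. if e' = e then (f \<in> J) \<noteq> (v \<in> Q) else e' \<in> J}" for J
  have bl: "odd (card F + card ({v} \<inter> Q)) \<Longrightarrow> F \<subseteq> {e, f} \<Longrightarrow>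
      1 \<le> (if e \<in> F then 1 - z e else z e) + (if f \<in> F then 1 - z f else z f)" for F
    using b[unfolded blossom_def, rule_format, of "{v}" F] v ef by simp
  \<comment> \<open>The two sets \<open>F\<close> of the right parity give opposite
    inequalities.\<close>
  have ze: "z e = (if v \<in> Q then 1 - z f else z f)"
    using bl[of "{}"] bl[of "{e}"] bl[of "{f}"] bl[of "{e, f}"] ef(2) by (auto split: if_splits)
  let ?p = "map_pmf R p"
  have "join V E g Q (R J)" if J: "J \<in> set_pmf p" for J
    unfolding join_def
  proof (intro conjI ballI)
    show "R J \<subseteq> E" by (auto simp: R_def)
    have jJ: "join (h ` V) E (\<lambda>e. h ` g e) Q1 J" using p J by blast
    have atv: "odd (card (R J \<inter> dl {v})) \<longleftrightarrow> v \<in> Q"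
    proof -
      have "R J \<inter> dl {v} = (if e \<in> R J then {e} else {}) \<union> (if f \<in> R J then {f} else {})"
        unfolding ef by auto
      moreover have "e \<in> R J \<longleftrightarrow> (f \<in> R J) \<noteq> (v \<in> Q)" using eE fE ef(2) by (auto simp: R_def)
      ultimately show ?thesis using ef(2) by (cases "f \<in> R J") auto
    qed
    have eaway: "e \<notin> dl U" if "v \<in> U \<longleftrightarrow> a \<in> U" for U
      using that mem_cut[OF eE a(1), of U] by simp
    have RJ: "R J \<inter> dl U = J \<inter> dl U" if "v \<in> U \<longleftrightarrow> a \<in> U" for U
      using eaway[OF that] cut_sub[of E g U] by (auto simp: R_def)
    have J1: "odd (card (J \<inter> dl (V \<inter> h -` {w}))) \<longleftrightarrow> odd (card (V \<inter> h -` {w} \<inter> Q))" if "w \<in> h ` V" for w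
      using jJ that by (auto simp: join_def Q1_def cut_image cut_V)
    fix w assume w: "w \<in> V"
    consider "w = v" | "w = a" | "w \<noteq> v" "w \<noteq> a" by blast
    then show "odd (card (R J \<inter> dl {w})) \<longleftrightarrow> w \<in> Q"
    proof cases
      case 1
      show ?thesis unfolding 1 by (rule atv)
    next
      case 2
      have pre: "V \<inter> h -` {a} = {v} \<union> {a}" using a(2,3) v unfolding h_def by (auto split: if_splits)
      have "even (card (R J \<inter> dl ({v} \<union> {a}))) \<longleftrightarrow> (even (card (R J \<inter> dl {v})) \<longleftrightarrow> even (card (R J \<inter> dl {a})))"
        unfolding card_Int_cut using a(3) by (intro even_cut_Un) auto
      moreover have "odd (card (R J \<inter> dl ({v} \<union> {a}))) \<longleftrightarrow> odd (card (({v} \<union> {a}) \<inter> Q))"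
        using J1[of a] RJ[of "{v} \<union> {a}"] unfolding pre using hV a by simp
      moreover have "odd (card (({v} \<union> {a}) \<inter> Q)) \<longleftrightarrow> (v \<in> Q) \<noteq> (a \<in> Q)"
        using a(3) by (cases "v \<in> Q"; cases "a \<in> Q") auto
      ultimately show ?thesis unfolding 2 using atv by argo
    next
      case 3
      have pre: "V \<inter> h -` {w} = {w}" using w 3 unfolding h_def by (auto split: if_splits)
      have "odd (card ({w} \<inter> Q)) \<longleftrightarrow> w \<in> Q" by (simp add: card_Int_singleton)
      then show ?thesis using J1[of w] RJ[of "{w}"] 3 hV w unfolding pre by auto
    qed
  qed
  moreover have "mean ?p (\<lambda>J. of_bool (e' \<in> J)) = z e'" if e': "e' \<in> E" for e'
  proof (cases "e' = e")
    case True
    have "mean p (\<lambda>J. of_bool (e \<in> R J)) = mean p (\<lambda>J. if v \<in> Q then 1 - of_bool (f \<in> J) else of_bool (f \<in> J))"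
      using eE by (intro mean_cong) (auto simp: R_def)
    also have "\<dots> = (if v \<in> Q then 1 - z f else z f)"
      using p(2) fE by (simp add: mean_diff[OF fp])
    finally show ?thesis using True ze by simp
  next
    case False
    then have "mean p (\<lambda>J. of_bool (e' \<in> R J)) = mean p (\<lambda>J. of_bool (e' \<in> J))"
      using e' by (intro mean_cong) (auto simp: R_def)
    then show ?thesis using p(2) e' by simp
  qed
  ultimately show ?thesis unfolding joinable_def by (intro exI[of _ ?p]) auto
qed

text \<open>A join meets a tight parity inequality in exactly one (possibly complemented) edge, and the
  distribution of that edge is read off from the point itself.\<close>

lemma tight_trace:
  assumes D: "finite D" "D \<subseteq> E" "F \<subseteq> D"
    and odd: "\<And>J. J \<in> set_pmf p \<Longrightarrow> odd (card (J \<inter> D) + card F)" and fp: "finite (set_pmf p)"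
    and m: "\<And>e. e \<in> E \<Longrightarrow> mean p (\<lambda>J. of_bool (e \<in> J)) = z e"
    and tight: "(\<Sum>e\<in>D. if e \<in> F then 1 - z e else z e) = 1"
  shows "pmf (map_pmf (\<lambda>J. {e\<in>D. (e \<in> J) \<noteq> (e \<in> F)}) p) S =
    (if \<exists>e\<in>D. S = {e} then \<Sum>e\<in>S. if e \<in> F then 1 - z e else z e else 0)"
proof -
  define sd where "sd J = {e\<in>D. (e \<in> J) \<noteq> (e \<in> F)}" for J
  have fF: "finite F" using D finite_subset by blast
  have m': "mean p (\<lambda>J. of_bool (e \<in> sd J)) = (if e \<in> F then 1 - z e else z e)" if "e \<in> D" for e
  proof -
    have "mean p (\<lambda>J. of_bool (e \<in> sd J)) = mean p (\<lambda>J. if e \<in> F then 1 - of_bool (e \<in> J) else of_bool (e \<in> J))"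
      using that by (intro mean_cong) (auto simp: sd_def)
    then show ?thesis using m[of e] that D by (auto simp: mean_diff[OF fp])
  qed
  have cs: "real (card (sd J)) = (\<Sum>e\<in>D. of_bool (e \<in> sd J))" for J
  proof -
    have "D \<inter> {e. e \<in> sd J} = sd J" by (auto simp: sd_def)
    then show ?thesis using D by simp
  qed
  have "mean p (\<lambda>J. real (card (sd J))) = 1"
    unfolding cs using tight by (simp add: mean_sum[OF fp] m')
  moreover have "real (card (sd J)) \<ge> 1" if "J \<in> set_pmf p" for J
  proof -
    have "sd J = {x \<in> (J \<inter> D) \<union> F. (x \<in> J \<inter> D) \<noteq> (x \<in> F)}" using D by (auto simp: sd_def)
    then have "odd (card (sd J))" using even_card_sym_diff[of "J \<inter> D" F] fF D odd[OF that] by simp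
    then show ?thesis by (cases "card (sd J)") auto
  qed
  ultimately have one: "card (sd J) = 1" if "J \<in> set_pmf p" for J
    using mean_one_imp_eq_one[OF fp, of "\<lambda>J. real (card (sd J))" J] that by simp
  have eq: "pmf (map_pmf sd p) S = mean p (\<lambda>J. of_bool (sd J = S))"
    by (simp add: pmf_eq_mean)
  show ?thesis
  proof (cases "\<exists>e\<in>D. S = {e}")
    case True
    then obtain e where e: "e \<in> D" "S = {e}" by blast
    have "mean p (\<lambda>J. of_bool (sd J = S)) = mean p (\<lambda>J. of_bool (e \<in> sd J))"
    proof (intro mean_cong)
      fix J assume J: "J \<in> set_pmf p"
      obtain x where "sd J = {x}" using one[OF J] by (auto simp: card_1_singleton_iff)
      then show "of_bool (sd J = S) = (of_bool (e \<in> sd J) :: real)" using e by auto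
    qed
    then have "pmf (map_pmf sd p) S = (if e \<in> F then 1 - z e else z e)" using eq m'[OF e(1)] by simp
    then show ?thesis using e(1) unfolding sd_def e(2) by simp
  next
    case False
    have "mean p (\<lambda>J. of_bool (sd J = S)) = mean p (\<lambda>J. 0)"
    proof (intro mean_cong)
      fix J assume J: "J \<in> set_pmf p"
      obtain x where x: "sd J = {x}" using one[OF J] by (auto simp: card_1_singleton_iff)
      then have "x \<in> D" by (auto simp: sd_def)
      then show "of_bool (sd J = S) = (0 :: real)" using x False by auto
    qed
    then have "pmf (map_pmf sd p) S = 0" using eq by simp
    then show ?thesis unfolding sd_def if_not_P[OF False] .
  qed
qed

text \<open>Contracting either side gives a decomposition by induction. By
  \<open>tight_trace\<close> both have the same law on the cut, so they can be coupled to agree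
  there, and the edges inside \<open>U\<close> are taken from one member of the pair, all others
  from the other.\<close>

lemma joinable_tight_cut:
  assumes U: "U \<subseteq> V" "2 \<le> card U" "2 \<le> card (V - U)" and Q: "Q \<subseteq> V" and b: "blossom V E g Q z"
    and F: "F \<subseteq> dl U" "odd (card F + card (U \<inter> Q))" "(\<Sum>e\<in>dl U. if e \<in> F then 1 - z e else z e) = 1"
    and IH: "\<And>(V' :: 'v set) g' Q'. card V' < card V \<Longrightarrow> mgraph V' E g' \<Longrightarrow> Q' \<subseteq> V' \<Longrightarrow> blossom V' E g' Q' z
      \<Longrightarrow> joinable V' E g' Q' z"
  shows "joinable V E g Q z"
proof -
  define T where "T J = {e\<in>dl U. (e \<in> J) \<noteq> (e \<in> F)}" for J
  define tr where "tr S = (if \<exists>e\<in>dl U. S = {e} then \<Sum>e\<in>S. if e \<in> F then 1 - z e else z e else 0)" for S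
  \<comment> \<open>\<open>A\<close> is the side that is shrunk to \<open>u\<close>. Its inner edges
    stay as loops, so the edge set is unchanged; parity is retained at the vertices outside
    \<open>A\<close>.\<close>
  have side: "\<exists>p. finite (set_pmf p) \<and> (\<forall>J\<in>set_pmf p. J \<subseteq> E \<and> (\<forall>v\<in>V - A. odd (card (J \<inter> dl {v})) \<longleftrightarrow> v \<in> Q)) \<and>
     (\<forall>e\<in>E. mean p (\<lambda>J. of_bool (e \<in> J)) = z e) \<and>
     pmf (map_pmf T p) = tr"
    if A: "A \<subseteq> V" "2 \<le> card A" "dl A = dl U" "odd (card F + card (A \<inter> Q))" for A
  proof -
    obtain u where u: "u \<in> A" using A by fastforce
    define h where "h = (\<lambda>x. if x \<in> A then u else x)"
    define Q1 where "Q1 = {w \<in> h ` V. odd (card (V \<inter> h -` {w} \<inter> Q))}"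
    have hV: "h ` V = insert u (V - A)" using A u by (auto simp: h_def)
    have fA: "finite A" using A finV finite_subset by blast
    have "card (h ` V) = Suc (card (V - A))" unfolding hV using u finV by simp
    also have "\<dots> < card V" using A fA card_mono[OF finV A(1)] by (simp add: card_Diff_subset)
    finally have "joinable (h ` V) E (\<lambda>e. h ` g e) Q1 z"
      by (rule IH) (use mgraph_image blossom_image[OF b] in \<open>auto simp: Q1_def\<close>)
    then obtain p where p: "\<forall>J\<in>set_pmf p. join (h ` V) E (\<lambda>e. h ` g e) Q1 J"
      "\<forall>e\<in>E. mean p (\<lambda>J. of_bool (e \<in> J)) = z e" by (auto simp: joinable_def)
    have fp: "finite (set_pmf p)" using p join_finite finE by blast
    have J1: "odd (card (J \<inter> dl (V \<inter> h -` {w}))) \<longleftrightarrow> odd (card (V \<inter> h -` {w} \<inter> Q))"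
      if "w \<in> h ` V" "J \<in> set_pmf p" for w J
      using p that by (auto simp: join_def Q1_def cut_image cut_V)
    have "V \<inter> h -` {u} = A" using A(1) u by (auto simp: h_def split: if_splits)
    then have od: "odd (card (J \<inter> dl U) + card F)" if "J \<in> set_pmf p" for J
      using J1[of u J] that A hV by auto
    have "odd (card (J \<inter> dl {v})) \<longleftrightarrow> v \<in> Q" if "J \<in> set_pmf p" "v \<in> V - A" for J v
    proof -
      have "V \<inter> h -` {v} = {v}" using that(2) u by (auto simp: h_def)
      moreover have "odd (card ({v} \<inter> Q)) \<longleftrightarrow> v \<in> Q" by (simp add: card_Int_singleton)
      ultimately show ?thesis using J1[of v J] that hV by auto
    qed
    moreover have "pmf (map_pmf T p) S = tr S" for S
      unfolding T_def tr_def by (rule tight_trace) (use od p(2) fp F cut_sub[of E g U] in auto)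
    ultimately show ?thesis using fp p by (intro exI[of _ p]) (auto simp: join_def fun_eq_iff)
  qed
  obtain p where p: "finite (set_pmf p)" "\<forall>J\<in>set_pmf p. J \<subseteq> E \<and> (\<forall>v\<in>V - U. odd (card (J \<inter> dl {v})) \<longleftrightarrow> v \<in> Q)"
    "\<forall>e\<in>E. mean p (\<lambda>J. of_bool (e \<in> J)) = z e"
    "pmf (map_pmf T p) = tr"
    using side[OF U(1,2) refl F(2)] by blast
  have "odd (card F + card ((V - U) \<inter> Q))"
  proof -
    have "card Q = card (Q \<inter> U) + card (Q - U)" using card_Int_Diff Q finV finite_subset by blast
    moreover have "(V - U) \<inter> Q = Q - U" using Q by auto
    ultimately show ?thesis using blossom_even[OF b Q] F(2) by (auto simp: Int_commute)
  qed
  from side[OF Diff_subset U(3) cut_compl this] obtain q where q: "finite (set_pmf q)" "\<forall>J\<in>set_pmf q. J \<subseteq> E \<and> (\<forall>v\<in>V - (V - U). odd (card (J \<inter> dl {v})) \<longleftrightarrow> v \<in> Q)"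
    "\<forall>e\<in>E. mean q (\<lambda>J. of_bool (e \<in> J)) = z e"
    "pmf (map_pmf T q) = tr"
    by blast
  have "map_pmf T p = map_pmf T q" using p(4) q(4) by (intro pmf_eqI) simp
  then obtain pq where pq: "map_pmf fst pq = p" "map_pmf snd pq = q"
    "\<And>x y. (x, y) \<in> set_pmf pq \<Longrightarrow> x \<in> set_pmf p \<and> y \<in> set_pmf q \<and> T x = T y"
    by (rule pmf_coupling) blast
  define R where "R = (\<lambda>(J, K). {e \<in> E. if g e \<subseteq> U then e \<in> K else e \<in> J})"
  have RJ: "join V E g Q (R (J, K))" if JK: "(J, K) \<in> set_pmf pq" for J K
    unfolding join_def
  proof (intro conjI ballI)
    show "R (J, K) \<subseteq> E" by (auto simp: R_def)
    have agree: "e \<in> J \<longleftrightarrow> e \<in> K" if "e \<in> dl U" for e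
      using pq(3)[OF JK] that by (auto simp: T_def)
    fix v assume v: "v \<in> V"
    show "odd (card (R (J, K) \<inter> dl {v})) \<longleftrightarrow> v \<in> Q"
    proof (cases "v \<in> U")
      case True
      have "R (J, K) \<inter> dl {v} = K \<inter> dl {v}"
        using agree True by (auto simp: R_def cut_def)
      then show ?thesis using q(2) pq(3)[OF JK] True v by auto
    next
      case False
      have "R (J, K) \<inter> dl {v} = J \<inter> dl {v}"
        using False by (auto simp: R_def cut_def)
      then show ?thesis using p(2) pq(3)[OF JK] False v by auto
    qed
  qed
  moreover have "mean (map_pmf R pq) (\<lambda>J. of_bool (e \<in> J)) = z e" if e: "e \<in> E" for e
  proof (cases "g e \<subseteq> U")
    case True
    have "mean (map_pmf R pq) (\<lambda>J. of_bool (e \<in> J)) = mean pq (\<lambda>x. of_bool (e \<in> snd x))"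
      unfolding integral_map_pmf using e True by (intro mean_cong) (auto simp: R_def)
    also have "\<dots> = mean q (\<lambda>J. of_bool (e \<in> J))" unfolding pq(2)[symmetric] by simp
    finally show ?thesis using q(3) e by simp
  next
    case False
    have "mean (map_pmf R pq) (\<lambda>J. of_bool (e \<in> J)) = mean pq (\<lambda>x. of_bool (e \<in> fst x))"
      unfolding integral_map_pmf using e False by (intro mean_cong) (auto simp: R_def)
    also have "\<dots> = mean p (\<lambda>J. of_bool (e \<in> J))" unfolding pq(1)[symmetric] by simp
    finally show ?thesis using p(3) e by simp
  qed
  ultimately show ?thesis unfolding joinable_def by (intro exI[of _ "map_pmf R pq"]) auto
qed

end

section \<open>The join polytope: counting tight constraints\<close>

context mgraph
begin

text \<open>With these coefficients the blossom inequality of \<open>(U, F)\<close> reads z(F) -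
  z(cut minus F) \<le> |F| - 1, the upper-bound form that \<open>feasible\<close> expects.\<close>

definition cf :: "'v set \<Rightarrow> 'e set \<Rightarrow> 'e \<Rightarrow> real" where
  "cf U F e = (if e \<in> dl U then (if e \<in> F then 1 else -1) else 0)"

definition joincons :: "'v set \<Rightarrow> (('e \<Rightarrow> real) \<times> real) set" where
  "joincons Q = (\<lambda>e. (\<lambda>e'. if e' = e then -1 else 0, 0)) ` E \<union> (\<lambda>e. (\<lambda>e'. if e' = e then 1 else 0, 1)) ` E \<union>
     (\<lambda>(U, F). (cf U F, real (card F) - 1)) ` {(U, F). U \<subseteq> V \<and> F \<subseteq> dl U \<and> odd (card F + card (U \<inter> Q))}"

lemma finite_joincons: "finite (joincons Q)"
proof -
  have "{(U, F). U \<subseteq> V \<and> F \<subseteq> dl U \<and> odd (card F + card (U \<inter> Q))} \<subseteq> Pow V \<times> Pow E"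
    using cut_sub[of E g] by auto
  then have "finite {(U, F). U \<subseteq> V \<and> F \<subseteq> dl U \<and> odd (card F + card (U \<inter> Q))}"
    by (rule finite_subset) (use finV finE in auto)
  then show ?thesis unfolding joincons_def using finE by blast
qed

lemma cf_sum: "(\<Sum>e\<in>E. cf U F e * d e) = (\<Sum>e\<in>dl U. if e \<in> F then d e else - d e)"
proof -
  have "(\<Sum>e\<in>E. cf U F e * d e) = (\<Sum>e\<in>E. if e \<in> dl U then (if e \<in> F then d e else - d e) else 0)"
    by (intro sum.cong) (auto simp: cf_def)
  also have "\<dots> = (\<Sum>e\<in>E \<inter> dl U. if e \<in> F then d e else - d e)"
    using finE by (simp add: sum.inter_restrict)
  finally show ?thesis by (simp add: Int_absorb1 cut_sub)
qed

lemma cf_sum_val: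
  assumes "F \<subseteq> dl U"
  shows "(\<Sum>e\<in>E. cf U F e * z e) = real (card F) - (\<Sum>e\<in>dl U. if e \<in> F then 1 - z e else z e)"
proof -
  have "(\<Sum>e\<in>dl U. if e \<in> F then z e else - z e) =
      (\<Sum>e\<in>dl U. (if e \<in> F then 1 else 0) - (if e \<in> F then 1 - z e else z e))"
    by (intro sum.cong) auto
  also have "\<dots> = (\<Sum>e\<in>dl U. if e \<in> F then 1 else 0) - (\<Sum>e\<in>dl U. if e \<in> F then 1 - z e else z e)"
    by (rule sum_subtractf)
  also have "(\<Sum>e\<in>dl U. if e \<in> F then 1 else 0) = (\<Sum>e\<in>dl U \<inter> F. 1::real)"
    by (subst sum.inter_restrict) auto
  also have "dl U \<inter> F = F" using assms by blast
  finally show ?thesis unfolding cf_sum by simp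
qed

lemma delta_sum: "e \<in> E \<Longrightarrow> (\<Sum>e'\<in>E. (if e' = e then c else 0) * (d e' :: real)) = c * d e"
  using finE by (simp add: if_distrib[of "\<lambda>x. x * _"] sum.delta cong: if_cong)

lemma feasible_joincons:
  "feasible E (joincons Q) z \<longleftrightarrow> (\<forall>e\<in>E. 0 \<le> z e \<and> z e \<le> 1) \<and> blossom V E g Q z"
proof -
  have a: "(\<forall>(a, b)\<in>(\<lambda>e. (\<lambda>e'. if e' = e then -1 else 0, 0)) ` E. (\<Sum>e\<in>E. a e * z e) \<le> b) \<longleftrightarrow> (\<forall>e\<in>E. 0 \<le> z e)"
    by (simp add: delta_sum)
  have b: "(\<forall>(a, b)\<in>(\<lambda>e. (\<lambda>e'. if e' = e then 1 else 0, 1)) ` E. (\<Sum>e\<in>E. a e * z e) \<le> b) \<longleftrightarrow> (\<forall>e\<in>E. z e \<le> 1)"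
    by (simp add: delta_sum)
  have c: "(\<forall>(a, b)\<in>(\<lambda>(U, F). (cf U F, real (card F) - 1)) ` {(U, F). U \<subseteq> V \<and> F \<subseteq> dl U \<and> odd (card F + card (U \<inter> Q))}.
      (\<Sum>e\<in>E. a e * z e) \<le> b) \<longleftrightarrow> blossom V E g Q z"
    unfolding blossom_def by (auto simp: cf_sum_val)
  show ?thesis unfolding feasible_def joincons_def ball_Un a b c by blast
qed

lemma sum_degree: "(\<Sum>v\<in>V. card (dl {v})) \<le> 2 * card E"
proof -
  have c: "card (dl {v}) = (\<Sum>e\<in>E. of_bool (e \<in> dl {v}))" for v
    using finE by (simp add: Int_absorb1 cut_sub)
  have "(\<Sum>v\<in>V. card (dl {v})) = (\<Sum>e\<in>E. \<Sum>v\<in>V. of_bool (e \<in> dl {v}))"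
    unfolding c by (rule sum.swap)
  also have "\<dots> \<le> (\<Sum>e\<in>E. 2)"
  proof (rule sum_mono)
    fix e assume e: "e \<in> E"
    have "(\<Sum>v\<in>V. of_bool (e \<in> dl {v})) = card (V \<inter> {v. e \<in> dl {v}})" using finV by simp
    also have "\<dots> \<le> card (g e)"
      using ends[OF e] finV finite_subset by (intro card_mono) (auto simp: cut_def)
    finally show "(\<Sum>v\<in>V. of_bool (e \<in> dl {v})) \<le> (2::nat)" using ends[OF e] by linarith
  qed
  finally show ?thesis by simp
qed

text \<open>Add the two tight equations, with total 2. Each edge of the symmetric difference
  contributes z + (1 - z) = 1, every other edge of the cut something positive. The difference has
  even size, so if it is nonempty it has two edges and is the whole cut, contrary to degree
  three.\<close>

lemma tight_vertex_unique:
  assumes z: "\<And>e. e \<in> E \<Longrightarrow> 0 < z e \<and> z e < 1" and deg: "card (dl {v}) \<ge> 3"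
    and F: "F \<subseteq> dl {v}" "odd (card F + k)" "(\<Sum>e\<in>dl {v}. if e \<in> F then 1 - z e else z e) = (1::real)"
    and G: "G \<subseteq> dl {v}" "odd (card G + k)" "(\<Sum>e\<in>dl {v}. if e \<in> G then 1 - z e else z e) = 1"
  shows "F = G"
proof (rule ccontr)
  assume ne: "F \<noteq> G"
  define D where "D = {x \<in> F \<union> G. (x \<in> F) \<noteq> (x \<in> G)}"
  have fin: "finite F" "finite G" using F G fin_cut finite_subset by blast+
  then have fD: "finite D" and Dsub: "D \<subseteq> dl {v}" using F G by (auto simp: D_def)
  have "even (card D)" unfolding D_def using even_card_sym_diff[OF fin] F G by auto
  moreover have "D \<noteq> {}" using ne by (auto simp: D_def)
  ultimately have D2: "card D \<ge> 2" using fD by (metis One_nat_def card_0_eq even_zero less_2_cases not_le odd_one)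
  define w where "w e = (if e \<in> F then 1 - z e else z e) + (if e \<in> G then 1 - z e else z e)" for e
  have wpos: "w e > 0" if "e \<in> dl {v}" for e using z[of e] that cut_sub[of E g "{v}"] by (auto simp: w_def)
  have wD: "w e = 1" if "e \<in> D" for e using that by (auto simp: w_def D_def)
  have tot: "sum w (dl {v}) = 2" using F(3) G(3) by (simp add: w_def sum.distrib)
  have split: "sum w (dl {v}) = sum w (dl {v} - D) + card D"
    using sum.subset_diff[OF Dsub fin_cut, of w] wD by simp
  show False
  proof (cases "dl {v} - D = {}")
    case True
    then have "D = dl {v}" using Dsub by blast
    then show False using split tot deg by simp
  next
    case False
    then have "sum w (dl {v} - D) > 0" using wpos by (intro sum_pos) auto
    then show False using split tot D2 by simp
  qed
qed

text \<open>Every tight blossom inequality comes from a single vertex or the complement of one, and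
  \<open>tight_vertex_unique\<close> allows one per vertex. Vertices with a nonempty cut have degree
  at least three, so 3 |N| \<le> 2 |E|: there are fewer equations than edges.\<close>

lemma not_rigid_joincons:
  assumes Q: "Q \<subseteq> V" and b: "blossom V E g Q z" and ne: "E \<noteq> {}"
    and z: "\<And>e. e \<in> E \<Longrightarrow> 0 < z e \<and> z e < 1"
    and deg2: "\<And>v. v \<in> V \<Longrightarrow> card (dl {v}) \<noteq> 2"
    and notight: "\<And>U F. U \<subseteq> V \<Longrightarrow> 2 \<le> card U \<Longrightarrow> 2 \<le> card (V - U) \<Longrightarrow> F \<subseteq> dl U \<Longrightarrow> odd (card F + card (U \<inter> Q))
      \<Longrightarrow> (\<Sum>e\<in>dl U. if e \<in> F then 1 - z e else z e) \<noteq> 1"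
  shows "\<not> rigid E (joincons Q) z"
proof -
  define N where "N = {v\<in>V. dl {v} \<noteq> {}}"
  define tt where "tt v F \<longleftrightarrow> F \<subseteq> dl {v} \<and> odd (card F + card ({v} \<inter> Q)) \<and>
     (\<Sum>e\<in>dl {v}. if e \<in> F then 1 - z e else z e) = 1" for v F
  \<comment> \<open>The tight set at \<open>v\<close> is unique if it exists; otherwise
    \<open>SOME\<close> merely adds one harmless extra equation.\<close>
  define a where "a v = cf {v} (SOME F. tt v F)" for v
  have deg3: "card (dl {v}) \<ge> 3" if "v \<in> N" for v
  proof -
    have vV: "v \<in> V" and "card (dl {v}) \<noteq> 0" using that by (auto simp: N_def)
    \<comment> \<open>At a vertex of degree one the blossom inequality would force the value of its
      edge to be 0 or 1.\<close>
    moreover have "card (dl {v}) \<noteq> 1"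
    proof
      assume "card (dl {v}) = 1"
      then obtain e where e: "dl {v} = {e}" by (auto simp: card_1_singleton_iff)
      then have "e \<in> E" using cut_sub[of E g "{v}"] by auto
      then have ze: "0 < z e \<and> z e < 1" by (rule z)
      have "1 \<le> (if e \<in> F then 1 - z e else z e)" if "F \<subseteq> {e}" "odd (card F + card ({v} \<inter> Q))" for F
        using b[unfolded blossom_def, rule_format, of "{v}" F] vV that unfolding e by simp
      from this[of "{}"] this[of "{e}"] show False using ze by (cases "v \<in> Q") auto
    qed
    ultimately show ?thesis using deg2[OF vV] by linarith
  qed
  have "card N * 3 \<le> (\<Sum>v\<in>N. card (dl {v}))"
    using sum_bounded_below[of N 3 "\<lambda>v. card (dl {v})"] deg3 by simp
  also have "\<dots> \<le> (\<Sum>v\<in>V. card (dl {v}))"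
    using finV by (intro sum_mono2) (auto simp: N_def)
  also have "\<dots> \<le> 2 * card E" by (rule sum_degree)
  finally have "card N < card E" using ne finE card_0_eq[of E] by (cases "card N = 0") auto
  moreover have "card (a ` N) \<le> card N" using finV by (intro card_image_le) (auto simp: N_def)
  ultimately have "card (a ` N) < card E" by linarith
  moreover have "finite (a ` N)" using finV by (auto simp: N_def)
  ultimately obtain d where d: "\<exists>e\<in>E. d e \<noteq> 0" "\<forall>c\<in>a ` N. (\<Sum>e\<in>E. c e * d e) = 0"
    using homogeneous_system_nontrivial[OF finE, of "a ` N"] by blast
  have tt_unique: "F = G" if "v \<in> N" "tt v F" "tt v G" for v F G
    by (rule tight_vertex_unique[of z v F "card ({v} \<inter> Q)"], fact z, rule deg3[OF that(1)])
      (use that(2,3) in \<open>unfold tt_def, blast+\<close>)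
  have vert: "(\<Sum>e\<in>E. cf {v} F e * d e) = 0" if "v \<in> V" "tt v F" for v F
  proof (cases "v \<in> N")
    case True
    have "tt v (SOME F. tt v F)" using that(2) by (rule someI)
    then have "F = (SOME F. tt v F)" by (rule tt_unique[OF True that(2)])
    then have "a v = cf {v} F" by (simp add: a_def)
    then show ?thesis using d(2) True by auto
  next
    case False
    then show ?thesis using that by (simp add: cf_sum N_def)
  qed
  have cuts: "(\<Sum>e\<in>E. cf U F e * d e) = 0"
    if UF: "U \<subseteq> V" "F \<subseteq> dl U" "odd (card F + card (U \<inter> Q))" "(\<Sum>e\<in>dl U. if e \<in> F then 1 - z e else z e) = 1" for U F
  proof -
    have fU: "finite U" using UF finV finite_subset by blast
    have "dl U \<noteq> {}" using UF(4) by auto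
    then have "U \<noteq> {}" "V - U \<noteq> {}" using cut_compl[of U] cut_empty[of E g] by metis+
    then have "card U \<noteq> 0" "card (V - U) \<noteq> 0" using fU finV by auto
    then consider "card U = 1" | "card (V - U) = 1"
      using notight[OF UF(1) _ _ UF(2,3)] UF(4) by linarith
    then show ?thesis
    proof cases
      case 1
      then obtain v where v: "U = {v}" by (auto simp: card_1_singleton_iff)
      then show ?thesis using UF vert[of v F] by (simp add: tt_def)
    next
      case 2
      then obtain v where v: "V - U = {v}" by (auto simp: card_1_singleton_iff)
      have dv: "dl {v} = dl U" using cut_compl[of U] v by simp
      \<comment> \<open>\<open>Q\<close> has even size, so a set and its complement impose the same
        parity on \<open>F\<close>.\<close>
      have "card Q = card (Q \<inter> U) + card (Q - U)" using card_Int_Diff Q finV finite_subset by blast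
      moreover have "{v} \<inter> Q = Q - U" using Q v by auto
      ultimately have "odd (card F + card ({v} \<inter> Q))"
        using blossom_even[OF b Q] UF(3) by (auto simp: Int_commute)
      then have "tt v F" using UF unfolding tt_def dv by blast
      moreover have "cf {v} F = cf U F" using dv by (auto simp: cf_def)
      moreover have "v \<in> V" using v by blast
      ultimately show ?thesis using vert[of v F] by simp
    qed
  qed
  have "\<forall>(a, b)\<in>joincons Q. (\<Sum>e\<in>E. a e * z e) = b \<longrightarrow> (\<Sum>e\<in>E. a e * d e) = 0"
    unfolding joincons_def ball_Un
  proof (intro conjI)
    show "\<forall>(a, b)\<in>(\<lambda>e. (\<lambda>e'. if e' = e then - 1 else 0, 0)) ` E.
       (\<Sum>e\<in>E. a e * z e) = b \<longrightarrow> (\<Sum>e\<in>E. a e * d e) = 0"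
      using z by (simp add: delta_sum) fastforce
    show "\<forall>(a, b)\<in>(\<lambda>e. (\<lambda>e'. if e' = e then 1 else 0, 1)) ` E.
       (\<Sum>e\<in>E. a e * z e) = b \<longrightarrow> (\<Sum>e\<in>E. a e * d e) = 0"
      using z by (simp add: delta_sum) fastforce
    show "\<forall>(a, b)\<in>(\<lambda>(U, F). (cf U F, real (card F) - 1)) ` {(U, F). U \<subseteq> V \<and> F \<subseteq> dl U \<and> odd (card F + card (U \<inter> Q))}.
       (\<Sum>e\<in>E. a e * z e) = b \<longrightarrow> (\<Sum>e\<in>E. a e * d e) = 0"
      using cuts by (clarsimp simp: cf_sum_val)
  qed
  then show ?thesis using d(1) unfolding rigid_def by blast
qed

end

text \<open>By convexity only rigid points matter. If edges remain,
  \<open>not_rigid_joincons\<close> leaves an edge of value 0 or 1, a vertex of degree two, or a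
  tight cut with two vertices on each side, and each of these leads to a smaller graph. This is the
  Edmonds-Johnson description of the join polytope inside the unit cube.\<close>

theorem joinable_if_blossom:
  fixes V :: "'v set" and E :: "'e set"
  assumes "mgraph V E g" "Q \<subseteq> V" "\<forall>e\<in>E. 0 \<le> z e \<and> z e \<le> 1" "blossom V E g Q z"
  shows "joinable V E g Q z"
  using assms
proof (induction "card V + card E" arbitrary: V E g Q z rule: less_induct)
  case less
  interpret mgraph V E g by fact
  have "feasible E (joincons Q) z" using less by (simp add: feasible_joincons)
  from finE finite_joincons[of Q] this show ?case
  proof (induction rule: polytope_induct)
    case (bounded x e)
    then show ?case by (simp add: feasible_joincons)
  next
    case (mix x y t)
    then show ?case by (rule joinable_mix)
  next
    case (rigid y)
    then have y01: "\<forall>e\<in>E. 0 \<le> y e \<and> y e \<le> 1" and b: "blossom V E g Q y" by (auto simp: feasible_joincons)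
    have IH: "joinable V' E g' Q' y" if "card V' < card V" "mgraph V' E g'" "Q' \<subseteq> V'" "blossom V' E g' Q' y" for V' :: "'v set" and g' Q'
      by (rule less.hyps) (use that y01 in auto)
    show ?case
    proof (cases "E = {}")
      case True
      have "v \<notin> Q" if "v \<in> V" for v
        using b[unfolded blossom_def, rule_format, of "{v}" "{}"] that True by (auto simp: cut_def)
      then have "join V E g Q {}" by (simp add: join_def)
      then show ?thesis using True unfolding joinable_def by (intro exI[of _ "return_pmf {}"]) auto
    next
      case ne: False
      show ?thesis
      proof (cases "\<exists>e\<in>E. y e = 0 \<or> y e = 1")
        case True
        then obtain e where e: "e \<in> E" "y e = 0 \<or> y e = 1" by blast
        show ?thesis
        proof (rule joinable_delete[OF e less.prems(2) b])
          fix Q' assume "Q' \<subseteq> V" "blossom V (E - {e}) g Q' y"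
          moreover have "card V + card (E - {e}) < card V + card E"
            using card_Diff1_less[OF finE e(1)] by simp
          ultimately show "joinable V (E - {e}) g Q' y"
            using y01 by (intro less.hyps mgraph_delete) auto
        qed
      next
        case False
        then have z: "0 < y e \<and> y e < 1" if "e \<in> E" for e using y01 that by (metis antisym_conv1)
        show ?thesis
        proof (cases "\<exists>v\<in>V. card (dl {v}) = 2")
          case True
          then obtain v e f where "v \<in> V" "dl {v} = {e, f}" "e \<noteq> f" by (auto simp: card_2_iff)
          then show ?thesis using IH by (rule joinable_degree_two[OF _ _ _ less.prems(2) b])
        next
          case nd: False
          show ?thesis
          proof (cases "\<exists>U F. U \<subseteq> V \<and> 2 \<le> card U \<and> 2 \<le> card (V - U) \<and> F \<subseteq> dl U \<and> odd (card F + card (U \<inter> Q))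
              \<and> (\<Sum>e\<in>dl U. if e \<in> F then 1 - y e else y e) = 1")
            case True
            then obtain U F where "U \<subseteq> V" "2 \<le> card U" "2 \<le> card (V - U)" "F \<subseteq> dl U" "odd (card F + card (U \<inter> Q))"
              "(\<Sum>e\<in>dl U. if e \<in> F then 1 - y e else y e) = 1" by blast
            then show ?thesis using IH by (rule joinable_tight_cut[OF _ _ _ less.prems(2) b])
          next
            case False
            then have "\<not> rigid E (joincons Q) y"
              using nd by (intro not_rigid_joincons[OF less.prems(2) b ne z]) blast+
            then show ?thesis using rigid by blast
          qed
        qed
      qed
    qed
  qed
qed

section \<open>Spanning connected sets with prescribed pairs\<close>

text \<open>Parts of size at least two give at most |X|/2 equations per family. If \<P> misses an
  element of \<open>X\<close>, the system has fewer equations than unknowns; otherwise both families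
  partition \<open>X\<close> and one equation follows from the rest. This count is the core of
  matroid intersection.\<close>

lemma two_partitions_circulation:
  fixes X :: "'e set"
  assumes X: "finite X" "X \<noteq> {}" and B: "\<Union>\<B> = X" "disjoint \<B>" "\<And>B. B \<in> \<B> \<Longrightarrow> 2 \<le> card B"
    and P: "\<Union>\<P> \<subseteq> X" "disjoint \<P>" "\<And>P. P \<in> \<P> \<Longrightarrow> 2 \<le> card P"
  shows "\<exists>d :: 'e \<Rightarrow> real. (\<exists>e\<in>X. d e \<noteq> 0) \<and> (\<forall>e. e \<notin> X \<longrightarrow> d e = 0) \<and> (\<forall>B\<in>\<B> \<union> \<P>. sum d B = 0)"
proof -
  have sub: "A \<subseteq> X" if "A \<in> \<B> \<union> \<P>" for A using that B P by blast
  have finA: "finite A" if "A \<in> \<B> \<union> \<P>" for A using sub[OF that] X finite_subset by blast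
  have fBP: "finite \<B>" "finite \<P>" using B P X
    by (metis finite_UnionD) (metis P(1) X(1) finite_UnionD finite_subset)
  have cB: "2 * card \<B> \<le> card X"
  proof -
    have "card X = sum card \<B>" using card_Union_disjoint[of \<B>] B finA by (auto simp: disjoint_def pairwise_def disjnt_def)
    then show ?thesis using sum_bounded_below[of \<B> 2 card] B(3) by simp
  qed
  have cP: "2 * card \<P> \<le> card (\<Union>\<P>)"
  proof -
    have "card (\<Union>\<P>) = sum card \<P>" using card_Union_disjoint[of \<P>] P finA by (auto simp: disjoint_def pairwise_def disjnt_def)
    then show ?thesis using sum_bounded_below[of \<P> 2 card] P(3) by simp
  qed
  have solve: "\<exists>d :: 'e \<Rightarrow> real. (\<exists>e\<in>X. d e \<noteq> 0) \<and> (\<forall>e. e \<notin> X \<longrightarrow> d e = 0) \<and> (\<forall>A\<in>\<A>. sum d A = 0)"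
    if \<A>: "finite \<A>" "card \<A> < card X" "\<A> \<subseteq> \<B> \<union> \<P>" for \<A>
  proof -
    let ?C = "(\<lambda>A e. of_bool (e \<in> A) :: real) ` \<A>"
    have "card ?C < card X" using card_image_le[OF \<A>(1)] \<A>(2) le_less_trans by blast
    from homogeneous_system_nontrivial[OF X(1) finite_imageI[OF \<A>(1)] this]
    obtain d where d: "\<exists>e\<in>X. d e \<noteq> 0" "\<forall>e. e \<notin> X \<longrightarrow> d e = 0" "\<forall>a\<in>?C. (\<Sum>e\<in>X. a e * d e) = 0"
      by (elim exE conjE)
    have "sum d A = 0" if A: "A \<in> \<A>" for A
    proof -
      have "A \<subseteq> X" using A \<A>(3) sub by blast
      then have "sum d A = sum d (X \<inter> A)" by (simp add: Int_absorb1)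
      also have "\<dots> = (\<Sum>e\<in>X. if e \<in> A then d e else 0)" using X(1) by (rule sum.inter_restrict)
      also have "\<dots> = (\<Sum>e\<in>X. of_bool (e \<in> A) * d e)" by (intro sum.cong) auto
      also have "\<dots> = 0" by (rule bspec[OF d(3) imageI[OF A]])
      finally show ?thesis .
    qed
    then show ?thesis using d by blast
  qed
  show ?thesis
  proof (cases "\<Union>\<P> = X")
    case False
    then have "card (\<Union>\<P>) < card X" using P(1) X(1) by (intro psubset_card_mono) auto
    then have "card (\<B> \<union> \<P>) < card X" using cB cP card_Un_le[of \<B> \<P>] by linarith
    then show ?thesis using solve[of "\<B> \<union> \<P>"] fBP by auto
  next
    case True
    \<comment> \<open>The equation of \<open>B0\<close> is left out: d(X) is the sum over \<P>,
      hence zero, and the other parts of \<B> sum to zero.\<close>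
    obtain B0 where B0: "B0 \<in> \<B>" using B(1) X(2) by blast
    have "card (\<B> - {B0}) < card \<B>" using B0 fBP by (meson card_Diff1_less)
    then have "card ((\<B> - {B0}) \<union> \<P>) < card X"
      using cB cP card_Un_le[of "\<B> - {B0}" \<P>] unfolding True by linarith
    then obtain d :: "'e \<Rightarrow> real" where d: "\<exists>e\<in>X. d e \<noteq> 0" "\<forall>e. e \<notin> X \<longrightarrow> d e = 0"
      "\<forall>A\<in>(\<B> - {B0}) \<union> \<P>. sum d A = 0"
      using solve[of "(\<B> - {B0}) \<union> \<P>"] fBP by blast
    have "sum d X = sum (sum d) \<P>"
      unfolding True[symmetric] using P finA by (subst sum.Union_disjoint) (auto simp: disjoint_def)
    then have "sum d X = 0" using d(3) by simp
    moreover have "sum d X = sum (sum d) \<B>"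
      unfolding B(1)[symmetric] using B finA by (subst sum.Union_disjoint) (auto simp: disjoint_def)
    moreover have "sum (sum d) \<B> = sum d B0 + sum (sum d) (\<B> - {B0})"
      using fBP(1) B0 by (rule sum.remove)
    moreover have "sum (sum d) (\<B> - {B0}) = 0" using d(3) by (intro sum.neutral) auto
    ultimately have "sum d B0 = 0" by simp
    then show ?thesis using d by blast
  qed
qed

text \<open>On the edges inside \<open>N\<close> the point \<open>t\<close> lies in the spanning
  tree polytope; edges with an end outside \<open>N\<close>, in the application those at the root,
  are kept as well.\<close>

locale forest_point =
  fixes E :: "'e set" and g :: "'e \<Rightarrow> 'v set" and N :: "'v set" and t :: "'e \<Rightarrow> real"
  assumes finE: "finite E" and finN: "finite N" and N0: "N \<noteq> {}"
    and ends: "e \<in> E \<Longrightarrow> g e \<noteq> {}"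
    and t01: "e \<in> E \<Longrightarrow> 0 \<le> t e \<and> t e \<le> 1"
    and indep: "S \<subseteq> N \<Longrightarrow> S \<noteq> {} \<Longrightarrow> sum t (inner E g S) \<le> card S - 1"
    and spanning: "sum t (inner E g N) = card N - 1"
begin

abbreviation ins :: "'v set \<Rightarrow> 'e set" where "ins \<equiv> inner E g"

definition TS :: "'v set set" where
  "TS = {S. S \<subseteq> N \<and> S \<noteq> {} \<and> sum t (ins S) = card S - 1}"

definition X :: "'e set" where "X = {e \<in> E. 0 < t e \<and> t e < 1}"

lemma fin_ins [simp]: "finite (ins S)"
  using finE by (simp add: inner_def)

lemma finX: "finite X" using finE by (simp add: X_def)

lemma TS_D: "S \<in> TS \<Longrightarrow> S \<subseteq> N \<and> S \<noteq> {} \<and> finite S \<and> sum t (ins S) = real (card S) - 1"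
  using finN card_gt_0_iff[of S] by (auto simp: TS_def intro: finite_subset)

text \<open>The weight inside a set is supermodular and the cardinality is modular, so both bounds
  hold with equality and the edges that are inside the union but inside neither set have total
  weight zero.\<close>

lemma uncross:
  assumes "A \<in> TS" "B \<in> TS" "A \<inter> B \<noteq> {}"
  shows "A \<union> B \<in> TS \<and> A \<inter> B \<in> TS \<and> (\<forall>e\<in>ins (A \<union> B). t e > 0 \<longrightarrow> e \<in> ins A \<or> e \<in> ins B)"
proof -
  note A = TS_D[OF assms(1)] and B = TS_D[OF assms(2)]
  have int: "ins A \<inter> ins B = ins (A \<inter> B)" by (auto simp: inner_def)
  have un: "ins A \<union> ins B \<subseteq> ins (A \<union> B)" by (auto simp: inner_def)
  have "sum t (ins A) + sum t (ins B) = sum t (ins A \<union> ins B) + sum t (ins (A \<inter> B))"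
    unfolding int[symmetric] by (simp add: sum.union_inter)
  moreover have "sum t (ins (A \<union> B)) = sum t (ins (A \<union> B) - (ins A \<union> ins B)) + sum t (ins A \<union> ins B)"
    using un by (intro sum.subset_diff) auto
  moreover have nonneg: "0 \<le> sum t (ins (A \<union> B) - (ins A \<union> ins B))"
    using t01 by (intro sum_nonneg) (auto simp: inner_def)
  moreover have "sum t (ins (A \<union> B)) \<le> real (card (A \<union> B)) - 1" "sum t (ins (A \<inter> B)) \<le> real (card (A \<inter> B)) - 1"
    using indep[of "A \<union> B"] indep[of "A \<inter> B"] A B assms(3) card_gt_0_iff[of "A \<union> B"] card_gt_0_iff[of "A \<inter> B"] by auto
  moreover have "card A + card B = card (A \<union> B) + card (A \<inter> B)"
    using A B by (intro card_Un_Int) auto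
  ultimately have "sum t (ins (A \<union> B)) = real (card (A \<union> B)) - 1" "sum t (ins (A \<inter> B)) = real (card (A \<inter> B)) - 1"
    and z: "sum t (ins (A \<union> B) - (ins A \<union> ins B)) = 0"
    using A B by linarith+
  then have "A \<union> B \<in> TS" "A \<inter> B \<in> TS"
    using A B assms(3) card_gt_0_iff[of "A \<union> B"] card_gt_0_iff[of "A \<inter> B"] by (auto simp: TS_def)
  moreover have "t e = 0" if "e \<in> ins (A \<union> B) - (ins A \<union> ins B)" for e
  proof -
    have "finite (ins (A \<union> B) - (ins A \<union> ins B))" by simp
    moreover have "0 \<le> t x" if "x \<in> ins (A \<union> B) - (ins A \<union> ins B)" for x
      using that t01 by (auto simp: inner_def)
    ultimately show ?thesis using z that sum_nonneg_eq_0_iff by blast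
  qed
  ultimately show ?thesis by force
qed

text \<open>By uncrossing, a tight set of least size around \<open>e\<close> is contained in all
  others (\<open>ins_iff_mS\<close>). Hence \<open>mS\<close> partitions the edges into classes, and
  the edges inside a tight set form a union of classes.\<close>

definition mS :: "'e \<Rightarrow> 'v set" where
  "mS e = (ARG_MIN card S. S \<in> TS \<and> e \<in> ins S)"

lemma N_TS: "N \<in> TS" using N0 spanning by (simp add: TS_def)

lemma mS_TS:
  assumes "e \<in> ins N"
  shows "mS e \<in> TS" "e \<in> ins (mS e)"
  using arg_min_natI[of "\<lambda>S. S \<in> TS \<and> e \<in> ins S" N card] N_TS assms by (auto simp: mS_def)

lemma ins_iff_mS:
  assumes e: "e \<in> ins N" and S: "S \<in> TS"
  shows "e \<in> ins S \<longleftrightarrow> mS e \<subseteq> S"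
proof
  assume eS: "e \<in> ins S"
  note m = mS_TS[OF e]
  have "mS e \<inter> S \<noteq> {}" using eS m ends[of e] by (auto simp: inner_def)
  then have "mS e \<inter> S \<in> TS" using uncross m S by blast
  moreover have "e \<in> ins (mS e \<inter> S)" using eS m by (auto simp: inner_def)
  ultimately have "card (mS e) \<le> card (mS e \<inter> S)"
    unfolding mS_def by (intro arg_min_nat_le) auto
  then have "mS e \<inter> S = mS e" using TS_D[OF m(1)] by (intro card_seteq) auto
  then show "mS e \<subseteq> S" by blast
next
  assume "mS e \<subseteq> S"
  then show "e \<in> ins S" using mS_TS[OF e] by (auto simp: inner_def)
qed

lemma sum_frac_int:
  assumes "A \<subseteq> E" "sum t A \<in> \<int>"
  shows "sum t (X \<inter> A) \<in> \<int>"
proof -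
  have fA: "finite A" using assms finE finite_subset by blast
  have "sum t A = sum t (A - X \<inter> A) + sum t (X \<inter> A)"
    using fA by (intro sum.subset_diff) auto
  moreover have "sum t (A - X \<inter> A) \<in> \<int>"
  proof (rule Ints_sum)
    fix e assume "e \<in> A - X \<inter> A"
    then have "t e = 0 \<or> t e = 1" using t01[of e] assms by (force simp: X_def)
    then show "t e \<in> \<int>" by auto
  qed
  ultimately show ?thesis using assms(2) by (metis Ints_diff add_diff_cancel_left')
qed

lemma frac_TS_int: "S \<in> TS \<Longrightarrow> sum t (X \<inter> ins S) \<in> \<int>"
  using TS_D[of S] by (intro sum_frac_int inner_sub) auto

definition cls :: "'v set \<Rightarrow> 'e set" where
  "cls M = {e \<in> X \<inter> ins N. mS e = M}"

lemma frac_two: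
  assumes "B \<subseteq> X" "B \<noteq> {}" "sum t B \<in> \<int>"
  shows "2 \<le> card B"
proof (rule ccontr)
  assume "\<not> 2 \<le> card B"
  moreover have "finite B" using assms finX finite_subset by blast
  ultimately have "card B = 1" using assms card_0_eq[of B] by linarith
  then obtain e where "B = {e}" by (auto simp: card_1_singleton_iff)
  then have "t e \<in> \<int>" "0 < t e" "t e < 1" using assms by (auto simp: X_def)
  then show False by (auto elim!: Ints_cases)
qed

text \<open>The fractional edges inside the tight set \<open>M\<close> are the class of
  \<open>M\<close> together with those inside disjoint smaller tight sets. All these tight sets have
  integral fractional weight, so the class has integral weight too, and one fractional edge alone
  cannot achieve that.\<close>

lemma cls_two:
  assumes e0: "e0 \<in> X \<inter> ins N"
  shows "2 \<le> card (cls (mS e0))"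
proof (rule frac_two)
  define M where "M = mS e0"
  have e0N: "e0 \<in> ins N" and te0: "t e0 > 0" using e0 by (auto simp: X_def)
  note m = mS_TS[OF e0N, folded M_def]
  \<comment> \<open>Asking the sets to miss \<open>e0\<close>, and not just to be proper subsets of
    \<open>M\<close>, makes the family closed under unions of intersecting members: an edge of
    positive weight inside the union is inside one of the two. So the maximal members are
    disjoint.\<close>
  define L0 where "L0 = {L \<in> TS. L \<subseteq> M \<and> e0 \<notin> ins L}"
  define Lm where "Lm = {L \<in> L0. \<forall>K\<in>L0. L \<subseteq> K \<longrightarrow> K = L}"
  have fL0: "finite L0" using TS_D[OF m(1)] by (auto simp: L0_def intro: rev_finite_subset[of "Pow M"])
  then have fLm: "finite Lm" by (simp add: Lm_def)
  have disj: "L1 \<inter> L2 = {}" if L: "L1 \<in> Lm" "L2 \<in> Lm" "L1 \<noteq> L2" for L1 L2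
  proof (rule ccontr)
    assume ne: "L1 \<inter> L2 \<noteq> {}"
    have T: "L1 \<in> TS" "L2 \<in> TS" using L by (auto simp: Lm_def L0_def)
    have LL: "L1 \<union> L2 \<in> L0" using uncross[OF T ne] L te0 by (auto simp: Lm_def L0_def)
    have max: "K = L" if "L \<in> Lm" "K \<in> L0" "L \<subseteq> K" for K L using that by (simp add: Lm_def)
    show False using max[OF L(1) LL Un_upper1] max[OF L(2) LL Un_upper2] L(3) by (metis)
  qed
  have cover: "X \<inter> ins M = cls M \<union> (\<Union>L\<in>Lm. X \<inter> ins L)"
  proof (intro equalityI subsetI)
    fix f assume f: "f \<in> X \<inter> ins M"
    have fN: "f \<in> ins N" using f TS_D[OF m(1)] by (auto simp: inner_def)
    have fM: "mS f \<subseteq> M" using f ins_iff_mS[OF fN m(1)] by blast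
    show "f \<in> cls M \<union> (\<Union>L\<in>Lm. X \<inter> ins L)"
    proof (cases "mS f = M")
      case True
      then show ?thesis using f fN by (simp add: cls_def)
    next
      case False
      then have "e0 \<notin> ins (mS f)"
        using ins_iff_mS[OF e0N mS_TS(1)[OF fN]] fM by (auto simp: M_def)
      then have "mS f \<in> L0" using fM mS_TS[OF fN] by (simp add: L0_def)
      then obtain L where "L \<in> L0" "mS f \<subseteq> L" "\<forall>K\<in>L0. L \<subseteq> K \<longrightarrow> L = K"
        using finite_has_maximal2[OF fL0] by blast
      then have "L \<in> Lm" "f \<in> ins L" using ins_iff_mS[OF fN] by (auto simp: Lm_def L0_def)
      then show ?thesis using f by blast
    qed
  next
    fix f assume "f \<in> cls M \<union> (\<Union>L\<in>Lm. X \<inter> ins L)"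
    then consider "f \<in> cls M" | L where "L \<in> Lm" "f \<in> X \<inter> ins L" by blast
    then show "f \<in> X \<inter> ins M"
    proof cases
      case 1
      then show ?thesis using mS_TS[of f] by (auto simp: cls_def)
    next
      case 2
      then show ?thesis by (auto simp: Lm_def L0_def inner_def)
    qed
  qed
  have dc: "cls M \<inter> (\<Union>L\<in>Lm. X \<inter> ins L) = {}"
  proof -
    have False if f: "f \<in> cls M" and L: "L \<in> Lm" "f \<in> ins L" for f L
    proof -
      have "M \<subseteq> L" using ins_iff_mS[of f L] f L by (auto simp: cls_def Lm_def L0_def)
      then have "e0 \<in> ins L" using m by (auto simp: inner_def)
      then show False using L by (auto simp: Lm_def L0_def)
    qed
    then show ?thesis by blast
  qed
  have fc: "finite (cls M)" using finX by (auto simp: cls_def intro: rev_finite_subset)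
  have "sum t (X \<inter> ins M) = sum t (cls M) + sum t (\<Union>L\<in>Lm. X \<inter> ins L)"
    unfolding cover by (rule sum.union_disjoint) (use fc fLm dc in auto)
  also have "sum t (\<Union>L\<in>Lm. X \<inter> ins L) = (\<Sum>L\<in>Lm. sum t (X \<inter> ins L))"
  proof (rule sum.UNION_disjoint)
    show "\<forall>i\<in>Lm. \<forall>j\<in>Lm. i \<noteq> j \<longrightarrow> X \<inter> ins i \<inter> (X \<inter> ins j) = {}"
    proof (intro ballI impI)
      fix i j assume "i \<in> Lm" "j \<in> Lm" "i \<noteq> j"
      then have "i \<inter> j = {}" by (rule disj)
      then show "X \<inter> ins i \<inter> (X \<inter> ins j) = {}" using ends by (fastforce simp: inner_def)
    qed
  qed (use fLm in auto)
  finally have "sum t (cls M) = sum t (X \<inter> ins M) - (\<Sum>L\<in>Lm. sum t (X \<inter> ins L))" by simp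
  moreover have "(\<Sum>L\<in>Lm. sum t (X \<inter> ins L)) \<in> \<int>"
    by (rule Ints_sum) (auto simp: Lm_def L0_def intro: frac_TS_int)
  ultimately show "sum t (cls (mS e0)) \<in> \<int>" using frac_TS_int[OF m(1)] by (simp add: M_def)
  show "cls (mS e0) \<subseteq> X" "cls (mS e0) \<noteq> {}" using e0 by (auto simp: cls_def)
qed

text \<open>The fractional edges split into classes by their minimal tight set. Together with the pairs
  this gives two families of disjoint sets of size at least two, which support a perturbation.\<close>

lemma perturbation:
  assumes X0: "X \<noteq> {}" and R: "R \<subseteq> E - ins N" "sum t R = 1" and W: "\<And>e. e \<in> E - ins N - R \<Longrightarrow> t e = 1"
    and P: "disjoint \<P>" "\<And>P. P \<in> \<P> \<Longrightarrow> P \<subseteq> E \<and> sum t P = 1"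
  shows "\<exists>d :: 'e \<Rightarrow> real. (\<exists>e\<in>X. d e \<noteq> 0) \<and> (\<forall>e. e \<notin> X \<longrightarrow> d e = 0) \<and> (\<forall>S\<in>TS. sum d (ins S) = 0) \<and>
    (\<forall>P\<in>insert R \<P>. sum d P = 0)"
proof -
  define BN where "BN = cls ` mS ` (X \<inter> ins N)"
  \<comment> \<open>\<open>R\<close> is disjoint from the edges inside \<open>N\<close>, and edges
    outside both have value 1, so the classes and \<open>R\<close> together partition the fractional
    edges.\<close>
  define B where "B = BN \<union> (if X \<inter> R = {} then {} else {X \<inter> R})"
  define P' where "P' = {X \<inter> P | P. P \<in> \<P> \<and> X \<inter> P \<noteq> {}}"
  have Xsplit: "X \<subseteq> ins N \<union> R" using W by (force simp: X_def)
  have BN_ins: "A \<subseteq> X \<inter> ins N" if "A \<in> BN" for A using that by (auto simp: BN_def cls_def)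
  have "\<Union>BN = X \<inter> ins N" by (auto simp: BN_def cls_def)
  then have UB: "\<Union>B = X" using Xsplit by (auto simp: B_def)
  have dBN: "disjoint BN" by (auto simp: BN_def disjoint_def cls_def)
  have "A \<inter> (X \<inter> R) = {}" if "A \<in> BN" for A using BN_ins[OF that] R(1) by blast
  then have dB: "disjoint B" using dBN by (auto simp: B_def disjoint_def Int_commute)
  have two: "2 \<le> card A" if "A \<in> B" for A
  proof (cases "A \<in> BN")
    case True
    then show ?thesis using cls_two by (auto simp: BN_def)
  next
    case False
    then have "A = X \<inter> R" "X \<inter> R \<noteq> {}" using that by (auto simp: B_def split: if_splits)
    then show ?thesis using R sum_frac_int[of R] by (intro frac_two) auto
  qed
  have PA: "\<Union>P' \<subseteq> X" by (auto simp: P'_def)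
  have PB: "disjoint P'" using P(1) unfolding P'_def disjoint_def by blast
  have PC: "2 \<le> card A" if AP: "A \<in> P'" for A
  proof -
    obtain P where P': "A = X \<inter> P" "P \<in> \<P>" "X \<inter> P \<noteq> {}" using AP by (auto simp: P'_def)
    then show ?thesis using P(2)[OF P'(2)] sum_frac_int[of P] by (intro frac_two) auto
  qed
  have "\<exists>d :: 'e \<Rightarrow> real. (\<exists>e\<in>X. d e \<noteq> 0) \<and> (\<forall>e. e \<notin> X \<longrightarrow> d e = 0) \<and> (\<forall>A\<in>B \<union> P'. sum d A = 0)"
    by (rule two_partitions_circulation[OF finX X0 UB dB _ PA PB]) (use two PC in auto)
  then obtain d :: "'e \<Rightarrow> real" where d: "\<exists>e\<in>X. d e \<noteq> 0" "\<forall>e. e \<notin> X \<longrightarrow> d e = 0" "\<forall>A\<in>B \<union> P'. sum d A = 0"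
    by (elim exE conjE)
  have restr: "sum d A = sum d (X \<inter> A)" if "A \<subseteq> E" for A
    using d(2) that finE finite_subset by (intro sum.mono_neutral_right) auto
  have "sum d (ins S) = 0" if S: "S \<in> TS" for S
  proof -
    define B' where "B' = {A \<in> BN. A \<subseteq> ins S}"
    have SN: "ins S \<subseteq> ins N" using TS_D[OF S] by (auto simp: inner_def)
    have "X \<inter> ins S = \<Union>B'"
    proof (intro equalityI subsetI)
      fix f assume f: "f \<in> X \<inter> ins S"
      have "cls (mS f) \<subseteq> ins S"
        using f SN ins_iff_mS[OF _ S] by (auto simp: cls_def)
      then show "f \<in> \<Union>B'" using f SN by (auto simp: B'_def BN_def cls_def)
    qed (use BN_ins in \<open>auto simp: B'_def\<close>)
    moreover have "sum d (\<Union>B') = sum (sum d) B'"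
    proof (subst sum.Union_disjoint)
      show "\<forall>A\<in>B'. finite A" using BN_ins finX by (auto simp: B'_def intro: finite_subset)
      show "\<forall>A\<in>B'. \<forall>B\<in>B'. A \<noteq> B \<longrightarrow> A \<inter> B = {}" using dBN by (auto simp: B'_def disjoint_def)
    qed simp
    moreover have "sum (sum d) B' = 0" using d(3) by (intro sum.neutral) (auto simp: B'_def B_def)
    ultimately show ?thesis using restr[of "ins S"] inner_sub[of E g S] by simp
  qed
  moreover have "sum d R = 0"
  proof (cases "X \<inter> R = {}")
    case True
    then show ?thesis using restr[of R] R by auto
  next
    case False
    then have "X \<inter> R \<in> B" by (simp add: B_def)
    then show ?thesis using restr[of R] R d(3) by auto
  qed
  moreover have "sum d P = 0" if "P \<in> \<P>" for P
  proof (cases "X \<inter> P = {}")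
    case True
    then show ?thesis using restr[of P] P(2)[OF that] by auto
  next
    case False
    then have "X \<inter> P \<in> P'" using that by (auto simp: P'_def)
    then show ?thesis using restr[of P] P(2)[OF that] d(3) by auto
  qed
  ultimately show ?thesis using d(1,2) by (intro exI[of _ d]) auto
qed

end

section \<open>Integrality of spanning connected sets with prescribed pairs\<close>

definition set_cons :: "(real \<times> 'e set \<times> real) set \<Rightarrow> (('e \<Rightarrow> real) \<times> real) set" where
  "set_cons D = (\<lambda>(c, A, b). (\<lambda>e. c * of_bool (e \<in> A), b)) ` D"

lemma set_cons_sum:
  fixes t :: "'e \<Rightarrow> real"
  assumes "finite E" "A \<subseteq> E"
  shows "(\<Sum>e\<in>E. c * of_bool (e \<in> A) * t e) = c * sum t A"
proof -
  have "(\<Sum>e\<in>E. c * of_bool (e \<in> A) * t e) = (\<Sum>e\<in>E. if e \<in> A then c * t e else 0)"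
    by (intro sum.cong) auto
  also have "\<dots> = (\<Sum>e\<in>E \<inter> A. c * t e)" using assms(1) by (simp add: sum.inter_restrict)
  finally show ?thesis using assms(2) by (simp add: Int_absorb1 sum_distrib_left)
qed

lemma feasible_set_cons:
  assumes "finite E" "\<And>c A b. (c, A, b) \<in> D \<Longrightarrow> A \<subseteq> E"
  shows "feasible E (set_cons D) t \<longleftrightarrow> (\<forall>(c, A, b)\<in>D. c * sum t A \<le> b)"
proof -
  have "(\<Sum>e\<in>E. c * of_bool (e \<in> A) * t e) = c * sum t A" if "(c, A, b) \<in> D" for c A b
    by (rule set_cons_sum[OF assms(1) assms(2)[OF that]])
  then show ?thesis unfolding feasible_def set_cons_def by (auto split: prod.splits)
qed

lemma rigid_set_cons:
  fixes t d :: "'e \<Rightarrow> real"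
  assumes "finite E" "\<And>c A b. (c, A, b) \<in> D \<Longrightarrow> A \<subseteq> E" and r: "rigid E (set_cons D) t"
    and d: "\<And>c A b. (c, A, b) \<in> D \<Longrightarrow> c * sum t A = b \<Longrightarrow> sum d A = 0" and e: "e \<in> E"
  shows "d e = 0"
proof -
  have "(\<Sum>e\<in>E. c * of_bool (e \<in> A) * d e) = 0"
    if D: "(c, A, b) \<in> D" and eq: "(\<Sum>e\<in>E. c * of_bool (e \<in> A) * t e) = b" for c A b
  proof -
    have A: "A \<subseteq> E" using D assms(2) by blast
    have "sum d A = 0" using d[OF D] eq unfolding set_cons_sum[OF assms(1) A] by blast
    then show ?thesis unfolding set_cons_sum[OF assms(1) A] by simp
  qed
  then have "\<forall>(a, b)\<in>set_cons D. (\<Sum>e\<in>E. a e * t e) = b \<longrightarrow> (\<Sum>e\<in>E. a e * d e) = 0"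
    unfolding set_cons_def by (auto split: prod.splits)
  then show ?thesis using r e unfolding rigid_def by blast
qed

text \<open>Connectivity of \<open>T\<close> on \<open>N\<close> is stated through cuts, the form in
  which tours are compared and glued later.\<close>

definition rainbow :: "'e set \<Rightarrow> ('e \<Rightarrow> 'v set) \<Rightarrow> 'v set \<Rightarrow> 'e set \<Rightarrow> 'e set set \<Rightarrow> 'e set \<Rightarrow> bool" where
  "rainbow E g N W \<P> T \<longleftrightarrow> T \<subseteq> E \<and> W \<subseteq> T \<and> (\<forall>P\<in>\<P>. card (T \<inter> P) = 1) \<and>
     (\<forall>S\<subseteq>N. S \<noteq> {} \<longrightarrow> S \<noteq> N \<longrightarrow> (\<exists>e\<in>T. g e \<subseteq> N \<and> e \<in> cut E g S))"

text \<open>Matroid intersection: spanning trees of \<open>N\<close> with one edge of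
  \<open>R\<close> on one side, the partition into pairs on the other. At a rigid point a fractional
  edge would allow the direction from \<open>perturbation\<close>, so rigid points are 0/1
  vectors.\<close>

theorem rainbow_decomposition:
  fixes x :: "'e \<Rightarrow> real" and g :: "'e \<Rightarrow> 'v set"
  assumes finE: "finite E" and finN: "finite N" and N0: "N \<noteq> {}" and ends: "\<And>e. e \<in> E \<Longrightarrow> g e \<noteq> {}"
    and x01: "\<And>e. e \<in> E \<Longrightarrow> 0 \<le> x e \<and> x e \<le> 1"
    and indep: "\<And>S. S \<subseteq> N \<Longrightarrow> S \<noteq> {} \<Longrightarrow> sum x (inner E g S) \<le> real (card S) - 1"
    and spanning: "sum x (inner E g N) = real (card N) - 1"
    and R: "R \<subseteq> E - inner E g N" "sum x R = 1" and W: "W \<subseteq> E" "\<And>e. e \<in> W \<Longrightarrow> x e = 1" "E - inner E g N - R \<subseteq> W"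
    and P: "disjoint \<P>" "\<And>P. P \<in> \<P> \<Longrightarrow> P \<subseteq> E \<and> sum x P = 1"
  shows "\<exists>p. (\<forall>T\<in>set_pmf p. rainbow E g N W (insert R \<P>) T) \<and> (\<forall>e\<in>E. mean p (\<lambda>T. of_bool (e \<in> T)) = x e)"
proof -
  \<comment> \<open>Equations are encoded as two opposite inequalities, so that they are tight at
    every feasible point.\<close>
  define D :: "(real \<times> 'e set \<times> real) set" where "D = (\<lambda>e. (-1, {e}, 0)) ` E \<union> (\<lambda>e. (1, {e}, 1)) ` E \<union> (\<lambda>e. (-1, {e}, -1)) ` W \<union>
     (\<lambda>S. (1, inner E g S, real (card S) - 1)) ` (Pow N - {{}}) \<union> {(-1, inner E g N, 1 - real (card N))} \<union>
     (\<lambda>P. (1, P, 1)) ` insert R \<P> \<union> (\<lambda>P. (-1, P, -1)) ` insert R \<P>"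
  have "\<P> \<subseteq> Pow E" using P by blast
  then have "finite \<P>" using finE finite_subset by blast
  then have finD: "finite D" using finE finN W(1) unfolding D_def by (auto intro: finite_subset)
  have PE: "P \<subseteq> E" if "P \<in> insert R \<P>" for P using that P R by blast
  have DE: "A \<subseteq> E" if "(c, A, b) \<in> D" for c A b
    using that W(1) PE inner_sub[of E g] unfolding D_def by blast
  have fs: "feasible E (set_cons D) t \<longleftrightarrow> (\<forall>(c, A, b)\<in>D. c * sum t A \<le> b)" for t
    by (rule feasible_set_cons[OF finE]) (rule DE)
  have feas: "feasible E (set_cons D) t \<longleftrightarrow> (\<forall>e\<in>E. 0 \<le> t e \<and> t e \<le> 1) \<and> (\<forall>e\<in>W. 1 \<le> t e) \<and>
     (\<forall>S\<in>Pow N - {{}}. sum t (inner E g S) \<le> real (card S) - 1) \<and> sum t (inner E g N) \<ge> real (card N) - 1 \<and>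
     (\<forall>P\<in>insert R \<P>. sum t P = 1)" for t
    unfolding fs unfolding D_def ball_Un by (auto simp: algebra_simps intro: antisym)
  have finp: "finite (set_pmf p)" if "\<forall>T\<in>set_pmf p. rainbow E g N W (insert R \<P>) T" for p
    by (rule finite_subset[of _ "Pow E"]) (use that finE in \<open>auto simp: rainbow_def\<close>)
  have fD: "finite (set_cons D)" using finD by (simp add: set_cons_def)
  have "feasible E (set_cons D) x"
    unfolding feas using x01 W indep spanning P R by auto
  from finE fD this show ?thesis
  proof (induction rule: polytope_induct)
    case (bounded t e)
    then show ?case using feas by blast
  next
    case (mix y z t)
    then obtain p q where p: "\<forall>T\<in>set_pmf p. rainbow E g N W (insert R \<P>) T" "\<forall>e\<in>E. mean p (\<lambda>T. of_bool (e \<in> T)) = y e"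
      and q: "\<forall>T\<in>set_pmf q. rainbow E g N W (insert R \<P>) T" "\<forall>e\<in>E. mean q (\<lambda>T. of_bool (e \<in> T)) = z e" by blast
    let ?r = "bind_pmf (bernoulli_pmf t) (\<lambda>b. if b then p else q)"
    have "set_pmf ?r \<subseteq> set_pmf p \<union> set_pmf q" by (auto split: if_splits)
    then have "\<forall>J\<in>set_pmf ?r. rainbow E g N W (insert R \<P>) J" using p q by blast
    moreover have "\<forall>e\<in>E. mean ?r (\<lambda>J. of_bool (e \<in> J)) = t * y e + (1 - t) * z e"
      unfolding mean_mix[OF finp[OF p(1)] finp[OF q(1)] mix(3,4)] using p q by simp
    ultimately show ?case by blast
  next
    case (rigid t)
    have f: "\<And>e. e \<in> E \<Longrightarrow> 0 \<le> t e \<and> t e \<le> 1" "\<And>e. e \<in> W \<Longrightarrow> 1 \<le> t e"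
      "\<And>S. S \<subseteq> N \<Longrightarrow> S \<noteq> {} \<Longrightarrow> sum t (inner E g S) \<le> real (card S) - 1" "sum t (inner E g N) \<ge> real (card N) - 1"
      "\<And>P. P \<in> insert R \<P> \<Longrightarrow> sum t P = 1"
      using rigid(1) unfolding feas by auto
    have span: "sum t (inner E g N) = real (card N) - 1" using f(3)[of N] f(4) N0 by simp
    have tW: "t e = 1" if "e \<in> W" for e using f(1)[of e] f(2)[of e] that W(1) by force
    have cN: "card S \<ge> 1" if "S \<subseteq> N" "S \<noteq> {}" for S
      using that finN card_gt_0_iff[of S] finite_subset[of S N] by fastforce
    interpret forest_point E g N t
      by standard (use finE finN N0 ends f span cN in \<open>auto simp: of_nat_diff\<close>)
    have X0: "X = {}"
    proof (rule ccontr)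
      assume ne: "X \<noteq> {}"
      have "\<exists>d :: 'e \<Rightarrow> real. (\<exists>e\<in>X. d e \<noteq> 0) \<and> (\<forall>e. e \<notin> X \<longrightarrow> d e = 0) \<and> (\<forall>S\<in>TS. sum d (inner E g S) = 0) \<and>
        (\<forall>P\<in>insert R \<P>. sum d P = 0)"
        by (rule perturbation[OF ne R(1) _ _ P(1)]) (use f(5) tW W(3) P(2) in auto)
      then obtain d :: "'e \<Rightarrow> real" where d: "\<exists>e\<in>X. d e \<noteq> 0" "\<forall>e. e \<notin> X \<longrightarrow> d e = 0" "\<forall>S\<in>TS. sum d (inner E g S) = 0"
        "\<forall>P\<in>insert R \<P>. sum d P = 0" by (elim exE conjE)
      have "d e = 0" if "e \<in> E" for e
      proof (rule rigid_set_cons[OF finE _ rigid(2) _ that])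
        show "A \<subseteq> E" if "(c, A, b) \<in> D" for c A b using that by (rule DE)
        fix c A b assume D: "(c, A, b) \<in> D" and eq: "c * sum t A = b"
        have single: "sum d {e} = 0" if "t e = 0 \<or> t e = 1" for e
          using d(2) that by (auto simp: X_def)
        from D show "sum d A = 0"
          unfolding D_def
        proof (elim UnE imageE singletonE)
          fix e assume "(c, A, b) = (- 1, {e}, 0)"
          then show ?thesis using single[of e] eq by simp
        next
          fix e assume "(c, A, b) = (1, {e}, 1)"
          then show ?thesis using single[of e] eq by simp
        next
          fix e assume "(c, A, b) = (- 1, {e}, - 1)"
          then show ?thesis using single[of e] eq by simp
        next
          fix S assume S: "(c, A, b) = (1, inner E g S, real (card S) - 1)" "S \<in> Pow N - {{}}"
          then have "S \<in> TS" using eq cN[of S] by (simp add: TS_def of_nat_diff)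
          then show ?thesis using d(3) S by simp
        next
          assume "(c, A, b) = (- 1, inner E g N, 1 - real (card N))"
          then show ?thesis using d(3) N_TS by simp
        next
          fix P assume "(c, A, b) = (1, P, 1)" "P \<in> insert R \<P>"
          then show ?thesis using d(4) by blast
        next
          fix P assume "(c, A, b) = (- 1, P, - 1)" "P \<in> insert R \<P>"
          then show ?thesis using d(4) by blast
        qed
      qed
      then show False using d(1) by (auto simp: X_def)
    qed
    then have t01': "t e = 0 \<or> t e = 1" if "e \<in> E" for e using f(1)[OF that] that by (force simp: X_def)
    define T where "T = {e \<in> E. t e = 1}"
    have sT: "sum t A = real (card (T \<inter> A))" if A: "A \<subseteq> E" for A
    proof -
      have fA: "finite A" using A finE finite_subset by blast
      have "sum t A = (\<Sum>e\<in>A. if e \<in> T then 1 else 0)"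
        using t01' A by (intro sum.cong) (auto simp: T_def)
      also have "\<dots> = (\<Sum>e\<in>A \<inter> T. 1)" using fA by (subst sum.inter_restrict) auto
      finally show ?thesis by (simp add: Int_commute)
    qed
    have "rainbow E g N W (insert R \<P>) T"
      unfolding rainbow_def
    proof (intro conjI ballI allI impI)
      show "T \<subseteq> E" by (auto simp: T_def)
      show "W \<subseteq> T" using W(1) tW by (auto simp: T_def)
      show "card (T \<inter> P) = 1" if P: "P \<in> insert R \<P>" for P
        using sT[OF PE[OF P]] f(5)[OF P] by simp
      fix S assume S: "S \<subseteq> N" "S \<noteq> {}" "S \<noteq> N"
      \<comment> \<open>At most |S| - 1 and |N - S| - 1 edges lie inside the two parts, one less in
        total than inside \<open>N\<close>, so some edge of \<open>T\<close> crosses.\<close>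
      have "sum t (inner E g S) + sum t (inner E g (N - S)) \<le> real (card S) - 1 + (real (card (N - S)) - 1)"
        using f(3)[of S] f(3)[of "N - S"] S by (intro add_mono) auto
      also have "real (card S) + real (card (N - S)) = real (card N)"
        using S finN by (metis card_Diff_subset card_mono finite_subset le_add_diff_inverse of_nat_add)
      ultimately have "sum t (inner E g S) + sum t (inner E g (N - S)) < sum t (inner E g N)"
        using span by simp
      moreover have "sum t (inner E g S \<union> inner E g (N - S)) \<le> sum t (inner E g S) + sum t (inner E g (N - S))"
        using f(1) by (subst sum_Un) (auto simp: inner_def intro!: sum_nonneg finE)
      moreover have "inner E g S \<union> inner E g (N - S) \<subseteq> inner E g N" using S by (auto simp: inner_def)
      ultimately have "sum t (inner E g N - (inner E g S \<union> inner E g (N - S))) \<noteq> 0"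
        using sum.subset_diff[of "inner E g S \<union> inner E g (N - S)" "inner E g N" t] fin_ins by auto
      then have "\<exists>e\<in>inner E g N - (inner E g S \<union> inner E g (N - S)). t e \<noteq> 0" by (meson sum.neutral)
      then obtain e where e: "e \<in> inner E g N" "e \<notin> inner E g S" "e \<notin> inner E g (N - S)" "t e \<noteq> 0" by blast
      then have "e \<in> T" using t01'[of e] by (auto simp: T_def inner_def)
      moreover have "e \<in> cut E g S" "g e \<subseteq> N" using e S by (auto simp: inner_def cut_def)
      ultimately show "\<exists>e\<in>T. g e \<subseteq> N \<and> e \<in> cut E g S" by blast
    qed
    moreover have "of_bool (e \<in> T) = t e" if "e \<in> E" for e using t01'[OF that] that by (auto simp: T_def)
    ultimately show ?case by (intro exI[of _ "return_pmf T"]) auto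
  qed
qed

text \<open>An element with the least \<open>m\<close> has all its conflicts among elements of at
  least that \<open>m\<close>, so at most four; it is coloured after the others.\<close>

lemma greedy_colouring:
  fixes m :: "'a \<Rightarrow> nat"
  assumes "finite I" "\<And>e. e \<in> I \<Longrightarrow> card {f\<in>I. conf e f \<and> m e \<le> m f} \<le> 4" "\<And>e f. conf e f \<Longrightarrow> conf f e" "\<And>e. \<not> conf e e"
  shows "\<exists>c :: 'a \<Rightarrow> nat. (\<forall>e\<in>I. c e < 5) \<and> (\<forall>e\<in>I. \<forall>f\<in>I. conf e f \<longrightarrow> c e \<noteq> c f)"
  using assms
proof (induction "card I" arbitrary: I)
  case 0
  then show ?case by auto
next
  case (Suc k)
  then have "I \<noteq> {}" by auto
  then obtain e where e: "e \<in> I" "\<And>f. f \<in> I \<Longrightarrow> m e \<le> m f"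
    using ex_is_arg_min_if_finite[OF Suc(3), of m] by (force simp: is_arg_min_linorder)
  have le4: "card {f \<in> I - {e}. conf e' f \<and> m e' \<le> m f} \<le> 4" if "e' \<in> I - {e}" for e'
  proof -
    have le4: "card {f \<in> I - {e}. conf e' f \<and> m e' \<le> m f} \<le> card {f \<in> I. conf e' f \<and> m e' \<le> m f}"
      using Suc by (intro card_mono) auto
    also have "\<dots> \<le> 4" using Suc that by blast
    finally show ?thesis .
  qed
  have k: "k = card (I - {e})" and fin: "finite (I - {e})" using Suc(2,3) e by auto
  from Suc(1)[OF k fin le4 Suc(5,6)] obtain c :: "'a \<Rightarrow> nat" where c: "\<forall>e'\<in>I - {e}. c e' < 5" "\<forall>e'\<in>I - {e}. \<forall>f\<in>I - {e}. conf e' f \<longrightarrow> c e' \<noteq> c f"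
    by blast
  have "{f \<in> I. conf e f \<and> m e \<le> m f} = {f \<in> I. conf e f}" using e by auto
  then have "card (c ` {f \<in> I. conf e f}) \<le> 4"
    using Suc(4)[OF e(1)] card_image_le[of "{f \<in> I. conf e f}" c] Suc by simp
  then have "\<not> {..<5} \<subseteq> c ` {f \<in> I. conf e f}"
    using card_mono[of "c ` {f \<in> I. conf e f}" "{..<5::nat}"] Suc by auto
  then obtain k where k: "k < 5" "k \<notin> c ` {f \<in> I. conf e f}" by blast
  then have "\<forall>f\<in>I. conf e f \<or> conf f e \<longrightarrow> c f \<noteq> k" using Suc(5) by blast
  then show ?case using c k(1) Suc(6) e by (intro exI[of _ "c(e := k)"]) auto
qed

section \<open>Support graphs of theta-cyclic points and the colouring of their 1-edges\<close>

lemma sum_restrict_subset: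
  assumes "finite E" "A \<subseteq> E"
  shows "(\<Sum>e\<in>E. if e \<in> A then f e else 0) = sum f A"
  using sum.inter_restrict[OF assms(1), of f A] assms(2) by (simp add: Int_absorb1)

text \<open>This is the support of a \<theta>-cyclic point as a multigraph, without reference to the
  complete graph, so that the class is closed under contracting small cuts
  (\<open>theta_graph_contract\<close>).\<close>

locale theta_graph = mgraph V E g for V :: "'v set" and E :: "'e set" and g +
  fixes x :: "'e \<Rightarrow> real" and \<theta> :: real
  assumes theta: "0 < \<theta>" "\<theta> \<le> 1/2"
    and loopless: "e \<in> E \<Longrightarrow> card (g e) = 2"
    and V2: "2 \<le> card V"
    and vertex: "v \<in> V \<Longrightarrow> (\<exists>e f. e \<noteq> f \<and> dl {v} = {e, f} \<and> x e = 1 \<and> x f = 1) \<or>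
      (\<exists>e h k. e \<noteq> h \<and> e \<noteq> k \<and> h \<noteq> k \<and> dl {v} = {e, h, k} \<and> x e = 1 \<and> x h = \<theta> \<and> x k = 1 - \<theta>)"
    and cut_ge: "U \<subseteq> V \<Longrightarrow> U \<noteq> {} \<Longrightarrow> U \<noteq> V \<Longrightarrow> 2 \<le> sum x (dl U)"
begin

definition W :: "'e set" where "W = {e \<in> E. x e = 1}"
definition H :: "'e set" where "H = {e \<in> E. x e < 1}"

lemma edge_ends:
  assumes "e \<in> E"
  obtains a b where "g e = {a, b}" "a \<in> V" "b \<in> V" "a \<noteq> b"
proof -
  obtain a b where ab: "g e = {a, b}" "a \<in> V" "b \<in> V" by (rule ends_pair[OF assms])
  then have "a \<noteq> b" using loopless[OF assms] by auto
  then show ?thesis using ab that by blast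
qed

lemma mem_vertex_cut: "e \<in> E \<Longrightarrow> e \<in> dl {v} \<longleftrightarrow> v \<in> g e"
  by (rule edge_ends[of e]) (auto simp: mem_cut)

lemma x_values: assumes "e \<in> E" shows "x e = 1 \<or> x e = \<theta> \<or> x e = 1 - \<theta>"
proof -
  obtain a b where ab: "g e = {a, b}" "a \<in> V" "b \<in> V" "a \<noteq> b" by (rule edge_ends[OF assms])
  then have "e \<in> dl {a}" using mem_vertex_cut[OF assms] by simp
  then show ?thesis using vertex[OF ab(2)] by auto
qed

lemma x_pos: "e \<in> E \<Longrightarrow> 0 < x e" using x_values[of e] theta by auto
lemma x_le1: "e \<in> E \<Longrightarrow> x e \<le> 1" using x_values[of e] theta by auto

lemma WH: "W \<union> H = E" "W \<inter> H = {}"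
  using x_le1 by (force simp: W_def H_def)+

lemma H_values: "e \<in> H \<Longrightarrow> x e = \<theta> \<or> x e = 1 - \<theta>"
  using x_values[of e] by (auto simp: H_def)

lemma finW: "finite W" and finH: "finite H"
  using finE by (simp_all add: W_def H_def)

definition cubic :: "'v \<Rightarrow> bool" where "cubic v \<longleftrightarrow> card (dl {v}) = 3"

lemma cubicE:
  assumes "v \<in> V" "cubic v"
  obtains e h k where "e \<noteq> h" "e \<noteq> k" "h \<noteq> k" "dl {v} = {e, h, k}" "x e = 1" "x h = \<theta>" "x k = 1 - \<theta>"
    "dl {v} \<inter> W = {e}" "dl {v} \<inter> H = {h, k}"
proof -
  obtain e h k where *: "e \<noteq> h" "e \<noteq> k" "h \<noteq> k" "dl {v} = {e, h, k}" "x e = 1" "x h = \<theta>" "x k = 1 - \<theta>"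
    using vertex[OF assms(1)] assms(2) by (auto simp: cubic_def)
  moreover have "{e, h, k} \<subseteq> E" using * cut_sub[of E g "{v}"] by simp
  ultimately have "dl {v} \<inter> W = {e}" "dl {v} \<inter> H = {h, k}" using theta by (auto simp: W_def H_def)
  then show ?thesis using * that by blast
qed

lemma not_cubicE:
  assumes "v \<in> V" "\<not> cubic v"
  obtains e f where "e \<noteq> f" "dl {v} = {e, f}" "x e = 1" "x f = 1"
  using vertex[OF assms(1)] assms(2) by (auto simp: cubic_def)

lemma vertex_sum: assumes "v \<in> V" shows "sum x (dl {v}) = 2"
  using vertex[OF assms] by auto

lemma even_H_cut:
  assumes "U \<subseteq> V"
  shows "even (card (H \<inter> dl U))"
proof -
  have "even (card (H \<inter> dl {v}))" if v: "v \<in> V" for v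
  proof (cases "cubic v")
    case True
    obtain e h k where "h \<noteq> k" "dl {v} \<inter> H = {h, k}" by (rule cubicE[OF v True])
    then show ?thesis by (simp add: Int_commute)
  next
    case False
    obtain e f where "dl {v} = {e, f}" "x e = 1" "x f = 1" by (rule not_cubicE[OF v False])
    then have "H \<inter> dl {v} = {}" by (auto simp: H_def)
    then show ?thesis by simp
  qed
  then have eq: "{v\<in>U. odd (card (H \<inter> dl {v}))} = {}" using assms by auto
  have "finite U" using assms finV finite_subset by blast
  from odd_card_cut[OF this, of H] show ?thesis unfolding eq by simp
qed

lemma card_cut_split: "card (dl U) = card (W \<inter> dl U) + card (H \<inter> dl U)"
proof -
  have "dl U = (W \<inter> dl U) \<union> (H \<inter> dl U)" using WH(1) cut_sub[of E g U] by blast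
  moreover have "card ((W \<inter> dl U) \<union> (H \<inter> dl U)) = card (W \<inter> dl U) + card (H \<inter> dl U)"
    using WH(2) by (intro card_Un_disjoint) auto
  ultimately show ?thesis by simp
qed

lemma degree_sum:
  assumes "S \<subseteq> V"
  shows "2 * sum x (inner E g S) + sum x (dl S) = 2 * real (card S)"
proof -
  have fS: "finite S" using assms finV finite_subset by blast
  have "2 * real (card S) = (\<Sum>v\<in>S. sum x (dl {v}))"
    using vertex_sum assms by (simp add: subset_iff)
  also have "\<dots> = (\<Sum>v\<in>S. \<Sum>e\<in>E. if e \<in> dl {v} then x e else 0)"
    by (simp only: sum_restrict_subset[OF finE cut_sub])
  also have "\<dots> = (\<Sum>e\<in>E. \<Sum>v\<in>S. if e \<in> dl {v} then x e else 0)" by (rule sum.swap)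
  also have "\<dots> = (\<Sum>e\<in>E. (if e \<in> inner E g S then 2 * x e else 0) + (if e \<in> dl S then x e else 0))"
  proof (rule sum.cong[OF refl])
    fix e assume e: "e \<in> E"
    obtain a b where ab: "g e = {a, b}" "a \<noteq> b" by (rule edge_ends[OF e])
    have "(\<Sum>v\<in>S. if e \<in> dl {v} then x e else 0) = (\<Sum>v\<in>S \<inter> g e. x e)"
      using fS mem_vertex_cut[OF e] by (subst sum.inter_restrict) auto
    also have "\<dots> = (if e \<in> inner E g S then 2 * x e else 0) + (if e \<in> dl S then x e else 0)"
      using e ab by (cases "a \<in> S"; cases "b \<in> S") (auto simp: inner_def mem_cut Int_insert_right)
    finally show "(\<Sum>v\<in>S. if e \<in> dl {v} then x e else 0) = \<dots>" .
  qed
  also have "\<dots> = (\<Sum>e\<in>E. if e \<in> inner E g S then 2 * x e else 0) + (\<Sum>e\<in>E. if e \<in> dl S then x e else 0)"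
    by (rule sum.distrib)
  also have "(\<Sum>e\<in>E. if e \<in> inner E g S then 2 * x e else 0) = 2 * sum x (inner E g S)"
    by (simp only: sum_restrict_subset[OF finE inner_sub] sum_distrib_left)
  also have "(\<Sum>e\<in>E. if e \<in> dl S then x e else 0) = sum x (dl S)"
    by (simp only: sum_restrict_subset[OF finE cut_sub])
  finally show ?thesis by simp
qed

lemma card_cut_bool: "card (dl U) = (\<Sum>e\<in>E. of_bool (e \<in> dl U))"
  using finE by (simp add: Int_absorb1 cut_sub)

lemma submodular:
  "card (dl (A \<inter> B)) + card (dl (A \<union> B)) \<le> card (dl A) + card (dl B)"
  "card (dl (A - B)) + card (dl (B - A)) \<le> card (dl A) + card (dl B)"
proof -
  have *: "of_bool (e \<in> dl (A \<inter> B)) + of_bool (e \<in> dl (A \<union> B)) \<le> (of_bool (e \<in> dl A) + of_bool (e \<in> dl B) :: nat)"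
    "of_bool (e \<in> dl (A - B)) + of_bool (e \<in> dl (B - A)) \<le> (of_bool (e \<in> dl A) + of_bool (e \<in> dl B) :: nat)"
    if e: "e \<in> E" for e
  proof -
    obtain a b where ab: "g e = {a, b}" by (rule ends_pair[OF e])
    show "of_bool (e \<in> dl (A \<inter> B)) + of_bool (e \<in> dl (A \<union> B)) \<le> (of_bool (e \<in> dl A) + of_bool (e \<in> dl B) :: nat)"
      "of_bool (e \<in> dl (A - B)) + of_bool (e \<in> dl (B - A)) \<le> (of_bool (e \<in> dl A) + of_bool (e \<in> dl B) :: nat)"
      unfolding mem_cut[OF e ab] by (cases "a \<in> A"; cases "a \<in> B"; cases "b \<in> A"; cases "b \<in> B"; simp)+
  qed
  show "card (dl (A \<inter> B)) + card (dl (A \<union> B)) \<le> card (dl A) + card (dl B)"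
    "card (dl (A - B)) + card (dl (B - A)) \<le> card (dl A) + card (dl B)"
    unfolding card_cut_bool sum.distrib[symmetric] using * by (auto intro: sum_mono)
qed

end

section \<open>Graphs without reducible cuts: laminar 3-cuts and five colours\<close>

locale base_graph = theta_graph +
  assumes all_cubic: "v \<in> V \<Longrightarrow> cubic v"
    and three_connected: "U \<subseteq> V \<Longrightarrow> U \<noteq> {} \<Longrightarrow> U \<noteq> V \<Longrightarrow> 3 \<le> card (dl U)"
    and no_tight: "U \<subseteq> V \<Longrightarrow> 2 \<le> card U \<Longrightarrow> 2 \<le> card (V - U) \<Longrightarrow> card (dl U) = 3 \<Longrightarrow> sum x (dl U) \<noteq> 2"
begin

lemma odd_class_cut:
  assumes U: "U \<subseteq> V" and C: "\<And>v. v \<in> V \<Longrightarrow> card (C \<inter> dl {v}) = 1"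
  shows "odd (card (C \<inter> dl U)) \<longleftrightarrow> odd (card U)"
proof -
  have eq: "{v\<in>U. odd (card (C \<inter> dl {v}))} = U" using U C by auto
  have "finite U" using U finV finite_subset by blast
  from odd_card_cut[OF this, of C] show ?thesis unfolding eq .
qed

lemma odd_W_cut:
  assumes "U \<subseteq> V"
  shows "odd (card (W \<inter> dl U)) \<longleftrightarrow> odd (card U)"
proof (rule odd_class_cut[OF assms])
  fix v assume v: "v \<in> V"
  obtain e where "dl {v} \<inter> W = {e}" by (rule cubicE[OF v all_cubic[OF v]])
  then show "card (W \<inter> dl {v}) = 1" by (simp add: Int_commute)
qed

lemma odd_cut: "U \<subseteq> V \<Longrightarrow> odd (card (dl U)) \<longleftrightarrow> odd (card U)"
  using odd_W_cut[of U] even_H_cut[of U] card_cut_split[of U] by presburger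

text \<open>Cuts of three W-edges have value 3, so \<open>no_tight\<close> permits them. Each is
  represented by its side without \<open>r\<close>, which makes the family laminar.\<close>

definition UU :: "'a \<Rightarrow> 'a set set" where
  "UU r = {U. U \<subseteq> V - {r} \<and> card (dl U) = 3 \<and> dl U \<subseteq> W}"

lemma UU_D: "A \<in> UU r \<Longrightarrow> A \<subseteq> V \<and> r \<notin> A \<and> A \<noteq> {} \<and> finite A \<and> card (dl A) = 3 \<and> dl A \<subseteq> W \<and> odd (card A)"
  using odd_cut[of A] finV by (auto simp: UU_def intro: finite_subset)

text \<open>Sides of 3-cuts are odd. If two of them crossed, either intersection and union or the
  two differences would be even, nonempty and different from \<open>V\<close>, hence with cuts of at
  least four edges each: 4 + 4 \<le> 3 + 3 contradicts submodularity.\<close>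

lemma laminar:
  assumes r: "r \<in> V" and A: "A \<in> UU r" and B: "B \<in> UU r"
  shows "A \<inter> B = {} \<or> A \<subseteq> B \<or> B \<subseteq> A"
proof (rule ccontr)
  assume n: "\<not> ?thesis"
  note a = UU_D[OF A] and b = UU_D[OF B]
  have ge4: "4 \<le> card (dl X)" if "X \<subseteq> A \<union> B" "X \<noteq> {}" "even (card X)" for X
  proof -
    have X: "X \<subseteq> V" "X \<noteq> V" using that a b r by auto
    have "3 \<le> card (dl X)" by (rule three_connected[OF X(1) that(2) X(2)])
    moreover have "even (card (dl X))" using odd_cut[OF X(1)] that by simp
    moreover from this have "card (dl X) \<noteq> 3" by auto
    ultimately show ?thesis by linarith
  qed
  have od: "odd (card A)" "odd (card B)" using a b by auto
  have cA: "card A = card (A \<inter> B) + card (A - B)" and cB: "card B = card (B \<inter> A) + card (B - A)"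
    using a b by (simp_all add: card_Int_Diff)
  have cU: "card A + card B = card (A \<union> B) + card (A \<inter> B)" using a b by (intro card_Un_Int) auto
  show False
  proof (cases "even (card (A \<inter> B))")
    case True
    then have "even (card (A \<union> B))" using cU od by (metis even_add)
    then have "4 \<le> card (dl (A \<inter> B))" "4 \<le> card (dl (A \<union> B))" using ge4 n True by auto
    then show False using submodular(1)[of A B] a b by linarith
  next
    case False
    then have "even (card (A - B))" "even (card (B - A))"
      using cA cB od by (metis even_add Int_commute)+
    then have "4 \<le> card (dl (A - B))" "4 \<le> card (dl (B - A))" using ge4 n by (auto)
    then show False using submodular(2)[of A B] a b by linarith
  qed
qed

text \<open>Two reasons keep 1-edges in different classes: an H-edge between their ends would belong
  to two prescribed pairs, and a cut of three 1-edges is to contain at most one lowered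
  edge.\<close>

definition conflict :: "'a \<Rightarrow> 'b \<Rightarrow> 'b \<Rightarrow> bool" where
  "conflict r e f \<longleftrightarrow> e \<noteq> f \<and> e \<in> W \<and> f \<in> W \<and>
     ((\<exists>h\<in>H. \<exists>v w. g h = {v, w} \<and> e \<in> dl {v} \<and> f \<in> dl {w}) \<or> (\<exists>A\<in>UU r. e \<in> dl A \<and> f \<in> dl A))"

text \<open>The size of the smallest member of the laminar family, with \<open>V\<close> added, that
  contains both ends. Edges inside a 3-cut side thus rank below the edges that leave it.\<close>

definition rank :: "'a \<Rightarrow> 'b \<Rightarrow> nat" where
  "rank r e = Min (card ` {U \<in> insert V (UU r). g e \<subseteq> U})"

lemma finite_UU: "finite (UU r)"
  by (rule finite_subset[of _ "Pow V"]) (use finV in \<open>auto simp: UU_def\<close>)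

lemma rank_le: "A \<in> UU r \<Longrightarrow> g e \<subseteq> A \<Longrightarrow> rank r e \<le> card A"
  unfolding rank_def using finite_UU by (intro Min_le) auto

lemma rank_gt:
  assumes "e \<in> E" "\<And>U. U \<in> insert V (UU r) \<Longrightarrow> g e \<subseteq> U \<Longrightarrow> k < card U"
  shows "k < rank r e"
  unfolding rank_def using finite_UU assms ends[OF assms(1)] by (subst Min_gr_iff) auto

text \<open>The edge leaves \<open>B\<close> at \<open>v\<close>, so by laminarity every member that
  contains both its ends strictly contains \<open>B\<close>.\<close>

lemma inside_larger:
  assumes r: "r \<in> V" and e: "e \<in> E" "v \<in> g e" and B: "B \<in> UU r" "v \<in> B" "\<not> g e \<subseteq> B"
  shows "card B < rank r e"
proof (rule rank_gt[OF e(1)])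
  fix U assume U: "U \<in> insert V (UU r)" "g e \<subseteq> U"
  note b = UU_D[OF B(1)]
  have "B \<subset> U"
  proof (cases "U = V")
    case True
    then show ?thesis using b r by blast
  next
    case False
    then have "U \<in> UU r" using U by simp
    then have "B \<inter> U = {} \<or> B \<subseteq> U \<or> U \<subseteq> B" by (rule laminar[OF r B(1)])
    then show ?thesis using U(2) B e(2) by blast
  qed
  moreover have "finite U" using U(1) finV UU_D by blast
  ultimately show "card B < card U" by (rule psubset_card_mono[rotated])
qed

text \<open>Edges are coloured by decreasing rank.  At an end v of e, all conflicts with edges of rank at
  least that of e come from the largest W-only 3-cut that contains v but not e, or from the two
  H-edges at v if there is no such cut.\<close>

lemma later_neighbours:
  assumes r: "r \<in> V" and e: "e \<in> W" and v: "v \<in> g e"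
  obtains M where "card M \<le> 2" "finite M"
    "\<And>f. f \<in> W \<Longrightarrow> f \<noteq> e \<Longrightarrow> rank r e \<le> rank r f \<Longrightarrow>
       (\<exists>h\<in>H. \<exists>w. g h = {v, w} \<and> f \<in> dl {w}) \<or> (\<exists>A\<in>UU r. v \<in> A \<and> e \<in> dl A \<and> f \<in> dl A) \<Longrightarrow> f \<in> M"
proof -
  have eE: "e \<in> E" using e by (simp add: W_def)
  define big where "big = {A \<in> UU r. v \<in> A \<and> \<not> g e \<subseteq> A}"
  have fbig: "finite big" using finite_UU by (simp add: big_def)
  have bigI: "A \<in> big" if "A \<in> UU r" "v \<in> A" "e \<in> dl A" for A
    using that by (auto simp: big_def cut_def)
  show ?thesis
  proof (cases "big = {}")
    case True
    \<comment> \<open>Each of the two H-edges at \<open>v\<close> leads to one vertex, and that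
      vertex has one W-edge.\<close>
    define M where "M = (\<Union>h\<in>H \<inter> dl {v}. {f \<in> W. \<exists>w. g h = {v, w} \<and> f \<in> dl {w}})"
    have vV: "v \<in> V" using ends[OF eE] v by blast
    have one: "card {f \<in> W. \<exists>w. g h = {v, w} \<and> f \<in> dl {w}} \<le> 1" if h: "h \<in> H \<inter> dl {v}" for h
    proof (cases "\<exists>w. g h = {v, w}")
      case False
      then show ?thesis by simp
    next
      case True
      then obtain w where w: "g h = {v, w}" by blast
      have hE: "h \<in> E" using h by (simp add: H_def)
      then have "w \<in> V" using w ends[of h] by auto
      then obtain e' where "dl {w} \<inter> W = {e'}" using cubicE[OF _ all_cubic, of w] by metis
      then have "{f \<in> W. \<exists>w. g h = {v, w} \<and> f \<in> dl {w}} \<subseteq> {e'}"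
        using w by (auto simp: doubleton_eq_iff)
      then show ?thesis using card_mono[of "{e'}"] by fastforce
    qed
    have "card M \<le> (\<Sum>h\<in>H \<inter> dl {v}. card {f \<in> W. \<exists>w. g h = {v, w} \<and> f \<in> dl {w}})"
      unfolding M_def using finH by (intro card_UN_le) auto
    also have "\<dots> \<le> (\<Sum>h\<in>H \<inter> dl {v}. 1)" using one by (intro sum_mono) auto
    also have "\<dots> = card (H \<inter> dl {v})" by simp
    also have "\<dots> = 2"
    proof -
      obtain h k where "h \<noteq> k" "dl {v} \<inter> H = {h, k}" by (rule cubicE[OF vV all_cubic[OF vV]])
      then show ?thesis by (simp add: Int_commute)
    qed
    finally have "card M \<le> 2" .
    moreover have "finite M" using finW finH unfolding M_def by auto
    moreover have "f \<in> M" if f: "f \<in> W" "(\<exists>h\<in>H. \<exists>w. g h = {v, w} \<and> f \<in> dl {w}) \<or> (\<exists>A\<in>UU r. v \<in> A \<and> e \<in> dl A \<and> f \<in> dl A)" for f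
    proof -
      have "\<not> (\<exists>A\<in>UU r. v \<in> A \<and> e \<in> dl A \<and> f \<in> dl A)" using bigI True by fast
      then obtain h w where h: "h \<in> H" "g h = {v, w}" "f \<in> dl {w}" using f(2) by meson
      have "h \<in> dl {v}" using h mem_vertex_cut[of h v] by (simp add: H_def)
      then show ?thesis unfolding M_def using f(1) h by fast
    qed
    ultimately show ?thesis by (rule that) fast+
  next
    case False
    define B where "B = (ARG_MAX card A. A \<in> big)"
    have Bmax: "B \<in> big \<and> (\<forall>A\<in>big. card A \<le> card B)"
    proof -
      obtain A0 where "A0 \<in> big" using False by blast
      moreover have "\<forall>A. A \<in> big \<longrightarrow> card A < Suc (card V)"
        using finV UU_D by (auto simp: big_def less_Suc_eq_le intro!: card_mono)
      ultimately show ?thesis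
        unfolding B_def using arg_max_nat_lemma[of "\<lambda>A. A \<in> big" A0 card "Suc (card V)"] by blast
    qed
    then have B: "B \<in> UU r" "v \<in> B" "\<not> g e \<subseteq> B" by (auto simp: big_def)
    note b = UU_D[OF B(1)]
    have eB: "e \<in> dl B" using eE v B by (auto simp: cut_def)
    have "card (dl B - {e}) \<le> 2" using b eB by simp
    moreover have "f \<in> dl B - {e}" if f: "f \<in> W" "f \<noteq> e" "rank r e \<le> rank r f"
      and c: "(\<exists>h\<in>H. \<exists>w. g h = {v, w} \<and> f \<in> dl {w}) \<or> (\<exists>A\<in>UU r. v \<in> A \<and> e \<in> dl A \<and> f \<in> dl A)" for f
    proof -
      have fE: "f \<in> E" using f by (simp add: W_def)
      have "g f \<inter> B \<noteq> {}"
        using c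
      proof
        assume "\<exists>h\<in>H. \<exists>w. g h = {v, w} \<and> f \<in> dl {w}"
        then obtain h w where h: "h \<in> H" "g h = {v, w}" "f \<in> dl {w}" by blast
        \<comment> \<open>The cut of \<open>B\<close> consists of W-edges, so the H-edge cannot
          leave \<open>B\<close>.\<close>
        have "h \<notin> dl B" using h(1) b WH by blast
        then have "w \<in> B" using mem_cut[of h v w B] h B(2) by (simp add: H_def)
        then show ?thesis using h(3) mem_vertex_cut[OF fE] by blast
      next
        assume "\<exists>A\<in>UU r. v \<in> A \<and> e \<in> dl A \<and> f \<in> dl A"
        then obtain A where A: "A \<in> UU r" "v \<in> A" "e \<in> dl A" "f \<in> dl A" by blast
        have "A \<subseteq> B \<or> B \<subseteq> A" using laminar[OF r A(1) B(1)] A(2) B(2) by blast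
        moreover have "card A \<le> card B" using Bmax bigI[OF A(1-3)] by blast
        ultimately have "A \<subseteq> B" using UU_D[OF A(1)] card_seteq[of A B] by blast
        then show ?thesis using A(4) by (auto simp: cut_def)
      qed
      \<comment> \<open>An edge inside \<open>B\<close> has rank at most |B|, which is below the
        rank of \<open>e\<close>. So \<open>f\<close> crosses \<open>B\<close>, and is one of the
        two other edges of its 3-cut.\<close>
      moreover have "\<not> g f \<subseteq> B"
        using rank_le[OF B(1), of f] inside_larger[OF r eE v B] f(3) by auto
      ultimately show ?thesis using fE f(2) by (auto simp: cut_def)
    qed
    ultimately show ?thesis by (intro that[of "dl B - {e}"]) auto
  qed
qed

theorem five_colouring:
  obtains c :: "'b \<Rightarrow> nat" where "\<And>e. e \<in> W \<Longrightarrow> c e < 5"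
    "\<And>h v w e f. h \<in> H \<Longrightarrow> g h = {v, w} \<Longrightarrow> e \<in> W \<inter> dl {v} \<Longrightarrow> f \<in> W \<inter> dl {w} \<Longrightarrow> e \<noteq> f \<Longrightarrow> c e \<noteq> c f"
    "\<And>U. U \<subseteq> V \<Longrightarrow> card (dl U) = 3 \<Longrightarrow> dl U \<subseteq> W \<Longrightarrow> inj_on c (dl U)"
proof -
  have "V \<noteq> {}" using V2 by auto
  then obtain r where r: "r \<in> V" by blast
  have le4: "card {f \<in> W. conflict r e f \<and> rank r e \<le> rank r f} \<le> 4" if e: "e \<in> W" for e
  proof -
    have eE: "e \<in> E" using e by (simp add: W_def)
    obtain a b where ab: "g e = {a, b}" by (rule ends_pair[OF eE])
    obtain M where M: "card M \<le> 2" "finite M"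
      "\<And>f. f \<in> W \<Longrightarrow> f \<noteq> e \<Longrightarrow> rank r e \<le> rank r f \<Longrightarrow>
         (\<exists>h\<in>H. \<exists>w. g h = {a, w} \<and> f \<in> dl {w}) \<or> (\<exists>A\<in>UU r. a \<in> A \<and> e \<in> dl A \<and> f \<in> dl A) \<Longrightarrow> f \<in> M"
      using later_neighbours[OF r e, of a] ab by blast
    obtain M' where M': "card M' \<le> 2" "finite M'"
      "\<And>f. f \<in> W \<Longrightarrow> f \<noteq> e \<Longrightarrow> rank r e \<le> rank r f \<Longrightarrow>
         (\<exists>h\<in>H. \<exists>w. g h = {b, w} \<and> f \<in> dl {w}) \<or> (\<exists>A\<in>UU r. b \<in> A \<and> e \<in> dl A \<and> f \<in> dl A) \<Longrightarrow> f \<in> M'"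
      using later_neighbours[OF r e, of b] ab by blast
    have "f \<in> M \<union> M'" if f: "f \<in> W" "conflict r e f" "rank r e \<le> rank r f" for f
    proof -
      have ne: "f \<noteq> e" using f(2) by (auto simp: conflict_def)
      consider h v w where "h \<in> H" "g h = {v, w}" "e \<in> dl {v}" "f \<in> dl {w}"
        | A where "A \<in> UU r" "e \<in> dl A" "f \<in> dl A" using f(2) by (auto simp: conflict_def)
      then show ?thesis
      proof cases
        case 1
        then have ve: "v = a \<or> v = b" using mem_vertex_cut[OF eE] ab by auto
        from 1 have nb: "\<exists>h\<in>H. \<exists>w. g h = {v, w} \<and> f \<in> dl {w}" by blast
        from ve show ?thesis
        proof
          assume "v = a"
          from M(3)[OF f(1) ne f(3) disjI1[OF nb[unfolded this]]] show ?thesis by simp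
        next
          assume "v = b"
          from M'(3)[OF f(1) ne f(3) disjI1[OF nb[unfolded this]]] show ?thesis by simp
        qed
      next
        case 2
        then have "a \<in> A \<or> b \<in> A" using mem_cut[OF eE ab, of A] by blast
        then show ?thesis
        proof
          assume "a \<in> A"
          then have "\<exists>A\<in>UU r. a \<in> A \<and> e \<in> dl A \<and> f \<in> dl A" using 2 by blast
          from M(3)[OF f(1) ne f(3) disjI2[OF this]] show ?thesis by simp
        next
          assume "b \<in> A"
          then have "\<exists>A\<in>UU r. b \<in> A \<and> e \<in> dl A \<and> f \<in> dl A" using 2 by blast
          from M'(3)[OF f(1) ne f(3) disjI2[OF this]] show ?thesis by simp
        qed
      qed
    qed
    then have "card {f \<in> W. conflict r e f \<and> rank r e \<le> rank r f} \<le> card (M \<union> M')"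
      using M M' by (intro card_mono) auto
    then show ?thesis using card_Un_le[of M M'] M M' by linarith
  qed
  have sym: "conflict r f e" if ef: "conflict r e f" for e f
  proof -
    from ef consider h v w where "h \<in> H" "g h = {v, w}" "e \<in> dl {v}" "f \<in> dl {w}"
      | A where "A \<in> UU r" "e \<in> dl A" "f \<in> dl A" by (auto simp: conflict_def)
    then have "(\<exists>h\<in>H. \<exists>v w. g h = {v, w} \<and> f \<in> dl {v} \<and> e \<in> dl {w}) \<or> (\<exists>A\<in>UU r. f \<in> dl A \<and> e \<in> dl A)"
    proof cases
      case (1 h v w)
      then have "g h = {w, v}" by auto
      then show ?thesis using 1 by blast
    qed blast
    moreover have "f \<noteq> e" "e \<in> W" "f \<in> W" using ef by (auto simp: conflict_def)
    ultimately show ?thesis unfolding conflict_def by blast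
  qed
  have irr: "\<not> conflict r e e" for e by (simp add: conflict_def)
  obtain c :: "'b \<Rightarrow> nat" where c: "\<forall>e\<in>W. c e < 5" "\<forall>e\<in>W. \<forall>f\<in>W. conflict r e f \<longrightarrow> c e \<noteq> c f"
    using greedy_colouring[of W "conflict r" "rank r", OF finW le4 sym irr] by auto
  show ?thesis
  proof (rule that)
    show "c e < 5" if "e \<in> W" for e using c that by blast
    show "c e \<noteq> c f" if "h \<in> H" "g h = {v, w}" "e \<in> W \<inter> dl {v}" "f \<in> W \<inter> dl {w}" "e \<noteq> f" for h v w e f
    proof -
      have "conflict r e f" using that unfolding conflict_def by blast
      then show ?thesis using c(2) that by blast
    qed
    show "inj_on c (dl U)" if U: "U \<subseteq> V" "card (dl U) = 3" "dl U \<subseteq> W" for U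
    proof -
      \<comment> \<open>Passing to the complement gives the side that avoids \<open>r\<close> and
        leaves the cut unchanged.\<close>
      define A where "A = (if r \<in> U then V - U else U)"
      have "dl A = dl U" using cut_compl[of U] by (simp add: A_def)
      then have A: "A \<in> UU r" "dl A = dl U" using U by (auto simp: UU_def A_def)
      have "c e \<noteq> c f" if "e \<in> dl U" "f \<in> dl U" "e \<noteq> f" for e f
      proof -
        have "conflict r e f" using that U(3) A by (auto simp: conflict_def)
        then show ?thesis using c(2) that U(3) by blast
      qed
      then show ?thesis by (auto simp: inj_on_def)
    qed
  qed
qed

end

section \<open>The base case\<close>

definition target :: "('e \<Rightarrow> real) \<Rightarrow> real \<Rightarrow> 'e \<Rightarrow> real" where
  "target x \<theta> e = (if x e = 1 then 3/2 - \<theta>/10 else 3/2 * x e)"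

text \<open>If an edge is in T with probability x and, whatever T is, in the join with probability
  z, its multiplicity is odd with probability x(1 - z) + (1 - x)z. For z = x/2 this is 3x/2 - x^2;
  for x = 1 it is 1 - z, and z averages to 1/2 - \<theta>/10 over the classes.\<close>

definition odd_target :: "('e \<Rightarrow> real) \<Rightarrow> real \<Rightarrow> 'e \<Rightarrow> real" where
  "odd_target x \<theta> e = (if x e = 1 then 1/2 + \<theta>/10 else 3/2 * x e - x e * x e)"

text \<open>Three features serve glueing: \<open>V - {r}\<close> is connected without the help of
  \<open>r\<close>, so that \<open>r\<close> may stand for a contracted side; the edge of value
  below 1 at \<open>r\<close> cannot belong to a 2-cut; and every 1-edge is used.\<close>

definition rooted_tour :: "'v set \<Rightarrow> 'e set \<Rightarrow> ('e \<Rightarrow> 'v set) \<Rightarrow> ('e \<Rightarrow> real) \<Rightarrow> 'v \<Rightarrow> ('e \<Rightarrow> nat) \<Rightarrow> bool" where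
  "rooted_tour V E g x r F \<longleftrightarrow> (\<forall>v\<in>V. even (sum F (cut E g {v}))) \<and> (\<forall>e\<in>E. x e = 1 \<longrightarrow> 1 \<le> F e) \<and>
     (\<exists>h\<in>cut E g {r}. x h < 1 \<and> 0 < F h) \<and>
     (\<forall>S\<subseteq>V - {r}. S \<noteq> {} \<longrightarrow> S \<noteq> V - {r} \<longrightarrow> (\<exists>e\<in>E. 0 < F e \<and> g e \<subseteq> V - {r} \<and> e \<in> cut E g S))"

definition exact_marginals :: "'e set \<Rightarrow> ('e \<Rightarrow> real) \<Rightarrow> real \<Rightarrow> ('e \<Rightarrow> nat) pmf \<Rightarrow> bool" where
  "exact_marginals E x \<theta> p \<longleftrightarrow> finite (set_pmf p) \<and> (\<forall>e\<in>E. mean p (\<lambda>F. real (F e)) = target x \<theta> e) \<and>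
     (\<forall>e\<in>E. mean p (\<lambda>F. of_bool (odd (F e))) = odd_target x \<theta> e)"

text \<open>Prescribing the parities as well as the means makes the induction work: on a cut of at
  most three edges they determine the joint distribution of the parities.\<close>

definition decomposes :: "'v set \<Rightarrow> 'e set \<Rightarrow> ('e \<Rightarrow> 'v set) \<Rightarrow> ('e \<Rightarrow> real) \<Rightarrow> real \<Rightarrow> 'v \<Rightarrow> bool" where
  "decomposes V E g x \<theta> r \<longleftrightarrow> (\<exists>p. exact_marginals E x \<theta> p \<and> (\<forall>F\<in>set_pmf p. rooted_tour V E g x r F))"

context base_graph
begin

definition joinpoint :: "'b set \<Rightarrow> 'b \<Rightarrow> real" where
  "joinpoint M e = (if e \<in> M then 1/2 - \<theta>/2 else x e / 2)"

lemma H_cut_sum_ge: "real (card (H \<inter> dl U)) * \<theta> \<le> sum x (H \<inter> dl U)"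
proof -
  have "\<theta> \<le> x e" if "e \<in> H" for e using H_values[OF that] theta by auto
  then show ?thesis using sum_bounded_below[of "H \<inter> dl U" \<theta> x] by simp
qed

lemma half_H_cut_sum:
  assumes "\<theta> = 1/2"
  shows "sum x (H \<inter> dl U) = real (card (H \<inter> dl U)) / 2"
proof -
  have "x e = 1/2" if "e \<in> H" for e using H_values[OF that] assms by auto
  then have "sum x (H \<inter> dl U) = (\<Sum>e\<in>H \<inter> dl U. 1/2)" by (intro sum.cong) auto
  then show ?thesis by simp
qed

text \<open>For \<theta> < 1/2 the edges of value \<theta> and those of value 1 - \<theta> are two
  different perfect matchings, so each meets the cut with the parity of |U|. For \<theta> = 1/2 they
  coincide, and \<open>half_H_cut_sum\<close> takes over.\<close>

lemma unequal_H_cut: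
  assumes "\<theta> < 1/2" "U \<subseteq> V"
  obtains a b where "card (H \<inter> dl U) = a + b" "sum x (H \<inter> dl U) = a * (1 - \<theta>) + b * \<theta>"
    "odd a \<longleftrightarrow> odd (card U)" "odd b \<longleftrightarrow> odd (card U)"
proof -
  define A where "A = {e \<in> E. x e = 1 - \<theta>}"
  define B where "B = {e \<in> E. x e = \<theta>}"
  have AB: "A \<union> B = H" "A \<inter> B = {}" using H_values assms theta by (auto simp: A_def B_def H_def)
  have fin: "finite A" "finite B" using finE by (auto simp: A_def B_def)
  have one: "card (A \<inter> dl {v}) = 1 \<and> card (B \<inter> dl {v}) = 1" if v: "v \<in> V" for v
  proof -
    obtain e h k where hk: "e \<noteq> h" "e \<noteq> k" "h \<noteq> k" "dl {v} = {e, h, k}" "x e = 1" "x h = \<theta>" "x k = 1 - \<theta>"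
      by (rule cubicE[OF v all_cubic[OF v]])
    have "{e, h, k} \<subseteq> E" using hk(4) cut_sub[of E g "{v}"] by simp
    then have "A \<inter> dl {v} = {k}" "B \<inter> dl {v} = {h}" using hk assms theta by (auto simp: A_def B_def)
    then show ?thesis by simp
  qed
  have s: "H \<inter> dl U = (A \<inter> dl U) \<union> (B \<inter> dl U)" using AB by blast
  have d: "(A \<inter> dl U) \<inter> (B \<inter> dl U) = {}" using AB by blast
  show ?thesis
  proof (rule that[of "card (A \<inter> dl U)" "card (B \<inter> dl U)"])
    show "card (H \<inter> dl U) = card (A \<inter> dl U) + card (B \<inter> dl U)"
      unfolding s using fin d by (intro card_Un_disjoint) auto
    have "sum x (H \<inter> dl U) = sum x (A \<inter> dl U) + sum x (B \<inter> dl U)"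
      unfolding s using fin d by (intro sum.union_disjoint) auto
    then show "sum x (H \<inter> dl U) = card (A \<inter> dl U) * (1 - \<theta>) + card (B \<inter> dl U) * \<theta>"
      by (simp add: A_def B_def)
    show "odd (card (A \<inter> dl U)) \<longleftrightarrow> odd (card U)" "odd (card (B \<inter> dl U)) \<longleftrightarrow> odd (card U)"
      using odd_class_cut[OF assms(2), of A] odd_class_cut[OF assms(2), of B] one by auto
  qed
qed

lemma cut_sum_split: "sum f (dl U) = sum f (W \<inter> dl U) + sum f (H \<inter> dl U)"
proof -
  have "dl U = (W \<inter> dl U) \<union> (H \<inter> dl U)" using WH(1) cut_sub[of E g U] by blast
  moreover have "sum f ((W \<inter> dl U) \<union> (H \<inter> dl U)) = sum f (W \<inter> dl U) + sum f (H \<inter> dl U)"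
    using WH(2) by (intro sum.union_disjoint) auto
  ultimately show ?thesis by simp
qed

lemma joinpoint_cut:
  assumes "M \<subseteq> W"
  shows "sum (joinpoint M) (dl U) = sum x (dl U) / 2 - \<theta>/2 * card (M \<inter> dl U)"
proof -
  have "sum (joinpoint M) (dl U) = (\<Sum>e\<in>dl U. x e / 2 - (if e \<in> M then \<theta>/2 else 0))"
    using assms by (intro sum.cong) (auto simp: joinpoint_def W_def)
  also have "\<dots> = sum x (dl U) / 2 - (\<Sum>e\<in>dl U. if e \<in> M then \<theta>/2 else 0)"
    by (simp add: sum_subtractf sum_divide_distrib)
  also have "(\<Sum>e\<in>dl U. if e \<in> M then \<theta>/2 else 0) = (\<Sum>e\<in>dl U \<inter> M. \<theta>/2)"
    by (subst sum.inter_restrict) auto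
  finally show ?thesis by (simp add: Int_commute)
qed

text \<open>After doubling, k + s - \<theta>m \<ge> 2 is to be shown, for k W-edges, m of them
  lowered, and H-weight s. With m = 0 this is the subtour bound. A second W-edge with at least two
  H-edges suffices, as do four W-edges because \<theta> \<le> 1/2; a 3-cut of W-edges has m \<le> 1.
  The delicate case is k = 1.\<close>

lemma joinpoint_proper_cut:
  assumes U: "U \<subseteq> V" "2 \<le> card U" "2 \<le> card (V - U)" and M: "M \<subseteq> W"
    and rb: "card (dl U) = 3 \<Longrightarrow> dl U \<subseteq> W \<Longrightarrow> card (M \<inter> dl U) \<le> 1"
  shows "1 \<le> sum (joinpoint M) (dl U)"
proof -
  define k j m s where "k = card (W \<inter> dl U)" "j = card (H \<inter> dl U)" "m = card (M \<inter> dl U)" "s = sum x (H \<inter> dl U)"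
  note defs = this
  have "U \<noteq> {}" "U \<noteq> V" using U by auto
  note U' = U(1) this
  have xs: "sum x (dl U) = k + s"
    unfolding cut_sum_split[of x U] defs by (simp add: W_def)
  have mk: "m \<le> k" unfolding defs using M finW by (intro card_mono) auto
  have kj: "3 \<le> k + j" using three_connected[OF U'] unfolding card_cut_split[of U] defs .
  have ej: "even j" using even_H_cut[OF U(1)] by (simp add: defs)
  have ge2: "2 \<le> k + s" using cut_ge[OF U'] xs by simp
  have sj: "j * \<theta> \<le> s" using H_cut_sum_ge[of U] by (simp add: defs)
  have parity: "odd (card U) \<longleftrightarrow> odd k" using odd_W_cut[OF U(1)] by (simp add: defs)
  have mth: "\<theta> * m \<le> \<theta> * k" using mk theta by (intro mult_left_mono) auto
  have goal: "2 \<le> k + s - \<theta> * m"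
  proof (cases "m = 0")
    case True
    then show ?thesis using ge2 by simp
  next
    case False
    then have "k \<noteq> 0" using mk by simp
    then consider "k = 1" | "k = 2" | "k = 3" | "4 \<le> k" by linarith
    then show ?thesis
    proof cases
      case 1
      then have j2: "2 \<le> j" using kj by simp
      \<comment> \<open>The number of H-edges is even, and two of them would make a tight nontrivial
        3-cut; with more there is room for \<theta>.\<close>
      have "1 + \<theta> \<le> s"
      proof (cases "\<theta> = 1/2")
        case True
        have "j \<noteq> 2"
        proof
          assume "j = 2"
          then have "s = 1" using half_H_cut_sum[OF True, of U] by (simp add: defs)
          moreover have "card (dl U) = 3" using card_cut_split[of U] 1 \<open>j = 2\<close> by (simp add: defs)
          ultimately show False using no_tight[OF U] xs 1 by simp
        qed
        moreover have "j \<noteq> 3" using ej by auto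
        ultimately have "4 \<le> j" using j2 by linarith
        then show ?thesis using half_H_cut_sum[OF True, of U] True by (simp add: defs)
      next
        case False
        then have lt: "\<theta> < 1/2" using theta by simp
        obtain a b where ab: "j = a + b" "s = a * (1 - \<theta>) + b * \<theta>" "odd a" "odd b"
          using unequal_H_cut[OF lt U(1)] parity 1 unfolding defs by (metis odd_one)
        have ab1: "1 \<le> a" "1 \<le> b" using odd_pos[OF ab(3)] odd_pos[OF ab(4)] by simp_all
        have "j \<noteq> 2"
        proof
          assume "j = 2"
          then have "a = 1" "b = 1" using ab(1) ab1 by linarith+
          then have "s = 1" using ab by simp
          moreover have "card (dl U) = 3" using card_cut_split[of U] 1 \<open>j = 2\<close> by (simp add: defs)
          ultimately show False using no_tight[OF U] xs 1 by simp
        qed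
        moreover have "a \<noteq> 2" "b \<noteq> 2" using ab by auto
        \<comment> \<open>Both counts are odd and not both 1, so the H-weight is at least 3 -
          2\<theta> or 1 + 2\<theta>.\<close>
        ultimately have "3 \<le> a \<and> 1 \<le> b \<or> 1 \<le> a \<and> 3 \<le> b" using ab(1) ab1 by linarith
        then show ?thesis
        proof
          assume h: "3 \<le> a \<and> 1 \<le> b"
          have "3 * (1 - \<theta>) \<le> a * (1 - \<theta>)" "1 * \<theta> \<le> b * \<theta>"
            using theta h by (intro mult_right_mono; simp)+
          then have "3 * (1 - \<theta>) + 1 * \<theta> \<le> s" unfolding ab(2) by (rule add_mono)
          then show ?thesis using lt by simp
        next
          assume h: "1 \<le> a \<and> 3 \<le> b"
          have "1 * (1 - \<theta>) \<le> a * (1 - \<theta>)" "3 * \<theta> \<le> b * \<theta>"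
            using theta h by (intro mult_right_mono; simp)+
          then have "1 * (1 - \<theta>) + 3 * \<theta> \<le> s" unfolding ab(2) by (rule add_mono)
          then show ?thesis using theta by simp
        qed
      qed
      then show ?thesis using mth 1 by simp
    next
      case 2
      then have "j \<noteq> 0" "j \<noteq> 1" using kj ej by auto
      then have "2 \<le> j" by linarith
      then have "2 * \<theta> \<le> j * \<theta>" using theta by (intro mult_right_mono) auto
      then have "2 * \<theta> \<le> s" using sj by (rule order_trans)
      moreover have "real k = 2" "\<theta> * m \<le> 2 * \<theta>" using mth 2 by simp_all
      ultimately show ?thesis by linarith
    next
      case 3
      show ?thesis
      proof (cases "j = 0")
        case True
        then have "H \<inter> dl U = {}" using finH by (simp add: defs)
        then have "dl U \<subseteq> W" using WH(1) cut_sub[of E g U] by blast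
        moreover have "card (dl U) = 3" using card_cut_split[of U] 3 True by (simp add: defs)
        ultimately have "m \<le> 1" using rb by (simp add: defs)
        then have "m = 1" using \<open>m \<noteq> 0\<close> by simp
        moreover have "0 \<le> s" using sj True by simp
        ultimately show ?thesis using 3 theta by simp
      next
        case False
        moreover have "j \<noteq> 1" using ej by auto
        ultimately have "2 \<le> j" by linarith
        then have "2 * \<theta> \<le> j * \<theta>" using theta by (intro mult_right_mono) auto
        then have "2 * \<theta> \<le> s" using sj by (rule order_trans)
        moreover have "real k = 3" "\<theta> * m \<le> 3 * \<theta>" using mth 3 by simp_all
        ultimately show ?thesis using theta by linarith
      qed
    next
      case 4
      have "0 \<le> j * \<theta>" using theta by simp
      then have "0 \<le> s" using sj by (rule order_trans)
      moreover have "4 * (1 - \<theta>) \<le> k * (1 - \<theta>)" using 4 theta by (intro mult_right_mono) auto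
      then have "4 * (1 - \<theta>) \<le> k - \<theta> * k" by (simp only: right_diff_distrib mult_1_right mult.commute)
      then have "4 * (1 - \<theta>) \<le> k - \<theta> * m" using diff_left_mono[OF mth] by (rule order_trans)
      moreover have "4 * (1 - \<theta>) = 4 - 4 * \<theta>" by simp
      ultimately show ?thesis using theta by linarith
    qed
  qed
  have eq: "(real k + s) / 2 - \<theta>/2 * m = (k + s - \<theta> * m) / 2" by (simp add: diff_divide_distrib)
  have "1 \<le> (k + s - \<theta> * m) / 2" using goal by simp
  then show ?thesis unfolding joinpoint_cut[OF M] xs defs(3)[symmetric] eq .
qed

text \<open>Nontrivial cuts are handled by \<open>joinpoint_proper_cut\<close>. At a vertex with an
  edge of \<open>M\<close> the sum is only 1 - \<theta>/2; but there \<open>T\<close> has degree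
  two, so the vertex is no terminal, \<open>F\<close> has to be odd, and each complemented edge
  brings enough.\<close>

lemma joinpoint_blossom:
  assumes M: "M \<subseteq> W" and T: "W \<subseteq> T" "T \<subseteq> E"
    and M3: "\<And>U. U \<subseteq> V \<Longrightarrow> card (dl U) = 3 \<Longrightarrow> dl U \<subseteq> W \<Longrightarrow> card (M \<inter> dl U) \<le> 1"
    and T2: "\<And>v e. v \<in> V \<Longrightarrow> e \<in> M \<Longrightarrow> e \<in> dl {v} \<Longrightarrow> card (T \<inter> (H \<inter> dl {v})) = 1"
  shows "blossom V E g {v\<in>V. odd (card (T \<inter> dl {v}))} (joinpoint M)"
  unfolding blossom_def
proof (intro allI impI)
  define Q where "Q = {v\<in>V. odd (card (T \<inter> dl {v}))}"
  let ?z = "joinpoint M"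
  fix U F assume U: "U \<subseteq> V" and F: "F \<subseteq> dl U" and o: "odd (card F + card (U \<inter> {v\<in>V. odd (card (T \<inter> dl {v}))}))"
  have "U \<inter> {v\<in>V. odd (card (T \<inter> dl {v}))} = {v\<in>U. odd (card (T \<inter> dl {v}))}" using U by auto
  then have odd: "odd (card F + card (T \<inter> dl U))"
    using o odd_card_cut[of U T] U finV finite_subset[of U V] by simp
  have zle: "?z e \<le> 1/2" if "e \<in> E" for e
    using x_le1[OF that] theta by (auto simp: joinpoint_def)
  \<comment> \<open>No value exceeds 1/2, so complementing edges can only raise the sum.\<close>
  have le: "sum ?z (dl U) \<le> (\<Sum>e\<in>dl U. if e \<in> F then 1 - ?z e else ?z e)"
    using zle cut_sub[of E g U] by (intro sum_mono) (fastforce)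
  have "U \<noteq> {} \<and> U \<noteq> V" using odd F by auto
  then have nonempty: "U \<noteq> {}" "U \<noteq> V" "V - U \<noteq> {}" using U by auto
  have fU: "finite U" using U finV finite_subset by blast
  show "1 \<le> (\<Sum>e\<in>dl U. if e \<in> F then 1 - ?z e else ?z e)"
  proof (cases "2 \<le> card U \<and> 2 \<le> card (V - U)")
    case True
    then show ?thesis using joinpoint_proper_cut[OF U _ _ M] M3[OF U] le by fastforce
  next
    case False
    have "\<exists>v\<in>V. dl U = dl {v}"
    proof (cases "card U = 1")
      case True
      then show ?thesis using U by (auto simp: card_1_singleton_iff)
    next
      case neq: False
      have "card (V - U) \<noteq> 0" "card U \<noteq> 0" using nonempty fU finV by auto
      then have "card (V - U) = 1" using False neq by linarith
      then obtain v where v: "V - U = {v}" by (auto simp: card_1_singleton_iff)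
      then show ?thesis using cut_compl[of U] by (intro bexI[of _ v]) auto
    qed
    then obtain v where v: "v \<in> V" "dl U = dl {v}" by blast
    show ?thesis
    proof (cases "M \<inter> dl {v} = {}")
      case True
      then have "sum ?z (dl U) = sum x (dl U) / 2" unfolding joinpoint_cut[OF M] v by simp
      then show ?thesis using le cut_ge[OF U nonempty(1,2)] by simp
    next
      case False
      obtain e h k where hk: "e \<noteq> h" "e \<noteq> k" "h \<noteq> k" "dl {v} = {e, h, k}" "x e = 1" "x h = \<theta>" "x k = 1 - \<theta>"
        "dl {v} \<inter> W = {e}" "dl {v} \<inter> H = {h, k}" by (rule cubicE[OF v(1) all_cubic[OF v(1)]])
      obtain f where f: "f \<in> M" "f \<in> dl {v}" using False by blast
      then have "f \<in> dl {v} \<inter> W" using M by blast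
      then have "e \<in> M" using f(1) unfolding hk(8) by simp
      moreover have "x e' = 1" if "e' \<in> M" for e' using M that by (auto simp: W_def)
      then have "h \<notin> M" "k \<notin> M" using hk(6,7) theta by force+
      ultimately have eM: "e \<in> M" "h \<notin> M" "k \<notin> M" by blast+
      have "card (T \<inter> (H \<inter> dl {v})) = 1" using T2[OF v(1) eM(1)] hk(4) by simp
      moreover have "T \<inter> dl {v} = insert e (T \<inter> (H \<inter> dl {v}))"
      proof -
        have "dl {v} = insert e (H \<inter> dl {v})" using hk(4,9) by (simp add: Int_commute)
        then show ?thesis using eM(1) M T(1) by blast
      qed
      moreover have "e \<notin> T \<inter> (H \<inter> dl {v})" using hk(5) by (simp add: H_def)
      ultimately have "card (T \<inter> dl {v}) = 2" using finH by (simp add: card_insert_if)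
      then have oF: "odd (card F)" using odd v(2) by simp
      have FE: "F \<subseteq> {e, h, k}" using F hk(4) v(2) by simp
      have z: "?z e = 1/2 - \<theta>/2" "?z h = \<theta>/2" "?z k = 1/2 - \<theta>/2"
        using eM hk by (auto simp: joinpoint_def)
      have "card F = (if e \<in> F then 1 else 0) + (if h \<in> F then 1 else 0) + (if k \<in> F then 1 else 0)"
      proof -
        have "F = (if e \<in> F then {e} else {}) \<union> ((if h \<in> F then {h} else {}) \<union> (if k \<in> F then {k} else {}))"
          using FE by auto
        then have "card F = card \<dots>" by simp
        also have "\<dots> = (if e \<in> F then 1 else 0) + (if h \<in> F then 1 else 0) + (if k \<in> F then 1 else 0)"
          using hk(1-3) by (cases "e \<in> F"; cases "h \<in> F"; cases "k \<in> F") auto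
        finally show ?thesis .
      qed
      then show ?thesis
        unfolding v(2) hk(4) using hk(1-3) oF z theta
        by (cases "e \<in> F"; cases "h \<in> F"; cases "k \<in> F") auto
    qed
  qed
qed

end

section \<open>Tours from one colour class, and their average\<close>

context base_graph
begin

text \<open>\<open>degree_sum\<close> turns the subtour bounds into the spanning tree constraints on
  \<open>V - {r}\<close>. The H-edges at \<open>r\<close> have weight 1 and play the part of
  \<open>R\<close>; \<open>sep\<close> makes the H-pairs at the ends of \<open>M\<close>
  disjoint.\<close>

lemma rainbow_trees:
  assumes r: "r \<in> V" and M: "M \<subseteq> W"
    and sep: "\<And>h v w e f. h \<in> H \<Longrightarrow> g h = {v, w} \<Longrightarrow> e \<in> M \<inter> dl {v} \<Longrightarrow> f \<in> M \<inter> dl {w} \<Longrightarrow> e = f"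
  shows "\<exists>p. (\<forall>T\<in>set_pmf p. rainbow E g (V - {r}) W
      (insert (H \<inter> dl {r}) ((\<lambda>v. H \<inter> dl {v}) ` {v\<in>V. M \<inter> dl {v} \<noteq> {}})) T) \<and>
    (\<forall>e\<in>E. mean p (\<lambda>T. of_bool (e \<in> T)) = x e)"
proof (rule rainbow_decomposition)
  show "finite E" "finite (V - {r})" using finE finV by auto
  have cN: "card (V - {r}) = card V - 1" using r finV by simp
  show "V - {r} \<noteq> {}" using cN V2 by fastforce
  show "g e \<noteq> {}" if "e \<in> E" for e using ends[OF that] by simp
  show "0 \<le> x e \<and> x e \<le> 1" if "e \<in> E" for e using x_pos[OF that] x_le1[OF that] by simp
  show "sum x (inner E g S) \<le> real (card S) - 1" if S: "S \<subseteq> V - {r}" "S \<noteq> {}" for S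
  proof -
    have S': "S \<subseteq> V" "S \<noteq> V" using S r by auto
    show ?thesis using degree_sum[OF S'(1)] cut_ge[OF S'(1) S(2) S'(2)] by linarith
  qed
  show "sum x (inner E g (V - {r})) = real (card (V - {r})) - 1"
    using degree_sum[of "V - {r}"] cut_compl[of "{r}"] vertex_sum[OF r] by simp
  have notin: "\<not> g e \<subseteq> V - {r}" if "e \<in> dl {r}" for e using that by (auto simp: cut_def)
  show "H \<inter> dl {r} \<subseteq> E - inner E g (V - {r})"
    using notin WH(1) by (auto simp: inner_def)
  have pair: "sum x (H \<inter> dl {v}) = 1" if v: "v \<in> V" for v
  proof -
    obtain e h k where "h \<noteq> k" "dl {v} \<inter> H = {h, k}" "x h = \<theta>" "x k = 1 - \<theta>" by (rule cubicE[OF v all_cubic[OF v]])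
    then show ?thesis by (simp add: Int_commute)
  qed
  show "sum x (H \<inter> dl {r}) = 1" by (rule pair[OF r])
  show "W \<subseteq> E" by (auto simp: W_def)
  show "x e = 1" if "e \<in> W" for e using that by (simp add: W_def)
  show "E - inner E g (V - {r}) - H \<inter> dl {r} \<subseteq> W"
  proof
    fix e assume e: "e \<in> E - inner E g (V - {r}) - H \<inter> dl {r}"
    then have "r \<in> g e" using ends[of e] by (auto simp: inner_def)
    then have "e \<in> dl {r}" using mem_vertex_cut[of e r] e by simp
    then show "e \<in> W" using e WH(1) by blast
  qed
  show "P \<subseteq> E \<and> sum x P = 1" if P: "P \<in> (\<lambda>v. H \<inter> dl {v}) ` {v\<in>V. M \<inter> dl {v} \<noteq> {}}" for P
  proof -
    obtain v where "v \<in> V" "P = H \<inter> dl {v}" using P by blast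
    then show ?thesis using pair[of v] cut_sub[of E g "{v}"] by blast
  qed
  show "disjoint ((\<lambda>v. H \<inter> dl {v}) ` {v\<in>V. M \<inter> dl {v} \<noteq> {}})"
    unfolding disjoint_def
  proof (intro ballI impI, elim imageE, rule ccontr)
    fix A B u v assume A: "A = H \<inter> dl {u}" "u \<in> {v\<in>V. M \<inter> dl {v} \<noteq> {}}"
      and B: "B = H \<inter> dl {v}" "v \<in> {v\<in>V. M \<inter> dl {v} \<noteq> {}}" and ne: "A \<noteq> B" "A \<inter> B \<noteq> {}"
    obtain h where h: "h \<in> H" "h \<in> dl {u}" "h \<in> dl {v}" using ne A B by blast
    have uv: "u \<noteq> v" using ne A B by blast
    have hE: "h \<in> E" using h by (simp add: H_def)
    obtain a b where ab: "g h = {a, b}" by (rule ends_pair[OF hE])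
    have "u \<in> g h" "v \<in> g h" using h mem_vertex_cut[OF hE] by blast+
    then have gh: "g h = {u, v}" using ab uv by auto
    obtain e f where ef: "e \<in> M \<inter> dl {u}" "f \<in> M \<inter> dl {v}" using A B by blast
    \<comment> \<open>A shared H-edge is then parallel to a 1-edge. The set of their two ends has
      more than 1 inside, hence a cut below 2, so it is all of \<open>V\<close> and the two pairs
      coincide.\<close>
    have "e = f" by (rule sep[OF h(1) gh ef])
    have eE: "e \<in> E" and xe: "x e = 1" using ef M by (auto simp: W_def)
    obtain a b where ab: "g e = {a, b}" by (rule ends_pair[OF eE])
    have "u \<in> g e" "v \<in> g e" using ef \<open>e = f\<close> mem_vertex_cut[OF eE] by blast+
    then have ge: "g e = {u, v}" using ab uv by auto
    have sub: "{e, h} \<subseteq> inner E g {u, v}" using eE hE ge gh by (auto simp: inner_def)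
    have "e \<noteq> h" using xe h by (auto simp: H_def)
    then have "x e + x h = sum x {e, h}" by simp
    also have "\<dots> \<le> sum x (inner E g {u, v})"
      using sub x_pos finE by (intro sum_mono2) (auto simp: inner_def intro: less_imp_le)
    finally have in1: "1 + x h \<le> sum x (inner E g {u, v})" using xe by simp
    have uvV: "{u, v} \<subseteq> V" using A B by simp
    have "sum x (dl {u, v}) < 2" using degree_sum[OF uvV] in1 x_pos[OF hE] uv by simp
    then have "{u, v} = V" using cut_ge[OF uvV] by fastforce
    then have "V - {u} = {v}" using uv by blast
    then have "dl {u} = dl {v}" using cut_compl[of "{u}"] by simp
    then show False using ne A B by simp
  qed
qed

lemma joinpoint_01: "e \<in> E \<Longrightarrow> 0 \<le> joinpoint M e \<and> joinpoint M e \<le> 1"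
  using x_pos[of e] x_le1[of e] theta by (auto simp: joinpoint_def)

definition tjoin :: "'b set \<Rightarrow> 'b set \<Rightarrow> 'b \<Rightarrow> nat" where
  "tjoin T J e = of_bool (e \<in> T) + of_bool (e \<in> J)"

text \<open>The terminals are the odd vertices of the sampled \<open>T\<close>, so adding a join
  makes all degrees even. Every conditional law of the join has the same edge probabilities, which
  turns both expectations into expressions in \<open>x\<close> and \<open>joinpoint\<close>
  alone.\<close>

lemma tour_class:
  assumes r: "r \<in> V" and M: "M \<subseteq> W"
    and sep: "\<And>h v w e f. h \<in> H \<Longrightarrow> g h = {v, w} \<Longrightarrow> e \<in> M \<inter> dl {v} \<Longrightarrow> f \<in> M \<inter> dl {w} \<Longrightarrow> e = f"
    and M3: "\<And>U. U \<subseteq> V \<Longrightarrow> card (dl U) = 3 \<Longrightarrow> dl U \<subseteq> W \<Longrightarrow> card (M \<inter> dl U) \<le> 1"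
  shows "\<exists>p. finite (set_pmf p) \<and> (\<forall>F\<in>set_pmf p. rooted_tour V E g x r F) \<and>
    (\<forall>e\<in>E. mean p (\<lambda>F. real (F e)) = x e + joinpoint M e \<and>
       mean p (\<lambda>F. of_bool (odd (F e))) = joinpoint M e + x e * (1 - 2 * joinpoint M e))"
proof -
  let ?z = "joinpoint M"
  have "\<exists>p. (\<forall>T\<in>set_pmf p. rainbow E g (V - {r}) W
      (insert (H \<inter> dl {r}) ((\<lambda>v. H \<inter> dl {v}) ` {v\<in>V. M \<inter> dl {v} \<noteq> {}})) T) \<and>
    (\<forall>e\<in>E. mean p (\<lambda>T. of_bool (e \<in> T)) = x e)"
    by (rule rainbow_trees[OF r M], rule sep)
  then obtain p where p: "\<forall>T\<in>set_pmf p. rainbow E g (V - {r}) W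
      (insert (H \<inter> dl {r}) ((\<lambda>v. H \<inter> dl {v}) ` {v\<in>V. M \<inter> dl {v} \<noteq> {}})) T"
    "\<forall>e\<in>E. mean p (\<lambda>T. of_bool (e \<in> T)) = x e"
    by (elim exE conjE)
  have fp: "finite (set_pmf p)"
    by (rule finite_subset[of _ "Pow E"]) (use p(1) finE in \<open>auto simp: rainbow_def\<close>)
  define Q where "Q T = {v\<in>V. odd (card (T \<inter> dl {v}))}" for T
  have TW: "W \<subseteq> T" "T \<subseteq> E" if "T \<in> set_pmf p" for T using p(1) that by (auto simp: rainbow_def)
  have "joinable V E g (Q T) ?z" if T: "T \<in> set_pmf p" for T
  proof (rule joinable_if_blossom[OF mgraph_axioms])
    show "blossom V E g (Q T) ?z"
      unfolding Q_def
    proof (rule joinpoint_blossom[OF M TW[OF T]])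
      show "card (M \<inter> dl U) \<le> 1" if "U \<subseteq> V" "card (dl U) = 3" "dl U \<subseteq> W" for U
        using that by (rule M3)
      fix v e assume v: "v \<in> V" "e \<in> M" "e \<in> dl {v}"
      then have "H \<inter> dl {v} \<in> insert (H \<inter> dl {r}) ((\<lambda>v. H \<inter> dl {v}) ` {v\<in>V. M \<inter> dl {v} \<noteq> {}})" by blast
      then show "card (T \<inter> (H \<inter> dl {v})) = 1" using p(1) T unfolding rainbow_def by blast
    qed
    show "Q T \<subseteq> V" by (auto simp: Q_def)
    show "\<forall>e\<in>E. 0 \<le> ?z e \<and> ?z e \<le> 1" using joinpoint_01 by blast
  qed
  then have "\<forall>T\<in>set_pmf p. \<exists>q. (\<forall>J\<in>set_pmf q. join V E g (Q T) J) \<and> (\<forall>e\<in>E. mean q (\<lambda>J. of_bool (e \<in> J)) = ?z e)"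
    unfolding joinable_def by blast
  then obtain q where q: "\<forall>T\<in>set_pmf p. (\<forall>J\<in>set_pmf (q T). join V E g (Q T) J) \<and>
      (\<forall>e\<in>E. mean (q T) (\<lambda>J. of_bool (e \<in> J)) = ?z e)" by (rule bchoice[THEN exE])
  have fq: "finite (set_pmf (q T))" if "T \<in> set_pmf p" for T
    using q that join_finite[OF finE] by blast
  define P where "P = bind_pmf p (\<lambda>T. map_pmf (tjoin T) (q T))"
  have mP: "mean P f = mean p (\<lambda>T. mean (q T) (\<lambda>J. f (tjoin T J)))" for f
    unfolding P_def using fp fq by (subst mean_bind) auto
  have "rooted_tour V E g x r F" if "F \<in> set_pmf P" for F
  proof -
    obtain T J where TJ: "T \<in> set_pmf p" "J \<in> set_pmf (q T)" "F = tjoin T J" using \<open>F \<in> set_pmf P\<close> by (auto simp: P_def)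
    have rb: "rainbow E g (V - {r}) W
      (insert (H \<inter> dl {r}) ((\<lambda>v. H \<inter> dl {v}) ` {v\<in>V. M \<inter> dl {v} \<noteq> {}})) T" using p(1) TJ(1) by blast
    have jn: "join V E g (Q T) J" using q TJ by blast
    show ?thesis
      unfolding rooted_tour_def
    proof (intro conjI ballI allI impI)
      fix v assume v: "v \<in> V"
      have "sum F (dl {v}) = card (T \<inter> dl {v}) + card (J \<inter> dl {v})"
        unfolding TJ(3) tjoin_def sum.distrib card_Int_cut ..
      moreover have "odd (card (J \<inter> dl {v})) \<longleftrightarrow> odd (card (T \<inter> dl {v}))"
        using jn v by (simp add: join_def Q_def)
      ultimately show "even (sum F (dl {v}))" by simp
    next
      fix e assume "e \<in> E" "x e = 1"
      then have "e \<in> T" using TW(1)[OF TJ(1)] by (auto simp: W_def)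
      then show "1 \<le> F e" by (simp add: TJ(3) tjoin_def)
    next
      have "card (T \<inter> (H \<inter> dl {r})) = 1" using rb unfolding rainbow_def by blast
      then have "T \<inter> (H \<inter> dl {r}) \<noteq> {}" by force
      then obtain h where "h \<in> T" "h \<in> H" "h \<in> dl {r}" by blast
      then show "\<exists>h\<in>dl {r}. x h < 1 \<and> 0 < F h"
        by (intro bexI[of _ h]) (auto simp: H_def TJ(3) tjoin_def)
    next
      fix S assume "S \<subseteq> V - {r}" "S \<noteq> {}" "S \<noteq> V - {r}"
      then obtain e where e: "e \<in> T" "g e \<subseteq> V - {r}" "e \<in> dl S" using rb unfolding rainbow_def by blast
      moreover have "e \<in> E" using e(1) TW(2)[OF TJ(1)] by blast
      ultimately show "\<exists>e\<in>E. 0 < F e \<and> g e \<subseteq> V - {r} \<and> e \<in> dl S"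
        by (intro bexI[of _ e]) (auto simp: TJ(3) tjoin_def)
    qed
  qed
  moreover have "finite (set_pmf P)" using fp fq by (simp add: P_def)
  moreover have "mean P (\<lambda>F. real (F e)) = x e + ?z e" if e: "e \<in> E" for e
  proof -
    have "mean P (\<lambda>F. real (F e)) = mean p (\<lambda>T. of_bool (e \<in> T) + ?z e)"
      unfolding mP
    proof (rule mean_cong)
      fix T assume T: "T \<in> set_pmf p"
      have "mean (q T) (\<lambda>J. real (tjoin T J e)) = mean (q T) (\<lambda>J. of_bool (e \<in> T) + of_bool (e \<in> J))"
        by (intro mean_cong) (simp add: tjoin_def)
      also have "\<dots> = of_bool (e \<in> T) + ?z e" using q T e by (simp add: mean_add[OF fq[OF T]])
      finally show "mean (q T) (\<lambda>J. real (tjoin T J e)) = of_bool (e \<in> T) + ?z e" .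
    qed
    also have "\<dots> = x e + ?z e" using p(2) e by (simp add: mean_add[OF fp])
    finally show ?thesis .
  qed
  moreover have "mean P (\<lambda>F. of_bool (odd (F e))) = ?z e + x e * (1 - 2 * ?z e)" if e: "e \<in> E" for e
  proof -
    have "mean P (\<lambda>F. of_bool (odd (F e))) = mean p (\<lambda>T. ?z e + of_bool (e \<in> T) * (1 - 2 * ?z e))"
      unfolding mP
    proof (rule mean_cong)
      fix T assume T: "T \<in> set_pmf p"
      have "mean (q T) (\<lambda>J. of_bool (odd (tjoin T J e))) =
          mean (q T) (\<lambda>J. if e \<in> T then 1 - of_bool (e \<in> J) else of_bool (e \<in> J))"
        by (intro mean_cong) (simp add: tjoin_def)
      also have "\<dots> = ?z e + of_bool (e \<in> T) * (1 - 2 * ?z e)"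
        using q T e by (simp add: mean_diff[OF fq[OF T]])
      finally show "mean (q T) (\<lambda>J. of_bool (odd (tjoin T J e))) = ?z e + of_bool (e \<in> T) * (1 - 2 * ?z e)" .
    qed
    also have "\<dots> = ?z e + x e * (1 - 2 * ?z e)" using p(2) e by (simp add: mean_add[OF fp])
    finally show ?thesis .
  qed
  ultimately show ?thesis by (intro exI[of _ P]) simp
qed

theorem base_decomposes:
  assumes r: "r \<in> V"
  shows "decomposes V E g x \<theta> r"
proof (rule five_colouring)
  fix c :: "'b \<Rightarrow> nat"
  assume c: "\<And>e. e \<in> W \<Longrightarrow> c e < 5"
    "\<And>h v w e f. h \<in> H \<Longrightarrow> g h = {v, w} \<Longrightarrow> e \<in> W \<inter> dl {v} \<Longrightarrow> f \<in> W \<inter> dl {w} \<Longrightarrow> e \<noteq> f \<Longrightarrow> c e \<noteq> c f"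
    "\<And>U. U \<subseteq> V \<Longrightarrow> card (dl U) = 3 \<Longrightarrow> dl U \<subseteq> W \<Longrightarrow> inj_on c (dl U)"
  define M where "M i = {e \<in> W. c e = i}" for i
  have "\<exists>p. finite (set_pmf p) \<and> (\<forall>F\<in>set_pmf p. rooted_tour V E g x r F) \<and>
    (\<forall>e\<in>E. mean p (\<lambda>F. real (F e)) = x e + joinpoint (M i) e \<and>
       mean p (\<lambda>F. of_bool (odd (F e))) = joinpoint (M i) e + x e * (1 - 2 * joinpoint (M i) e))" for i
  proof (rule tour_class[OF r])
    show "M i \<subseteq> W" by (auto simp: M_def)
    show "e = f" if "h \<in> H" "g h = {v, w}" "e \<in> M i \<inter> dl {v}" "f \<in> M i \<inter> dl {w}" for h v w e f
      using c(2)[OF that(1,2), of e f] that(3,4) by (auto simp: M_def)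
    show "card (M i \<inter> dl U) \<le> 1" if "U \<subseteq> V" "card (dl U) = 3" "dl U \<subseteq> W" for U
      using c(3)[OF that] by (auto simp: M_def inj_on_def card_le_Suc0_iff_eq)
  qed
  then obtain p where p: "\<And>i. finite (set_pmf (p i)) \<and> (\<forall>F\<in>set_pmf (p i). rooted_tour V E g x r F) \<and>
    (\<forall>e\<in>E. mean (p i) (\<lambda>F. real (F e)) = x e + joinpoint (M i) e \<and>
       mean (p i) (\<lambda>F. of_bool (odd (F e))) = joinpoint (M i) e + x e * (1 - 2 * joinpoint (M i) e))"
    by metis
  define P where "P = bind_pmf (pmf_of_set {..<5}) p"
  have n5: "{..<5::nat} \<noteq> {}" "finite {..<5::nat}" by (auto simp: lessThan_empty_iff)
  have mP: "mean P f = (\<Sum>i<5. mean (p i) f) / 5" for f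
  proof -
    have "mean P f = (\<Sum>i<5. mean (p i) f /\<^sub>R real (card {..<5::nat}))"
      unfolding P_def by (rule pmf_expectation_bind_pmf_of_set[OF n5]) (use p in blast)
    also have "\<dots> = (\<Sum>i<5. mean (p i) f / 5)"
      by (rule sum.cong) simp_all
    finally show ?thesis by (simp only: sum_divide_distrib)
  qed
  have zH: "joinpoint (M i) e = x e / 2" if "x e \<noteq> 1" for i e
    using that by (auto simp: joinpoint_def M_def W_def)
  \<comment> \<open>A 1-edge is lowered by \<theta>/2 in exactly one of the five summands.\<close>
  have zW: "(\<Sum>i<5. joinpoint (M i) e) = 5/2 - \<theta>/2" if "e \<in> W" for e
  proof -
    have "(\<Sum>i<5. joinpoint (M i) e) = (\<Sum>i<5. 1/2 - (if i = c e then \<theta>/2 else 0))"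
      using that by (intro sum.cong) (auto simp: joinpoint_def M_def W_def)
    also have "\<dots> = 5/2 - (\<Sum>i<5. if i = c e then \<theta>/2 else 0)" by (simp add: sum_subtractf)
    also have "(\<Sum>i<5. if i = c e then \<theta>/2 else 0) = \<theta>/2" using c(1)[OF that] by simp
    finally show ?thesis .
  qed
  have "mean P (\<lambda>F. real (F e)) = target x \<theta> e \<and> mean P (\<lambda>F. of_bool (odd (F e))) = odd_target x \<theta> e"
    if e: "e \<in> E" for e
  proof -
    have m: "mean P (\<lambda>F. real (F e)) = (\<Sum>i<5. x e + joinpoint (M i) e) / 5"
      "mean P (\<lambda>F. of_bool (odd (F e))) = (\<Sum>i<5. joinpoint (M i) e + x e * (1 - 2 * joinpoint (M i) e)) / 5"
      unfolding mP using p e by simp_all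
    show ?thesis
    proof (cases "x e = 1")
      case True
      then have "e \<in> W" using e by (simp add: W_def)
      then show ?thesis unfolding m target_def odd_target_def
        using True zW by (simp add: sum.distrib sum_subtractf)
    next
      case False
      have k: "(\<Sum>i<5::nat. K) / 5 = K" for K :: real by simp
      show ?thesis unfolding m target_def odd_target_def zH[OF False] k using False by (simp add: algebra_simps)
    qed
  qed
  moreover have "finite (set_pmf P)" using p n5 by (simp add: P_def set_pmf_of_set)
  moreover have "\<forall>F\<in>set_pmf P. rooted_tour V E g x r F" using p n5 by (simp add: P_def set_pmf_of_set)
  ultimately show "decomposes V E g x \<theta> r" unfolding decomposes_def exact_marginals_def by blast
qed

end

section \<open>Contraction and glueing\<close>

text \<open>The vertex condition of \<open>theta_graph\<close>, stated for an arbitrary edge set: a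
  cut of this form can serve as the cut of a contracted vertex.\<close>

definition vertex_type :: "('e \<Rightarrow> real) \<Rightarrow> real \<Rightarrow> 'e set \<Rightarrow> bool" where
  "vertex_type x \<theta> D \<longleftrightarrow> (\<exists>e f. e \<noteq> f \<and> D = {e, f} \<and> x e = 1 \<and> x f = 1) \<or>
      (\<exists>e h k. e \<noteq> h \<and> e \<noteq> k \<and> h \<noteq> k \<and> D = {e, h, k} \<and> x e = 1 \<and> x h = \<theta> \<and> x k = 1 - \<theta>)"

lemma vertex_type_card: "vertex_type x \<theta> D \<Longrightarrow> finite D \<and> card D \<le> 3"
  by (auto simp: vertex_type_def)

text \<open>The vertex type is kept: \<open>A\<close> is represented by a vertex \<open>u\<close>,
  chosen in \<open>A\<close>. Edges inside \<open>A\<close> would become loops and are removed by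
  \<open>E - inner E g A\<close>.\<close>

definition contr :: "'v set \<Rightarrow> 'v \<Rightarrow> 'v \<Rightarrow> 'v" where
  "contr A u v = (if v \<in> A then u else v)"

definition cends :: "('e \<Rightarrow> 'v set) \<Rightarrow> 'v set \<Rightarrow> 'v \<Rightarrow> 'e \<Rightarrow> 'v set" where
  "cends g A u e = contr A u ` g e"

context theta_graph
begin

lemma cut_cends:
  assumes "u \<in> A"
  shows "cut (E - inner E g A) (cends g A u) S = dl (V \<inter> contr A u -` S)"
proof -
  have "cut (E - inner E g A) (cends g A u) S = dl (contr A u -` S) - inner E g A"
    unfolding cut_diff cends_def cut_image ..
  also have "\<dots> = dl (contr A u -` S)"
  proof -
    have "e \<notin> dl (contr A u -` S)" if "e \<in> inner E g A" for e
    proof -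
      have "\<forall>y\<in>g e. contr A u y = u" using that by (auto simp: inner_def contr_def)
      then show ?thesis by (auto simp: cut_def)
    qed
    then show ?thesis by blast
  qed
  finally show ?thesis by (simp add: cut_V)
qed

lemma cut_cends_out: "u \<in> A \<Longrightarrow> v \<in> V - A \<Longrightarrow> cut (E - inner E g A) (cends g A u) {v} = dl {v}"
proof -
  assume u: "u \<in> A" and v: "v \<in> V - A"
  then have "V \<inter> contr A u -` {v} = {v}" by (auto simp: contr_def split: if_splits)
  then show ?thesis using cut_cends[OF u] by simp
qed

lemma cut_cends_in: "u \<in> A \<Longrightarrow> A \<subseteq> V \<Longrightarrow> cut (E - inner E g A) (cends g A u) {u} = dl A"
proof -
  assume u: "u \<in> A" and A: "A \<subseteq> V"
  then have "V \<inter> contr A u -` {u} = A" by (auto simp: contr_def split: if_splits)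
  then show ?thesis using cut_cends[OF u] by simp
qed

text \<open>Cuts of the contraction are cuts of the original, so \<open>cut_ge\<close> is inherited;
  the only new vertex has the cut \<open>dl A\<close>, for which the vertex condition is
  assumed.\<close>

lemma theta_graph_contract:
  assumes A: "A \<subseteq> V" "A \<noteq> V" "u \<in> A" and t: "vertex_type x \<theta> (dl A)"
  shows "theta_graph (insert u (V - A)) (E - inner E g A) (cends g A u) x \<theta>"
proof -
  have im: "contr A u ` V = insert u (V - A)" using A by (auto simp: contr_def)
  interpret c: mgraph "contr A u ` V" E "cends g A u"
    using mgraph_image[of "contr A u"] by (simp add: cends_def[abs_def])
  have mg: "mgraph (insert u (V - A)) (E - inner E g A) (cends g A u)"
    using c.mgraph_delete[of "inner E g A"] unfolding im .
  have fV: "finite (V - A)" using finV by simp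
  have neA: "V - A \<noteq> {}" using A by blast
  show ?thesis
  proof (rule theta_graph.intro[OF mg], unfold_locales)
    show "0 < \<theta>" "\<theta> \<le> 1/2" by (rule theta)+
    fix e assume e: "e \<in> E - inner E g A"
    obtain a b where ab: "g e = {a, b}" "a \<in> V" "b \<in> V" "a \<noteq> b" using edge_ends[of e] e by blast
    have "\<not> (a \<in> A \<and> b \<in> A)" using e ab by (auto simp: inner_def)
    then have "contr A u a \<noteq> contr A u b" using A ab(4) by (auto simp: contr_def)
    then show "card (cends g A u e) = 2" using ab by (simp add: cends_def)
  next
    have "card (V - A) \<noteq> 0" using fV neA by simp
    moreover have "card (insert u (V - A)) = Suc (card (V - A))" using A fV by simp
    ultimately show "2 \<le> card (insert u (V - A))" by linarith
  next
    fix v assume v: "v \<in> insert u (V - A)"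
    have "vertex_type x \<theta> (cut (E - inner E g A) (cends g A u) {v})"
    proof (cases "v = u")
      case True
      then show ?thesis using t cut_cends_in[OF A(3,1)] by simp
    next
      case False
      then have "v \<in> V - A" using v by blast
      moreover have "vertex_type x \<theta> (dl {v})" using vertex[of v] v False unfolding vertex_type_def by blast
      ultimately show ?thesis using cut_cends_out[OF A(3)] by simp
    qed
    then show "(\<exists>e f. e \<noteq> f \<and> cut (E - inner E g A) (cends g A u) {v} = {e, f} \<and> x e = 1 \<and> x f = 1) \<or>
      (\<exists>e h k. e \<noteq> h \<and> e \<noteq> k \<and> h \<noteq> k \<and> cut (E - inner E g A) (cends g A u) {v} = {e, h, k} \<and> x e = 1 \<and> x h = \<theta> \<and> x k = 1 - \<theta>)"
      unfolding vertex_type_def .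
  next
    fix S assume S: "S \<subseteq> insert u (V - A)" "S \<noteq> {}" "S \<noteq> insert u (V - A)"
    obtain s where s: "s \<in> S" using S by blast
    have "contr A u s = s" "s \<in> V" using s S(1) A by (auto simp: contr_def)
    then have ne: "V \<inter> contr A u -` S \<noteq> {}" using s by blast
    obtain s' where s': "s' \<in> insert u (V - A)" "s' \<notin> S" using S by blast
    have "contr A u s' = s'" "s' \<in> V" using s' A by (auto simp: contr_def)
    then have "s' \<in> V" "s' \<notin> contr A u -` S" using s' by auto
    then have "V \<inter> contr A u -` S \<noteq> V" by blast
    then show "2 \<le> sum x (cut (E - inner E g A) (cends g A u) S)"
      unfolding cut_cends[OF A(3)] by (intro cut_ge ne) auto
  qed
qed

text \<open>On a cut of at most three edges, an even parity pattern is an affine function of the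
  parities of the single edges.\<close>

lemma pattern_affine:
  assumes D: "finite D" "card D \<le> 3" and A: "A \<subseteq> D" "even (card A)"
  shows "of_bool (A = S) = (if S = {} then 1 - (\<Sum>e\<in>D. of_bool (e \<in> A)) / 2
     else if S \<subseteq> D \<and> card S = 2 then ((\<Sum>e\<in>S. of_bool (e \<in> A)) - (\<Sum>e\<in>D - S. of_bool (e \<in> A))) / 2 else (0::real))"
proof -
  have fA: "finite A" using A D finite_subset by blast
  have cnt: "(\<Sum>e\<in>B. of_bool (e \<in> A)) = (real (card (B \<inter> A)))" if "B \<subseteq> D" for B
    using that D finite_subset[of B D] by (simp add: Int_commute)
  have "card A \<le> 3" using A D card_mono[of D A] by linarith
  moreover have "card A \<noteq> 1" "card A \<noteq> 3" using A(2) by auto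
  ultimately have "card A = 0 \<or> card A = 2" by linarith
  then consider "A = {}" | "card A = 2" using fA by auto
  then show ?thesis
  proof cases
    case 1
    then show ?thesis by auto
  next
    case 2
    have DA: "D \<inter> A = A" using A by blast
    have Ane: "A \<noteq> {}" using 2 by auto
    show ?thesis
    proof (cases "S \<noteq> {} \<and> S \<subseteq> D \<and> card S = 2")
      case True
      have fS: "finite S" using True D finite_subset by blast
      have DS: "(D - S) \<inter> A = A - S" using A by blast
      have c: "card A = card (S \<inter> A) + card (A - S)" using card_Int_Diff[OF fA, of S] by (simp add: Int_commute)
      have eq: "((\<Sum>e\<in>S. of_bool (e \<in> A)) - (\<Sum>e\<in>D - S. of_bool (e \<in> A))) / 2 = (real (card (S \<inter> A)) - real (card (A - S))) / 2"
        using True cnt[of S] cnt[of "D - S"] DS by simp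
      show ?thesis
      proof (cases "A = S")
        case True
        then show ?thesis using eq \<open>S \<noteq> {} \<and> S \<subseteq> D \<and> card S = 2\<close> by simp
      next
        case False
        \<comment> \<open>Two different pairs among at most three elements share exactly one, so the
          two sums cancel.\<close>
        have "card (S \<union> A) \<le> 3" using True A D card_mono[of D "S \<union> A"] by simp
        moreover have "card S + card A = card (S \<union> A) + card (S \<inter> A)" using fS fA by (rule card_Un_Int)
        moreover have "card (S \<inter> A) \<noteq> 2"
        proof
          assume "card (S \<inter> A) = 2"
          then have "S \<inter> A = S" "S \<inter> A = A"
            using 2 True card_subset_eq[OF fS Int_lower1, of A] card_subset_eq[OF fA Int_lower2, of S] by simp_all
          then show False using False by blast
        qed
        moreover have "card (S \<inter> A) \<le> 2" using 2 fA card_mono[of A "S \<inter> A"] by simp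
        ultimately have "card (S \<inter> A) = 1" "card (A - S) = 1" using c 2 True by linarith+
        then have "((\<Sum>e\<in>S. of_bool (e \<in> A)) - (\<Sum>e\<in>D - S. of_bool (e \<in> A))) / 2 = (0::real)" unfolding eq by simp
        then show ?thesis using True False by simp
      qed
    next
      case False
      then have "A = S \<longleftrightarrow> False" using 2 A Ane by auto
      then show ?thesis using False cnt[of D] DA 2 by auto
    qed
  qed
qed

text \<open>Expectation commutes with the affine formula of \<open>pattern_affine\<close>, so the
  law of the pattern depends only on the parity probabilities of single edges.\<close>

lemma pattern_pmf_eq:
  fixes p q :: "('c \<Rightarrow> nat) pmf"
  assumes D: "finite D" "card D \<le> 3" and fin: "finite (set_pmf p)" "finite (set_pmf q)"
    and even: "\<And>F. F \<in> set_pmf p \<union> set_pmf q \<Longrightarrow> even (sum F D)"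
    and eq: "\<And>e. e \<in> D \<Longrightarrow> mean p (\<lambda>F. of_bool (odd (F e))) = mean q (\<lambda>F. of_bool (odd (F e)))"
  shows "map_pmf (\<lambda>F. {e\<in>D. odd (F e)}) p = map_pmf (\<lambda>F. {e\<in>D. odd (F e)}) q"
proof (rule pmf_eqI)
  fix S
  define b where "b \<longleftrightarrow> S \<subseteq> D \<and> card S = 2"
  define val where "val G = (if S = {} then 1 - (\<Sum>e\<in>D. G e) / 2
     else if b then ((\<Sum>e\<in>S. G e) - (\<Sum>e\<in>D - S. G e)) / 2 else (0::real))" for G
  have calc: "pmf (map_pmf (\<lambda>F. {e\<in>D. odd (F e)}) r) S = val (\<lambda>e. mean r (\<lambda>F. of_bool (odd (F e))))"
    if fr: "finite (set_pmf r)" and ev: "\<And>F. F \<in> set_pmf r \<Longrightarrow> even (sum F D)" for r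
  proof -
    have "pmf (map_pmf (\<lambda>F. {e\<in>D. odd (F e)}) r) S = mean r (\<lambda>F. of_bool ({e\<in>D. odd (F e)} = S))"
      by (simp add: pmf_eq_mean)
    also have "\<dots> = mean r (\<lambda>F. val (\<lambda>e. of_bool (odd (F e))))"
    proof (rule mean_cong)
      fix F assume "F \<in> set_pmf r"
      then have "even (card {e\<in>D. odd (F e)})" using ev even_sum_iff[OF D(1), of F] by simp
      then have "of_bool ({e\<in>D. odd (F e)} = S) = val (\<lambda>e. of_bool (e \<in> {e\<in>D. odd (F e)}))"
        unfolding val_def b_def by (intro pattern_affine[OF D]) auto
      also have "\<dots> = val (\<lambda>e. of_bool (odd (F e)))"
        unfolding val_def b_def by (auto intro!: sum.cong arg_cong2[of _ _ _ _ "(-)"] arg_cong2[of _ _ _ _ "(/)"])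
      finally show "of_bool ({e\<in>D. odd (F e)} = S) = val (\<lambda>e. of_bool (odd (F e)))" .
    qed
    also have "\<dots> = val (\<lambda>e. mean r (\<lambda>F. of_bool (odd (F e))))"
      by (cases "S = {}"; cases b) (simp_all add: val_def mean_diff[OF fr] mean_sum[OF fr])
    finally show ?thesis .
  qed
  have "val (\<lambda>e. mean p (\<lambda>F. of_bool (odd (F e)))) = val (\<lambda>e. mean q (\<lambda>F. of_bool (odd (F e))))"
    unfolding val_def b_def using eq by (auto intro!: sum.cong arg_cong2[of _ _ _ _ "(-)"] arg_cong2[of _ _ _ _ "(/)"])
  then show "pmf (map_pmf (\<lambda>F. {e\<in>D. odd (F e)}) p) S = pmf (map_pmf (\<lambda>F. {e\<in>D. odd (F e)}) q) S"
    using calc[OF fin(1)] calc[OF fin(2)] even by simp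
qed

text \<open>After coupling, edges inside \<open>U\<close> come from \<open>q\<close>, all others,
  those of the cut included, from \<open>p\<close>. At vertices of \<open>U\<close> only the
  parities on the cut matter, and these agree; since \<open>q\<close> connects \<open>U\<close> by
  itself, connectivity never relies on its multiplicities on the cut.\<close>

lemma glue:
  assumes U: "U \<subseteq> V" "u \<in> U" and r: "r \<in> V - U" and t: "vertex_type x \<theta> (dl U)"
    and p: "exact_marginals (E - inner E g U) x \<theta> p"
      "\<forall>F\<in>set_pmf p. rooted_tour (insert u (V - U)) (E - inner E g U) (cends g U u) x r F"
    and q: "exact_marginals (E - inner E g (V - U)) x \<theta> q"
      "\<And>F v. F \<in> set_pmf q \<Longrightarrow> v \<in> U \<Longrightarrow> even (sum F (dl {v}))"
      "\<And>F. F \<in> set_pmf q \<Longrightarrow> even (sum F (dl U))"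
      "\<And>F e. F \<in> set_pmf q \<Longrightarrow> e \<in> E - inner E g (V - U) \<Longrightarrow> x e = 1 \<Longrightarrow> 1 \<le> F e"
      "\<And>F S. F \<in> set_pmf q \<Longrightarrow> S \<subseteq> U \<Longrightarrow> S \<noteq> {} \<Longrightarrow> S \<noteq> U \<Longrightarrow> \<exists>e\<in>inner E g U. 0 < F e \<and> e \<in> dl S"
  shows "decomposes V E g x \<theta> r"
proof -
  let ?E1 = "E - inner E g U" and ?E2 = "E - inner E g (V - U)" and ?g1 = "cends g U u" and ?V1 = "insert u (V - U)"
  define pat where "pat F = {e\<in>dl U. odd (F e)}" for F :: "'e \<Rightarrow> nat"
  have fp: "finite (set_pmf p)" and fq: "finite (set_pmf q)" using p q by (auto simp: exact_marginals_def)
  have dlU: "dl U \<subseteq> ?E1" "dl U \<subseteq> ?E2" using U by (auto simp: cut_def inner_def)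
  have "map_pmf pat p = map_pmf pat q"
    unfolding pat_def
  proof (rule pattern_pmf_eq)
    show "finite (dl U)" "card (dl U) \<le> 3" using vertex_type_card[OF t] by auto
    show "even (sum F (dl U))" if "F \<in> set_pmf p \<union> set_pmf q" for F
    proof (cases "F \<in> set_pmf q")
      case True
      then show ?thesis by (rule q(3))
    next
      case False
      then have "rooted_tour ?V1 ?E1 ?g1 x r F" using that p(2) by blast
      then have "even (sum F (cut ?E1 ?g1 {u}))" unfolding rooted_tour_def by blast
      then show ?thesis unfolding cut_cends_in[OF U(2,1)] .
    qed
    show "mean p (\<lambda>F. of_bool (odd (F e))) = mean q (\<lambda>F. of_bool (odd (F e)))" if "e \<in> dl U" for e
      using that dlU p(1) q(1) unfolding exact_marginals_def by (metis subsetD)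
  qed (use fp fq in auto)
  then obtain pq where pq: "map_pmf fst pq = p" "map_pmf snd pq = q"
    "\<And>F G. (F, G) \<in> set_pmf pq \<Longrightarrow> F \<in> set_pmf p \<and> G \<in> set_pmf q \<and> pat F = pat G"
    by (rule pmf_coupling) blast
  define R :: "('e \<Rightarrow> nat) \<times> ('e \<Rightarrow> nat) \<Rightarrow> 'e \<Rightarrow> nat"
    where "R = (\<lambda>(F, G) e. if g e \<subseteq> U then G e else F e)"
  have tour: "rooted_tour V E g x r (R (F, G))" if FG: "(F, G) \<in> set_pmf pq" for F G
  proof -
    have F: "F \<in> set_pmf p" and G: "G \<in> set_pmf q" and same: "pat F = pat G" using pq(3)[OF FG] by auto
    have rt: "rooted_tour ?V1 ?E1 ?g1 x r F" using F p(2) by blast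
    have rF: "\<And>v. v \<in> ?V1 \<Longrightarrow> even (sum F (cut ?E1 ?g1 {v}))" "\<And>e. e \<in> ?E1 \<Longrightarrow> x e = 1 \<Longrightarrow> 1 \<le> F e"
      "\<exists>h\<in>cut ?E1 ?g1 {r}. x h < 1 \<and> 0 < F h"
      "\<And>S. S \<subseteq> ?V1 - {r} \<Longrightarrow> S \<noteq> {} \<Longrightarrow> S \<noteq> ?V1 - {r} \<Longrightarrow> \<exists>e\<in>?E1. 0 < F e \<and> ?g1 e \<subseteq> ?V1 - {r} \<and> e \<in> cut ?E1 ?g1 S"
      using rt unfolding rooted_tour_def by blast+
    have outs: "\<not> g e \<subseteq> U" if "v \<notin> U" "e \<in> dl {v}" for v e using that by (auto simp: cut_def)
    show ?thesis
      unfolding rooted_tour_def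
    proof (intro conjI ballI allI impI)
      fix v assume v: "v \<in> V"
      show "even (sum (R (F, G)) (dl {v}))"
      proof (cases "v \<in> U")
        case True
        have "odd (R (F, G) e) \<longleftrightarrow> odd (G e)" if e: "e \<in> dl {v}" for e
        proof (cases "g e \<subseteq> U")
          case True
          then show ?thesis by (simp add: R_def)
        next
          case False
          have "e \<in> dl U" using e False \<open>v \<in> U\<close> by (auto simp: cut_def)
          then have "odd (F e) \<longleftrightarrow> odd (G e)" using same by (auto simp: pat_def)
          then show ?thesis using False by (simp add: R_def)
        qed
        then have "{e \<in> dl {v}. odd (R (F, G) e)} = {e \<in> dl {v}. odd (G e)}" by blast
        then show ?thesis using even_sum_iff[of "dl {v}" "R (F, G)"] even_sum_iff[of "dl {v}" G] q(2)[OF G True] by simp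
      next
        case False
        have "sum (R (F, G)) (dl {v}) = sum F (dl {v})"
          using outs[OF False] by (intro sum.cong) (auto simp: R_def)
        then show ?thesis using rF(1)[of v] cut_cends_out[OF U(2), of v] v False by simp
      qed
    next
      fix e assume e: "e \<in> E" "x e = 1"
      show "1 \<le> R (F, G) e"
      proof (cases "g e \<subseteq> U")
        case True
        then have "e \<in> ?E2" using e ends[OF e(1)] by (auto simp: inner_def)
        then show ?thesis using q(4)[OF G _ e(2)] True by (simp add: R_def)
      next
        case False
        then have "e \<in> ?E1" using e by (auto simp: inner_def)
        then show ?thesis using rF(2)[OF _ e(2)] False by (simp add: R_def)
      qed
    next
      obtain h where h: "h \<in> dl {r}" "x h < 1" "0 < F h"
        using rF(3) cut_cends_out[OF U(2) r] by auto
      then show "\<exists>h\<in>dl {r}. x h < 1 \<and> 0 < R (F, G) h"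
        using outs[of r h] r by (intro bexI[of _ h]) (auto simp: R_def)
    next
      fix S assume S: "S \<subseteq> V - {r}" "S \<noteq> {}" "S \<noteq> V - {r}"
      show "\<exists>e\<in>E. 0 < R (F, G) e \<and> g e \<subseteq> V - {r} \<and> e \<in> dl S"
      proof (cases "S \<inter> U \<noteq> {} \<and> S \<inter> U \<noteq> U")
        case True
        then obtain e where e: "e \<in> inner E g U" "0 < G e" "e \<in> dl (S \<inter> U)" using q(5)[OF G, of "S \<inter> U"] by blast
        then show ?thesis using U(1) r by (intro bexI[of _ e]) (auto simp: R_def inner_def cut_def)
      next
        case False
        \<comment> \<open>\<open>S\<close> contains \<open>U\<close> or misses it, so it is the
          preimage of \<open>S1\<close>, and an edge that crosses \<open>S1\<close> in the
          contraction crosses \<open>S\<close>.\<close>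
        define S1 where "S1 = (if U \<subseteq> S then insert u (S - U) else S)"
        have dich: "U \<subseteq> S \<or> S \<inter> U = {}" using False by blast
        have pre: "V \<inter> contr U u -` S1 = S"
          using dich S(1) U by (auto simp: S1_def contr_def split: if_splits)
        have "S1 \<subseteq> ?V1 - {r}" using S(1) U r dich by (auto simp: S1_def split: if_splits)
        moreover have "S1 \<noteq> {}" using S(2) by (auto simp: S1_def)
        moreover have "S1 \<noteq> ?V1 - {r}"
        proof
          assume eq: "S1 = ?V1 - {r}"
          have "u \<noteq> r" using U r by blast
          then have "u \<in> S1" using eq by blast
          then have US: "U \<subseteq> S" using dich U(2) by (auto simp: S1_def split: if_splits)
          have "V - {r} \<subseteq> S"
          proof
            fix y assume y: "y \<in> V - {r}"
            show "y \<in> S"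
            proof (cases "y \<in> U")
              case True
              then show ?thesis using US by blast
            next
              case False
              then have "y \<in> S1" using y unfolding eq by blast
              then show ?thesis using US False U(2) by (auto simp: S1_def)
            qed
          qed
          then show False using S by blast
        qed
        ultimately obtain e where e: "e \<in> ?E1" "0 < F e" "?g1 e \<subseteq> ?V1 - {r}" "e \<in> cut ?E1 ?g1 S1"
          using rF(4) by blast
        have "e \<in> dl S" using e(4) unfolding cut_cends[OF U(2)] pre .
        moreover have "r \<notin> g e"
        proof
          assume "r \<in> g e"
          then have "contr U u r \<in> ?g1 e" by (auto simp: cends_def)
          then show False using e(3) r by (auto simp: contr_def)
        qed
        moreover have "\<not> g e \<subseteq> U" using e(1) by (auto simp: inner_def)
        ultimately show ?thesis using e(1,2) ends[of e] by (intro bexI[of _ e]) (auto simp: R_def)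
      qed
    qed
  qed
  have fpq: "finite (set_pmf pq)" using coupling_finite[OF fp fq pq(1,2)] .
  have mR: "mean (map_pmf R pq) (\<lambda>F. f (F e)) = (if g e \<subseteq> U then mean q (\<lambda>F. f (F e)) else mean p (\<lambda>F. f (F e)))"
    for f :: "nat \<Rightarrow> real" and e
  proof (cases "g e \<subseteq> U")
    case True
    have "mean (map_pmf R pq) (\<lambda>F. f (F e)) = mean pq (\<lambda>z. f (snd z e))"
      unfolding integral_map_pmf using True by (intro mean_cong) (simp add: R_def split_beta)
    also have "\<dots> = mean q (\<lambda>F. f (F e))" unfolding pq(2)[symmetric] by simp
    finally show ?thesis using True by simp
  next
    case False
    have "mean (map_pmf R pq) (\<lambda>F. f (F e)) = mean pq (\<lambda>z. f (fst z e))"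
      unfolding integral_map_pmf using False by (intro mean_cong) (simp add: R_def split_beta)
    also have "\<dots> = mean p (\<lambda>F. f (F e))" unfolding pq(1)[symmetric] by simp
    finally show ?thesis using False by simp
  qed
  have side: "(g e \<subseteq> U \<longrightarrow> e \<in> ?E2) \<and> (\<not> g e \<subseteq> U \<longrightarrow> e \<in> ?E1)" if "e \<in> E" for e
    using that ends[OF that] by (auto simp: inner_def)
  have "exact_marginals E x \<theta> (map_pmf R pq)"
    unfolding exact_marginals_def
  proof (intro conjI ballI)
    show "finite (set_pmf (map_pmf R pq))" using fpq by simp
    fix e assume e: "e \<in> E"
    show "mean (map_pmf R pq) (\<lambda>F. real (F e)) = target x \<theta> e"
      unfolding mR using side[OF e] p(1) q(1) unfolding exact_marginals_def by auto
    show "mean (map_pmf R pq) (\<lambda>F. of_bool (odd (F e))) = odd_target x \<theta> e"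
      unfolding mR[of "\<lambda>n. of_bool (odd n)"] using side[OF e] p(1) q(1) unfolding exact_marginals_def by auto
  qed
  then show ?thesis unfolding decomposes_def using tour by (intro exI[of _ "map_pmf R pq"]) auto
qed

end

lemma complementary_values:
  fixes \<theta> :: real
  assumes "a = \<theta> \<or> a = 1 - \<theta>" "b = \<theta> \<or> b = 1 - \<theta>" "a + b = 1"
  shows "a = \<theta> \<and> b = 1 - \<theta> \<or> a = 1 - \<theta> \<and> b = \<theta>"
  using assms by auto

section \<open>Removing vertices of degree two and small cuts\<close>

context theta_graph
begin

text \<open>Contracting an edge \<open>e\<close> at \<open>v\<close> leaves a cut of vertex type. No
  second decomposition is needed: inside the contracted pair, \<open>e\<close> copies the
  multiplicity of the other edge \<open>f\<close> at \<open>v\<close>, which makes \<open>v\<close>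
  even and meets the same targets, both being 1-edges.\<close>

lemma degree_two_step:
  assumes v: "v \<in> V" "\<not> cubic v" and r: "r \<in> V" "cubic r"
    and IH: "\<And>(V' :: 'v set) (E' :: 'e set) g'. card V' < card V \<Longrightarrow> theta_graph V' E' g' x \<theta> \<Longrightarrow> r \<in> V' \<Longrightarrow>
      card (cut E' g' {r}) = 3 \<Longrightarrow> decomposes V' E' g' x \<theta> r"
  shows "decomposes V E g x \<theta> r"
proof -
  obtain e0 f0 where ef0: "e0 \<noteq> f0" "dl {v} = {e0, f0}" "x e0 = 1" "x f0 = 1" by (rule not_cubicE[OF v])
  have vr: "v \<noteq> r" using v r by blast
  have other: "\<exists>a. g e = {v, a} \<and> a \<noteq> v \<and> a \<in> V" if "e \<in> dl {v}" for e
  proof -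
    have eE: "e \<in> E" using that cut_sub[of E g "{v}"] by blast
    obtain a b where ab: "g e = {a, b}" "a \<in> V" "b \<in> V" "a \<noteq> b" by (rule edge_ends[OF eE])
    have "v \<in> g e" using that mem_vertex_cut[OF eE] by blast
    then show ?thesis using ab by auto
  qed
  obtain a0 b0 where a0: "g e0 = {v, a0}" "a0 \<noteq> v" "a0 \<in> V" and b0: "g f0 = {v, b0}" "b0 \<noteq> v" "b0 \<in> V"
    using other[of e0] other[of f0] ef0(2) by auto
  have E0: "e0 \<in> E" "f0 \<in> E" using ef0(2) cut_sub[of E g "{v}"] by auto
  \<comment> \<open>With equal neighbours, that neighbour would have two 1-edges, hence degree two
    and the same cut as \<open>v\<close>; the pair would have an empty cut although it misses
    \<open>r\<close>.\<close>
  have ab0: "a0 \<noteq> b0"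
  proof
    assume eq: "a0 = b0"
    have in_a: "e0 \<in> dl {a0}" "f0 \<in> dl {a0}" using a0 b0 eq mem_vertex_cut E0 by auto
    have "\<not> cubic a0"
    proof
      assume c: "cubic a0"
      obtain e' where "dl {a0} \<inter> W = {e'}" by (rule cubicE[OF a0(3) c])
      moreover have "e0 \<in> dl {a0} \<inter> W" "f0 \<in> dl {a0} \<inter> W" using in_a E0 ef0 by (auto simp: W_def)
      ultimately show False using ef0(1) by auto
    qed
    then obtain e' f' where ef': "e' \<noteq> f'" "dl {a0} = {e', f'}" by (rule not_cubicE[OF a0(3)])
    then have same: "dl {a0} = dl {v}" using in_a ef0 by auto
    have "dl ({v} \<union> {a0}) = {}"
      using cut_disjoint_Un[of "{v}" "{a0}"] a0(2) same cut_sub[of E g "{v} \<union> {a0}"] by blast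
    moreover have "a0 \<noteq> r" using \<open>\<not> cubic a0\<close> r by blast
    then have "{v} \<union> {a0} \<noteq> V" using r vr by blast
    ultimately show False using cut_ge[of "{v} \<union> {a0}"] v a0 by simp
  qed
  \<comment> \<open>The edge to be contracted is the one that does not lead to the root.\<close>
  obtain e f a where ef: "e \<noteq> f" "dl {v} = {e, f}" "x e = 1" "x f = 1" and a: "g e = {v, a}" "a \<noteq> v" "a \<in> V" "a \<noteq> r"
    and fa: "a \<notin> g f"
  proof (cases "a0 = r")
    case True
    show ?thesis by (rule that[of f0 e0 b0]) (use ef0 a0 b0 ab0 True in auto)
  next
    case False
    show ?thesis by (rule that[of e0 f0 a0]) (use ef0 a0 b0 ab0 False in auto)
  qed
  have eE: "e \<in> E" and fE: "f \<in> E" using ef(2) cut_sub[of E g "{v}"] by auto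
  define A where "A = {v, a}"
  have A: "A \<subseteq> V" "A \<noteq> V" "a \<in> A" using v a r vr by (auto simp: A_def)
  have ea: "e \<in> dl {a}" and nfa: "f \<notin> dl {a}" using a fa mem_vertex_cut eE fE by auto
  have dA: "dl A = insert f (dl {a} - {e})"
  proof (intro set_eqI)
    fix e'
    have "e' \<in> dl A \<longleftrightarrow> e' \<in> E \<and> ((e' \<in> dl {v}) \<noteq> (e' \<in> dl {a}))"
    proof -
      have AA: "A = {v} \<union> {a}" and disj: "{v} \<inter> {a} = {}" using a(2) by (auto simp: A_def)
      show ?thesis using cut_disjoint_Un[OF disj, of e'] cut_sub[of E g A] unfolding AA by blast
    qed
    then show "e' \<in> dl A \<longleftrightarrow> e' \<in> insert f (dl {a} - {e})"
      using ef(1,2) ea nfa fE cut_sub[of E g "{a}"] by auto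
  qed
  have t: "vertex_type x \<theta> (dl A)"
  proof (cases "cubic a")
    case True
    obtain e' h k where hk: "e' \<noteq> h" "e' \<noteq> k" "h \<noteq> k" "dl {a} = {e', h, k}" "x e' = 1" "x h = \<theta>" "x k = 1 - \<theta>"
      by (rule cubicE[OF a(3) True])
    have "e = e'" using ea ef(3) hk theta by auto
    then have "dl A = {f, h, k}" "f \<noteq> h" "f \<noteq> k" using dA hk nfa by auto
    then show ?thesis using hk ef unfolding vertex_type_def by blast
  next
    case False
    obtain e' f' where hk: "e' \<noteq> f'" "dl {a} = {e', f'}" "x e' = 1" "x f' = 1"
      by (rule not_cubicE[OF a(3) False])
    then obtain g' where "dl {a} - {e} = {g'}" "x g' = 1" "g' \<noteq> f" using ea nfa by auto
    then show ?thesis using dA ef(4) unfolding vertex_type_def by blast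
  qed
  have inA: "inner E g A = {e}"
  proof (intro set_eqI iffI)
    fix e' assume e': "e' \<in> inner E g A"
    then have e'E: "e' \<in> E" "g e' \<subseteq> A" by (auto simp: inner_def)
    obtain c d where "g e' = {c, d}" "c \<noteq> d" by (rule edge_ends[OF e'E(1)])
    then have "v \<in> g e'" "a \<in> g e'" using e'E(2) by (auto simp: A_def)
    then have "e' \<in> dl {v}" "e' \<noteq> f" using mem_vertex_cut[OF e'E(1)] fa by auto
    then show "e' \<in> {e}" using ef(2) by simp
  qed (use a eE in \<open>auto simp: inner_def A_def\<close>)
  let ?V1 = "insert a (V - A)" and ?E1 = "E - inner E g A" and ?g1 = "cends g A a"
  have "?V1 = V - {v}" using v a by (auto simp: A_def)
  then have "card ?V1 < card V" using card_Diff1_less[OF finV v(1)] by simp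
  moreover have "theta_graph ?V1 ?E1 ?g1 x \<theta>" by (rule theta_graph_contract[OF A t])
  moreover have rA: "r \<in> V - A" using r vr a by (auto simp: A_def)
  moreover have "card (cut ?E1 ?g1 {r}) = 3" using r(2) cut_cends_out[OF A(3) rA] by (simp add: cubic_def)
  ultimately have "decomposes ?V1 ?E1 ?g1 x \<theta> r" by (intro IH) auto
  then obtain p where p: "exact_marginals ?E1 x \<theta> p" "\<forall>F\<in>set_pmf p. rooted_tour ?V1 ?E1 ?g1 x r F"
    unfolding decomposes_def by blast
  define up :: "('e \<Rightarrow> nat) \<Rightarrow> 'e \<Rightarrow> nat" where "up F = F(e := F f)" for F
  have tour: "even (sum F (dl A))" "\<And>e'. e' \<in> ?E1 \<Longrightarrow> x e' = 1 \<Longrightarrow> 1 \<le> F e'" if "F \<in> set_pmf p" for F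
  proof -
    have rt: "rooted_tour ?V1 ?E1 ?g1 x r F" using p(2) that by blast
    then have "even (sum F (cut ?E1 ?g1 {a}))" unfolding rooted_tour_def by blast
    then show "even (sum F (dl A))" unfolding cut_cends_in[OF A(3,1)] .
    show "\<And>e'. e' \<in> ?E1 \<Longrightarrow> x e' = 1 \<Longrightarrow> 1 \<le> F e'" using rt unfolding rooted_tour_def by blast
  qed
  have f1: "f \<in> ?E1" using fE ef(1) inA by simp
  have enA: "e \<notin> dl A" using dA ef(1) by simp
  show ?thesis
  proof (rule glue[OF A(1,3) rA t p, of "map_pmf up p"])
    show "exact_marginals (E - inner E g (V - A)) x \<theta> (map_pmf up p)"
      unfolding exact_marginals_def
    proof (intro conjI ballI)
      show "finite (set_pmf (map_pmf up p))" using p(1) by (simp add: exact_marginals_def)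
      fix e' assume e': "e' \<in> E - inner E g (V - A)"
      define e'' where "e'' = (if e' = e then f else e')"
      have "e'' \<in> ?E1" "x e'' = x e'" using e' f1 ef inA by (auto simp: e''_def)
      moreover have "up F e' = F e''" for F by (simp add: up_def e''_def)
      ultimately show "mean (map_pmf up p) (\<lambda>F. real (F e')) = target x \<theta> e'"
        "mean (map_pmf up p) (\<lambda>F. of_bool (odd (F e'))) = odd_target x \<theta> e'"
        using p(1) by (simp_all add: exact_marginals_def target_def odd_target_def)
    qed
    fix F assume "F \<in> set_pmf (map_pmf up p)"
    then obtain F0 where F0: "F0 \<in> set_pmf p" "F = up F0" by auto
    have sA: "sum F (dl A) = sum F0 (dl A)" using enA by (intro sum.cong) (auto simp: F0 up_def)
    then show "even (sum F (dl A))" using tour(1)[OF F0(1)] by simp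
    show "even (sum F (dl {w}))" if "w \<in> A" for w
    proof (cases "w = v")
      case True
      then show ?thesis using ef(1,2) by (simp add: F0 up_def)
    next
      case False
      then have "w = a" using that by (simp add: A_def)
      have "sum F (dl {a}) = F e + sum F (dl {a} - {e})" using ea by (intro sum.remove) auto
      also have "\<dots> = F f + sum F (dl {a} - {e})" using ef(1) by (simp add: F0 up_def)
      also have "\<dots> = sum F (dl A)" unfolding dA using nfa by (subst sum.insert) auto
      finally show ?thesis using \<open>w = a\<close> sA tour(1)[OF F0(1)] by simp
    qed
    show "1 \<le> F e'" if "e' \<in> E - inner E g (V - A)" "x e' = 1" for e'
      using tour(2)[OF F0(1), of "if e' = e then f else e'"] that f1 ef inA by (auto simp: F0 up_def split: if_splits)
    show "\<exists>e\<in>inner E g A. 0 < F e \<and> e \<in> dl S" if S: "S \<subseteq> A" "S \<noteq> {}" "S \<noteq> A" for S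
    proof (rule bexI[of _ e])
      have "1 \<le> F0 f" by (rule tour(2)[OF F0(1) f1 ef(4)])
      then have "0 < F e" by (simp add: F0 up_def)
      moreover have "e \<in> dl S" unfolding mem_cut[OF eE a(1)] using S by (auto simp: A_def)
      ultimately show "0 < F e \<and> e \<in> dl S" by blast
    qed (simp add: inA)
  qed
qed

text \<open>In a 2-cut the subtour bound forces both values to be 1. In a 3-cut of value 2 the
  number of H-edges is even and not zero, so there are two, and their values sum to 1.\<close>

lemma small_cut_type:
  assumes U: "U \<subseteq> V" "U \<noteq> {}" "U \<noteq> V" and c: "card (dl U) = 2 \<or> card (dl U) = 3 \<and> sum x (dl U) = 2"
  shows "vertex_type x \<theta> (dl U)"
  using c
proof
  assume "card (dl U) = 2"
  then obtain e f where ef: "dl U = {e, f}" "e \<noteq> f" by (auto simp: card_2_iff)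
  then have "e \<in> E" "f \<in> E" using cut_sub[of E g U] by auto
  then have "x e = 1" "x f = 1" using cut_ge[OF U] x_le1[of e] x_le1[of f] ef by auto
  then show ?thesis using ef unfolding vertex_type_def by blast
next
  assume c: "card (dl U) = 3 \<and> sum x (dl U) = 2"
  have split: "dl U = (W \<inter> dl U) \<union> (H \<inter> dl U)" using WH(1) cut_sub[of E g U] by blast
  have j: "even (card (H \<inter> dl U))" using even_H_cut[OF U(1)] .
  have s: "card (W \<inter> dl U) + card (H \<inter> dl U) = 3" using c card_cut_split[of U] by simp
  have "card (H \<inter> dl U) \<noteq> 0"
  proof
    assume "card (H \<inter> dl U) = 0"
    then have "H \<inter> dl U = {}" using finH by simp
    then have "sum x (dl U) = (\<Sum>e\<in>dl U. 1)" using split by (intro sum.cong) (auto simp: W_def)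
    then show False using c by simp
  qed
  moreover have "card (H \<inter> dl U) \<noteq> 1" "card (H \<inter> dl U) \<noteq> 3" using j by auto
  ultimately have "card (H \<inter> dl U) = 2" "card (W \<inter> dl U) = 1" using s by linarith+
  then obtain e h k where hk: "W \<inter> dl U = {e}" "H \<inter> dl U = {h, k}" "h \<noteq> k"
    by (auto simp: card_2_iff card_1_singleton_iff)
  have xe: "x e = 1" "x h < 1" "x k < 1" using hk by (auto simp: W_def H_def)
  have dU: "dl U = {e, h, k}" using split hk by auto
  moreover have ne: "e \<noteq> h" "e \<noteq> k" using xe by auto
  ultimately have "x h + x k = 1" using c xe hk(3) by simp
  moreover have "h \<in> H" "k \<in> H" using hk by auto
  ultimately have "x h = \<theta> \<and> x k = 1 - \<theta> \<or> x h = 1 - \<theta> \<and> x k = \<theta>"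
    using H_values by (intro complementary_values) auto
  moreover have "dl U = {e, k, h}" using dU by auto
  ultimately show ?thesis using dU ne hk(3) xe(1) unfolding vertex_type_def by metis
qed

text \<open>The contraction of \<open>V - U\<close> has to be connected inside \<open>U\<close>. For
  a 3-cut this is rootedness at the contracted vertex. For a 2-cut that vertex has degree two and
  cannot be a root; the root is then an end \<open>s\<close> in \<open>U\<close> of one of the cut
  edges.\<close>

lemma small_cut_step:
  assumes all_cubic: "\<And>v. v \<in> V \<Longrightarrow> cubic v" and U: "U \<subseteq> V" "2 \<le> card U" "2 \<le> card (V - U)" and r: "r \<in> V - U"
    and c: "card (dl U) = 2 \<or> card (dl U) = 3 \<and> sum x (dl U) = 2"
    and IH: "\<And>(V' :: 'v set) (E' :: 'e set) g' r'. card V' < card V \<Longrightarrow> theta_graph V' E' g' x \<theta> \<Longrightarrow> r' \<in> V' \<Longrightarrow>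
      card (cut E' g' {r'}) = 3 \<Longrightarrow> decomposes V' E' g' x \<theta> r'"
  shows "decomposes V E g x \<theta> r"
proof -
  have ne: "U \<noteq> {}" "U \<noteq> V" using U by auto
  note t = small_cut_type[OF U(1) ne c]
  obtain u where u: "u \<in> U" using ne by blast
  have fU: "finite U" using U finV finite_subset by blast
  have cV: "card V = card U + card (V - U)"
    using card_Diff_subset[OF fU U(1)] card_mono[OF finV U(1)] by simp
  let ?V1 = "insert u (V - U)" and ?E1 = "E - inner E g U" and ?g1 = "cends g U u"
  let ?w = r
  let ?V2 = "insert ?w U" and ?E2 = "E - inner E g (V - U)" and ?g2 = "cends g (V - U) ?w"
  have "card ?V1 < card V" using u finV cV U by simp
  moreover have "theta_graph ?V1 ?E1 ?g1 x \<theta>" by (rule theta_graph_contract[OF U(1) ne(2) u t])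
  moreover have "card (cut ?E1 ?g1 {r}) = 3" using all_cubic[of r] r cut_cends_out[OF u r] by (simp add: cubic_def)
  ultimately have "decomposes ?V1 ?E1 ?g1 x \<theta> r" using r by (intro IH) auto
  then obtain p where p: "exact_marginals ?E1 x \<theta> p" "\<forall>F\<in>set_pmf p. rooted_tour ?V1 ?E1 ?g1 x r F"
    unfolding decomposes_def by blast
  have VU: "V - (V - U) = U" using U(1) by blast
  have dc: "dl (V - U) = dl U" by (rule cut_compl)
  have c2: "card ?V2 < card V" using r fU cV U by simp
  have VUne: "V - U \<noteq> V" using ne U by blast
  have tg2: "theta_graph ?V2 ?E2 ?g2 x \<theta>"
    using theta_graph_contract[OF Diff_subset VUne r t[folded dc]] unfolding VU .
  have cut2: "cut ?E2 ?g2 {v} = dl {v}" if "v \<in> U" for v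
    using cut_cends_out[OF r, of v] that U(1) by blast
  have cut2w: "cut ?E2 ?g2 {?w} = dl U"
    using cut_cends_in[OF r Diff_subset] unfolding dc .
  have inU: "g e \<subseteq> U" if "e \<in> E" "?g2 e \<subseteq> insert ?w U" "?w \<notin> ?g2 e" for e
  proof
    fix y assume y: "y \<in> g e"
    have "contr (V - U) ?w y \<in> ?g2 e" using y by (auto simp: cends_def)
    then have "y \<notin> V - U" using that(3) by (auto simp: contr_def split: if_splits)
    then show "y \<in> U" using y ends[OF that(1)] by blast
  qed
  have pre: "V \<inter> contr (V - U) ?w -` S = S" if "S \<subseteq> U" for S
    using that U(1) r by (auto simp: contr_def split: if_splits)
  have "\<exists>q. exact_marginals ?E2 x \<theta> q \<and> (\<forall>F\<in>set_pmf q. (\<exists>r2\<in>?V2. rooted_tour ?V2 ?E2 ?g2 x r2 F) \<and>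
     (\<forall>S\<subseteq>U. S \<noteq> {} \<longrightarrow> S \<noteq> U \<longrightarrow> (\<exists>e\<in>inner E g U. 0 < F e \<and> e \<in> dl S)))"
  proof (cases "card (dl U) = 3")
    case True
    then have "decomposes ?V2 ?E2 ?g2 x \<theta> ?w" using cut2w by (intro IH c2 tg2) auto
    then obtain q where q: "exact_marginals ?E2 x \<theta> q" "\<forall>F\<in>set_pmf q. rooted_tour ?V2 ?E2 ?g2 x ?w F"
      unfolding decomposes_def by blast
    have "\<exists>e\<in>inner E g U. 0 < F e \<and> e \<in> dl S" if F: "F \<in> set_pmf q" and S: "S \<subseteq> U" "S \<noteq> {}" "S \<noteq> U" for F S
    proof -
      have V2w: "?V2 - {?w} = U" using r by blast
      have "\<forall>S\<subseteq>U. S \<noteq> {} \<longrightarrow> S \<noteq> U \<longrightarrow> (\<exists>e\<in>?E2. 0 < F e \<and> ?g2 e \<subseteq> U \<and> e \<in> cut ?E2 ?g2 S)"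
        using q(2) F unfolding rooted_tour_def V2w by blast
      then obtain e where e: "e \<in> ?E2" "0 < F e" "?g2 e \<subseteq> U" "e \<in> cut ?E2 ?g2 S" using S by blast
      have "g e \<subseteq> U" by (rule inU) (use e r in auto)
      moreover have "e \<in> dl S" using e(4) unfolding cut_cends[OF r] pre[OF S(1)] .
      ultimately show ?thesis using e by (intro bexI[of _ e]) (auto simp: inner_def)
    qed
    then show ?thesis using q by (intro exI[of _ q]) blast
  next
    case False
    then have "card (dl U) = 2" using c by blast
    then obtain e f where ef: "dl U = {e, f}" "e \<noteq> f" by (auto simp: card_2_iff)
    have eE: "e \<in> E" and fE: "f \<in> E" using ef cut_sub[of E g U] by auto
    have x1: "x e = 1" "x f = 1" using cut_ge[OF U(1) ne] x_le1[OF eE] x_le1[OF fE] ef by auto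
    obtain s where s: "s \<in> g e" "s \<in> U" using ef(1) by (auto simp: cut_def)
    have sV: "s \<in> V" using s U by blast
    have "decomposes ?V2 ?E2 ?g2 x \<theta> s"
      using cut2[OF s(2)] s(2) all_cubic[OF sV] by (intro IH c2 tg2) (auto simp: cubic_def)
    then obtain q where q: "exact_marginals ?E2 x \<theta> q" "\<forall>F\<in>set_pmf q. rooted_tour ?V2 ?E2 ?g2 x s F"
      unfolding decomposes_def by blast
    have "\<exists>e\<in>inner E g U. 0 < F e \<and> e \<in> dl S" if F: "F \<in> set_pmf q" and S: "S \<subseteq> U" "S \<noteq> {}" "S \<noteq> U" for F S
    proof -
      have rt: "rooted_tour ?V2 ?E2 ?g2 x s F" using q(2) F by blast
      define S0 where "S0 = S - {s}"
      show ?thesis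
      proof (cases "S0 = {} \<or> S0 = U - {s}")
        case True
        \<comment> \<open>Here \<open>S\<close> separates \<open>s\<close> from the rest of
          \<open>U\<close>. The H-edge that the root provides is not a cut edge, both of those being
          1-edges, so it runs inside \<open>U\<close>.\<close>
        obtain h where h: "h \<in> dl {s}" "x h < 1" "0 < F h"
          using rt cut2[OF s(2)] unfolding rooted_tour_def by auto
        have hE: "h \<in> E" using h cut_sub[of E g "{s}"] by blast
        have sh: "s \<in> g h" using h mem_vertex_cut[OF hE] by blast
        have "h \<notin> dl U" using h x1 ef by auto
        then have hU: "g h \<subseteq> U" using sh s hE by (auto simp: cut_def)
        obtain a b where ab: "g h = {a, b}" "a \<noteq> b" by (rule edge_ends[OF hE])
        then obtain b' where b': "g h = {s, b'}" "b' \<noteq> s" using sh by auto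
        have "S = {s} \<or> S = U - {s}" using True S s by (auto simp: S0_def)
        then have "h \<in> dl S" unfolding mem_cut[OF hE b'(1)] using b' hU by auto
        then show ?thesis using h hU hE by (intro bexI[of _ h]) (auto simp: inner_def)
      next
        case False
        obtain s' where s': "s' \<in> g f" "s' \<in> U" using ef(1) by (auto simp: cut_def)
        \<comment> \<open>The contracted vertex goes to the side of \<open>s'\<close>, the end of
          \<open>f\<close> in \<open>U\<close>. Then \<open>f\<close> does not cross
          \<open>S'\<close>, the other cut edge contains \<open>s\<close>, and so the crossing edge
          lies inside \<open>U\<close>.\<close>
        define S' where "S' = S0 \<union> (if s' \<in> S0 then {?w} else {})"
        have wU: "?w \<notin> U" using r by blast
        have "S' \<subseteq> ?V2 - {s}" using S s wU by (auto simp: S'_def S0_def)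
        moreover have "S' \<noteq> {}" using False by (auto simp: S'_def)
        moreover have "S' \<noteq> ?V2 - {s}"
        proof
          assume eq: "S' = ?V2 - {s}"
          have "U - {s} \<subseteq> S0"
          proof
            fix y assume y: "y \<in> U - {s}"
            then have "y \<in> S'" unfolding eq by blast
            moreover have "y \<noteq> r" using y wU by blast
            ultimately show "y \<in> S0" unfolding S'_def by (cases "s' \<in> S0") simp_all
          qed
          then show False using False S by (auto simp: S0_def)
        qed
        ultimately obtain e' where e': "e' \<in> ?E2" "0 < F e'" "?g2 e' \<subseteq> ?V2 - {s}" "e' \<in> cut ?E2 ?g2 S'"
          using rt unfolding rooted_tour_def by blast
        have sne: "s \<notin> g e'"
        proof
          assume "s \<in> g e'"
          then have "contr (V - U) ?w s \<in> ?g2 e'" by (auto simp: cends_def)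
          then show False using e'(3) s by (auto simp: contr_def)
        qed
        have "?w \<notin> ?g2 e'"
        proof
          assume w: "?w \<in> ?g2 e'"
          have e'E: "e' \<in> E" "\<not> g e' \<subseteq> V - U" using e'(1) by (auto simp: inner_def)
          have "\<not> g e' \<subseteq> U" using w wU by (auto simp: cends_def contr_def split: if_splits)
          then have "e' \<in> dl U" using e'E ends[OF e'E(1)] by (auto simp: cut_def)
          then have "e' = f" using ef sne s by auto
          obtain a b where ab: "g f = {a, b}" "a \<noteq> b" by (rule edge_ends[OF fE])
          have fU: "f \<in> dl U" using ef by simp
          obtain b' where b': "g f = {s', b'}" "b' \<in> V - U"
            using ab s' fU mem_cut[OF fE ab(1), of U] ends[OF fE] by auto
          have "?g2 f = {s', ?w}" using b' s' by (auto simp: cends_def contr_def)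
          moreover have "s' \<in> S' \<longleftrightarrow> ?w \<in> S'" using wU s' S by (auto simp: S'_def S0_def)
          ultimately show False using e'(4) \<open>e' = f\<close> by (auto simp: cut_def)
        qed
        then have gU: "g e' \<subseteq> U" using e' by (intro inU) auto
        have "V \<inter> contr (V - U) ?w -` S' \<inter> U = S0"
          using S U wU by (auto simp: S'_def S0_def contr_def split: if_splits)
        moreover have "e' \<in> dl (V \<inter> contr (V - U) ?w -` S')" using e'(4) unfolding cut_cends[OF r] .
        ultimately have "e' \<in> dl S0" using gU unfolding cut_def by blast
        then have "e' \<in> dl S" using sne by (auto simp: cut_def S0_def)
        then show ?thesis using e' gU by (intro bexI[of _ e']) (auto simp: inner_def)
      qed
    qed
    then show ?thesis using q s by (intro exI[of _ q]) blast
  qed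
  then obtain q where q: "exact_marginals ?E2 x \<theta> q"
    "\<And>F. F \<in> set_pmf q \<Longrightarrow> \<exists>r2\<in>?V2. rooted_tour ?V2 ?E2 ?g2 x r2 F"
    "\<And>F S. F \<in> set_pmf q \<Longrightarrow> S \<subseteq> U \<Longrightarrow> S \<noteq> {} \<Longrightarrow> S \<noteq> U \<Longrightarrow> \<exists>e\<in>inner E g U. 0 < F e \<and> e \<in> dl S"
    by (elim exE conjE) metis
  have q2: "\<And>v. v \<in> ?V2 \<Longrightarrow> even (sum F (cut ?E2 ?g2 {v}))" "\<And>e. e \<in> ?E2 \<Longrightarrow> x e = 1 \<Longrightarrow> 1 \<le> F e"
    if "F \<in> set_pmf q" for F
    using q(2)[OF that] unfolding rooted_tour_def by blast+
  show ?thesis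
  proof (rule glue[OF U(1) u r t p q(1)])
    fix F assume F: "F \<in> set_pmf q"
    show "even (sum F (dl {v}))" if "v \<in> U" for v using q2(1)[OF F, of v] that cut2[OF that] by simp
    show "even (sum F (dl U))" using q2(1)[OF F, of ?w] cut2w by simp
    show "1 \<le> F e" if "e \<in> ?E2" "x e = 1" for e using q2(2)[OF F that] .
    show "\<exists>e\<in>inner E g U. 0 < F e \<and> e \<in> dl S" if "S \<subseteq> U" "S \<noteq> {}" "S \<noteq> U" for S using q(3)[OF F that] .
  qed
qed

end

text \<open>The root is generalised in the induction, because the second side of a small cut needs a
  root of its own.\<close>

theorem theta_graph_decomposes:
  fixes V :: "'v set" and E :: "'e set"
  assumes "theta_graph V E g x \<theta>" "r \<in> V" "card (cut E g {r}) = 3"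
  shows "decomposes V E g x \<theta> r"
  using assms
proof (induction "card V" arbitrary: V E g r rule: less_induct)
  case less
  interpret theta_graph V E g x \<theta> by fact
  have IH: "decomposes V' E' g' x \<theta> r'"
    if "card V' < card V" "theta_graph V' E' g' x \<theta>" "r' \<in> V'" "card (cut E' g' {r'}) = 3"
    for V' :: "'v set" and E' :: "'e set" and g' r'
    using less.hyps that by blast
  show ?case
  proof (cases "\<exists>v\<in>V. \<not> cubic v")
    case True
    then obtain v where v: "v \<in> V" "\<not> cubic v" by blast
    show ?thesis
      by (rule degree_two_step[OF v less.prems(2)]) (use less.prems(3) IH in \<open>auto simp: cubic_def\<close>)
  next
    case False
    then have cub: "\<And>v. v \<in> V \<Longrightarrow> cubic v" by blast
    show ?thesis
    proof (cases "\<exists>U\<subseteq>V. 2 \<le> card U \<and> 2 \<le> card (V - U) \<and> (card (dl U) = 2 \<or> card (dl U) = 3 \<and> sum x (dl U) = 2)")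
      case True
      then obtain U where U: "U \<subseteq> V" "2 \<le> card U" "2 \<le> card (V - U)"
        "card (dl U) = 2 \<or> card (dl U) = 3 \<and> sum x (dl U) = 2" by blast
      define U' where "U' = (if r \<in> U then V - U else U)"
      have VV: "V - (V - U) = U" using U(1) by blast
      have "U' \<subseteq> V" "2 \<le> card U'" "2 \<le> card (V - U')" "r \<in> V - U'"
        "card (dl U') = 2 \<or> card (dl U') = 3 \<and> sum x (dl U') = 2"
        using U less.prems(2) VV cut_compl[of U] by (auto simp: U'_def)
      then show ?thesis using small_cut_step[OF cub] IH by blast
    next
      case no: False
      interpret base_graph V E g x \<theta>
      proof (unfold_locales, rule cub)
        fix U assume U: "U \<subseteq> V" "U \<noteq> {}" "U \<noteq> V"
        have fU: "finite U" using U finV finite_subset by blast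
        show "3 \<le> card (dl U)"
        proof (cases "2 \<le> card U \<and> 2 \<le> card (V - U)")
          case True
          then have "card (dl U) \<noteq> 2" using no U by blast
          moreover have "sum x (dl U) \<le> (\<Sum>e\<in>dl U. 1)"
            using x_le1 cut_sub[of E g U] by (intro sum_mono) auto
          then have "2 \<le> real (card (dl U))" using cut_ge[OF U] by simp
          ultimately show ?thesis by linarith
        next
          case False
          have "card U \<noteq> 0" "card (V - U) \<noteq> 0" using U fU finV by auto
          then consider "card U = 1" | "card (V - U) = 1" using False by linarith
          then show ?thesis
          proof cases
            case 1
            then obtain v where "U = {v}" by (auto simp: card_1_singleton_iff)
            then show ?thesis using cub[of v] U(1) by (simp add: cubic_def)
          next
            case 2
            then obtain v where v: "V - U = {v}" by (auto simp: card_1_singleton_iff)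
            then have "dl U = dl {v}" "v \<in> V" using cut_compl[of U] by auto
            then show ?thesis using cub[of v] by (simp add: cubic_def)
          qed
        qed
      next
        fix U assume "U \<subseteq> V" "2 \<le> card U" "2 \<le> card (V - U)" "card (dl U) = 3"
        then show "sum x (dl U) \<noteq> 2" using no by blast
      qed
      show ?thesis by (rule base_decomposes[OF less.prems(2)])
    qed
  qed
qed

section \<open>The main theorem\<close>

lemma TSP_if_pmf:
  assumes fin: "finite (set_pmf p)" and tour: "\<And>F. F \<in> set_pmf p \<Longrightarrow> is_tour n F"
    and y: "\<And>e. e \<in> En n \<Longrightarrow> y e = mean p (\<lambda>F. real (F e))"
  shows "TSP n y"
proof -
  obtain h where h: "bij_betw h {0..<card (set_pmf p)} (set_pmf p)"
    using ex_bij_betw_nat_finite[OF fin] by blast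
  have s: "(\<Sum>i<card (set_pmf p). f (h i)) = (\<Sum>F\<in>set_pmf p. f F)" for f :: "_ \<Rightarrow> real"
    using sum.reindex_bij_betw[OF h, of f] by (simp add: atLeast0LessThan)
  have hin: "h i \<in> set_pmf p" if "i < card (set_pmf p)" for i
    using bij_betwE[OF h] that by simp
  show ?thesis
    unfolding TSP_def
  proof (intro exI[of _ "card (set_pmf p)"] exI[of _ h] exI[of _ "\<lambda>i. pmf p (h i)"] conjI allI impI ballI)
    show "is_tour n (h i)" if "i < card (set_pmf p)" for i using tour hin[OF that] by blast
    show "0 \<le> pmf p (h i)" for i by simp
    show "(\<Sum>i<card (set_pmf p). pmf p (h i)) = 1"
      unfolding s[of "pmf p"] by (rule sum_pmf_eq_1[OF fin]) simp
    fix e assume "e \<in> En n"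
    then show "y e = (\<Sum>i<card (set_pmf p). pmf p (h i) * real (h i e))"
      unfolding s[of "\<lambda>F. pmf p F * real (F e)"] using y mean_finite[OF fin] by simp
  qed
qed

lemma finite_En: "finite (En n)"
  by (rule finite_subset[of _ "Pow (Vn n)"]) (auto simp: En_def Vn_def)

lemma En_ends: assumes "e \<in> En n" obtains a b where "e = {a, b}" "a \<in> Vn n" "b \<in> Vn n" "a \<noteq> b"
  using assms by (auto simp: En_def)

lemma mem_delta: "e \<in> En n \<Longrightarrow> e \<in> delta n U \<longleftrightarrow> e \<inter> U \<noteq> {} \<and> \<not> e \<subseteq> U"
  by (erule En_ends) (auto simp: delta_def En_def Int_insert_left)

lemma cut_Esupp: "cut (Esupp n x) (\<lambda>e. e) U = {e \<in> delta n U. e \<in> Esupp n x}"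
  using mem_delta[of _ n U] by (auto simp: cut_def Esupp_def)

text \<open>Besides an edge of value 1, the degree equation leaves weight 1 for at most two more
  edges: one of value 1, or two whose values are \<theta> and 1 - \<theta>.\<close>

lemma theta_cyclic_graph:
  assumes n: "n \<ge> 3" and theta: "0 < \<theta>" "\<theta> \<le> 1/2" and x: "theta_cyclic n \<theta> x"
  shows "theta_graph (Vn n) (Esupp n x) (\<lambda>e. e) x \<theta>"
proof -
  have S: "SUBT n x" and vals: "\<And>e. e \<in> En n \<Longrightarrow> x e \<in> {0, \<theta>, 1 - \<theta>, 1}"
    and deg: "\<And>v. v \<in> Vn n \<Longrightarrow> card {e \<in> delta n {v}. e \<in> Esupp n x} \<le> 3"
    and one: "\<And>v. v \<in> Vn n \<Longrightarrow> \<exists>e\<in>delta n {v}. x e = 1"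
    using x by (auto simp: theta_cyclic_def)
  have cutsum: "sum x (cut (Esupp n x) (\<lambda>e. e) U) = xsum x (delta n U)" for U
    unfolding xsum_def cut_Esupp
  proof (rule sum.mono_neutral_left)
    show "finite (delta n U)" using finite_En by (simp add: delta_def)
    show "\<forall>e\<in>delta n U - {e \<in> delta n U. e \<in> Esupp n x}. x e = 0"
    proof
      fix e assume e: "e \<in> delta n U - {e \<in> delta n U. e \<in> Esupp n x}"
      then have "e \<in> En n" "\<not> 0 < x e" by (auto simp: delta_def Esupp_def)
      then show "x e = 0" using S by (force simp: SUBT_def)
    qed
  qed auto
  have mg: "mgraph (Vn n) (Esupp n x) (\<lambda>e. e)"
  proof
    show "finite (Vn n)" by (simp add: Vn_def)
    show "finite (Esupp n x)" using finite_En by (simp add: Esupp_def)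
    fix e assume "e \<in> Esupp n x"
    then have "e \<in> En n" by (simp add: Esupp_def)
    then show "e \<subseteq> Vn n \<and> e \<noteq> {} \<and> card e \<le> 2" by (elim En_ends) auto
  qed
  show ?thesis
  proof (rule theta_graph.intro[OF mg], unfold_locales)
    show "0 < \<theta>" "\<theta> \<le> 1/2" by (rule theta)+
    show "card e = 2" if "e \<in> Esupp n x" for e
    proof -
      have "e \<in> En n" using that by (simp add: Esupp_def)
      then show ?thesis by (elim En_ends) auto
    qed
    show "2 \<le> card (Vn n)" using n by (simp add: Vn_def)
    show "2 \<le> sum x (cut (Esupp n x) (\<lambda>e. e) U)" if "U \<subseteq> Vn n" "U \<noteq> {}" "U \<noteq> Vn n" for U
      using S that unfolding cutsum SUBT_def by blast
    fix v assume v: "v \<in> Vn n"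
    define D where "D = cut (Esupp n x) (\<lambda>e. e) {v}"
    have fD: "finite D" unfolding D_def cut_Esupp using finite_En by (simp add: delta_def)
    have sD: "sum x D = 2" unfolding D_def cutsum using S v by (simp add: SUBT_def)
    have cD: "card D \<le> 3" unfolding D_def cut_Esupp by (rule deg[OF v])
    have xD: "x e = 1 \<or> x e = \<theta> \<or> x e = 1 - \<theta>" "0 < x e" if "e \<in> D" for e
      using that vals[of e] by (auto simp: D_def cut_def Esupp_def)
    obtain e where e: "e \<in> D" "x e = 1" using one[OF v] unfolding D_def cut_Esupp by (auto simp: delta_def Esupp_def)
    have rest: "sum x (D - {e}) = 1" using sD sum.remove[OF fD e(1), of x] e(2) by simp
    have "card (D - {e}) \<le> 2" using cD e(1) fD by simp
    moreover have "card (D - {e}) \<noteq> 0"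
    proof
      assume "card (D - {e}) = 0"
      then have "D - {e} = {}" using fD by (meson card_0_eq finite_Diff)
      then show False using rest by (metis sum.empty zero_neq_one)
    qed
    ultimately consider "card (D - {e}) = 1" | "card (D - {e}) = 2" by linarith
    then have "vertex_type x \<theta> D"
    proof cases
      case 1
      then obtain f where f: "D - {e} = {f}" by (auto simp: card_1_singleton_iff)
      then have "e \<noteq> f" "D = {e, f}" "x f = 1" using e rest by auto
      then show ?thesis using e(2) unfolding vertex_type_def by blast
    next
      case 2
      then obtain h k where hk: "D - {e} = {h, k}" "h \<noteq> k" by (auto simp: card_2_iff)
      then have D: "D = {e, h, k}" "e \<noteq> h" "e \<noteq> k" using e by auto
      have sum1: "x h + x k = 1" using rest hk by simp
      have "x h = \<theta> \<and> x k = 1 - \<theta> \<or> x h = 1 - \<theta> \<and> x k = \<theta>"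
        using xD[of h] xD[of k] D(1) sum1 by (intro complementary_values) auto
      moreover have "D = {e, k, h}" using D by auto
      ultimately show ?thesis using D hk(2) e(2) unfolding vertex_type_def by metis
    qed
    then show "(\<exists>e f. e \<noteq> f \<and> cut (Esupp n x) (\<lambda>e. e) {v} = {e, f} \<and> x e = 1 \<and> x f = 1) \<or>
      (\<exists>e h k. e \<noteq> h \<and> e \<noteq> k \<and> h \<noteq> k \<and> cut (Esupp n x) (\<lambda>e. e) {v} = {e, h, k} \<and> x e = 1 \<and> x h = \<theta> \<and> x k = 1 - \<theta>)"
      unfolding vertex_type_def D_def .
  qed
qed

lemma is_tour_if_cuts:
  assumes zero: "\<And>e. e \<notin> Esupp n x \<Longrightarrow> F e = 0"
    and even: "\<And>v. v \<in> Vn n \<Longrightarrow> even (sum F (cut (Esupp n x) (\<lambda>e. e) {v}))"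
    and conn: "\<And>S. S \<subseteq> Vn n \<Longrightarrow> S \<noteq> {} \<Longrightarrow> S \<noteq> Vn n \<Longrightarrow> \<exists>e\<in>cut (Esupp n x) (\<lambda>e. e) S. 0 < F e"
  shows "is_tour n F"
  unfolding is_tour_def
proof (intro conjI allI impI ballI)
  show "F e = 0" if "e \<notin> En n" for e using that zero[of e] by (auto simp: Esupp_def)
next
  fix v assume v: "v \<in> Vn n"
  have "sum F (cut (Esupp n x) (\<lambda>e. e) {v}) = sum F (delta n {v})"
    unfolding cut_Esupp
  proof (rule sum.mono_neutral_left)
    show "finite (delta n {v})" using finite_En by (simp add: delta_def)
  qed (use zero in auto)
  then show "even (\<Sum>e\<in>delta n {v}. F e)" using even[OF v] by simp
next
  fix u v assume uv: "u \<in> Vn n" "v \<in> Vn n"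
  let ?R = "{(a, b). {a, b} \<in> En n \<and> 0 < F {a, b}}"
  define S where "S = {w \<in> Vn n. (u, w) \<in> ?R\<^sup>*}"
  have "S = Vn n"
  proof (rule ccontr)
    assume ne: "S \<noteq> Vn n"
    have "S \<subseteq> Vn n" "S \<noteq> {}" using uv by (auto simp: S_def)
    then obtain e where e: "e \<in> cut (Esupp n x) (\<lambda>e. e) S" "0 < F e" using conn ne by blast
    then have eE: "e \<in> En n" by (simp add: cut_def Esupp_def)
    have cross: "e \<inter> S \<noteq> {}" "\<not> e \<subseteq> S" using e by (auto simp: cut_def)
    obtain a b where ab: "e = {a, b}" "a \<in> S" "b \<in> Vn n" "b \<notin> S"
    proof -
      obtain a b where *: "e = {a, b}" "a \<in> Vn n" "b \<in> Vn n" by (rule En_ends[OF eE])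
      show ?thesis
      proof (cases "a \<in> S")
        case True
        then show ?thesis using that[of a b] * cross by auto
      next
        case False
        then show ?thesis using that[of b a] * cross by auto
      qed
    qed
    then have "(u, a) \<in> ?R\<^sup>*" "(a, b) \<in> ?R" using eE e(2) by (auto simp: S_def)
    then have "(u, b) \<in> ?R\<^sup>*" by (rule rtrancl.rtrancl_into_rtrancl)
    then show False using ab by (simp add: S_def)
  qed
  then show "(u, v) \<in> ?R\<^sup>*" using uv by (auto simp: S_def)
qed

theorem mainTheorem1:
  fixes n :: nat and \<theta> :: real and x y :: "nat set \<Rightarrow> real"
  assumes "n \<ge> 3" and "0 < \<theta>" and "\<theta> \<le> 1/2"
    and "theta_cyclic n \<theta> x"
    and "\<And>e. e \<in> Wx n x \<Longrightarrow> y e = 3/2 - \<theta>/10"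
    and "\<And>e. e \<in> Hx n x \<Longrightarrow> y e = 3/2 * x e"
    and "\<And>e. e \<in> En n \<Longrightarrow> e \<notin> Esupp n x \<Longrightarrow> y e = 0"
  shows "TSP n y"
proof -
  let ?V = "Vn n" and ?E = "Esupp n x" and ?g = "\<lambda>e :: nat set. e"
  interpret theta_graph ?V ?E ?g x \<theta> by (rule theta_cyclic_graph[OF assms(1-4)])
  have y: "y e = (if e \<in> ?E then target x \<theta> e else 0)" if e: "e \<in> En n" for e
  proof (cases "e \<in> ?E")
    case True
    show ?thesis
    proof (cases "x e = 1")
      case True
      then show ?thesis using assms(5)[of e] e \<open>e \<in> ?E\<close> by (simp add: Wx_def target_def)
    next
      case False
      then show ?thesis using assms(6)[of e] x_le1[OF \<open>e \<in> ?E\<close>] \<open>e \<in> ?E\<close> by (simp add: Hx_def target_def)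
    qed
  next
    case False
    then show ?thesis using assms(7)[OF e] by simp
  qed
  have "\<exists>p. finite (set_pmf p) \<and> (\<forall>F\<in>set_pmf p. (\<forall>v\<in>?V. even (sum F (dl {v}))) \<and>
      (\<forall>S\<subseteq>?V. S \<noteq> {} \<longrightarrow> S \<noteq> ?V \<longrightarrow> (\<exists>e\<in>dl S. 0 < F e))) \<and>
      (\<forall>e\<in>?E. mean p (\<lambda>F. real (F e)) = target x \<theta> e)"
  proof (cases "\<exists>r\<in>?V. cubic r")
    case True
    then obtain r where r: "r \<in> ?V" "cubic r" by blast
    have "decomposes ?V ?E ?g x \<theta> r"
      by (rule theta_graph_decomposes[OF theta_graph_axioms r(1)]) (use r(2) in \<open>simp add: cubic_def\<close>)
    then obtain p where p: "exact_marginals ?E x \<theta> p" "\<forall>F\<in>set_pmf p. rooted_tour ?V ?E ?g x r F"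
      unfolding decomposes_def by blast
    have conn: "\<exists>e\<in>dl S. 0 < F e" if F: "F \<in> set_pmf p" and S: "S \<subseteq> ?V" "S \<noteq> {}" "S \<noteq> ?V" for F S
    proof -
      have rt: "rooted_tour ?V ?E ?g x r F" using p(2) F by blast
      show ?thesis
      proof (cases "S - {r} \<noteq> {} \<and> S - {r} \<noteq> ?V - {r}")
        case True
        moreover have "S - {r} \<subseteq> ?V - {r}" using S by blast
        ultimately obtain e where e: "e \<in> ?E" "0 < F e" "e \<subseteq> ?V - {r}" "e \<in> dl (S - {r})"
          using rt unfolding rooted_tour_def by blast
        then have "e \<in> dl S" by (auto simp: cut_def)
        then show ?thesis using e by blast
      next
        case False
        then have "S = {r} \<or> S = ?V - {r}" using S r by blast
        then have "dl S = dl {r}" using cut_compl[of "{r}"] by auto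
        then show ?thesis using rt unfolding rooted_tour_def by auto
      qed
    qed
    show ?thesis
    proof (intro exI[of _ p] conjI ballI allI impI)
      show "finite (set_pmf p)" using p(1) by (simp add: exact_marginals_def)
      show "even (sum F (dl {v}))" if "F \<in> set_pmf p" "v \<in> ?V" for F v
        using p(2) that by (simp add: rooted_tour_def)
      show "\<exists>e\<in>dl S. 0 < F e" if "F \<in> set_pmf p" "S \<subseteq> ?V" "S \<noteq> {}" "S \<noteq> ?V" for F S
        by (rule conn[OF that])
      show "mean p (\<lambda>F. real (F e)) = target x \<theta> e" if "e \<in> ?E" for e
        using p(1) that by (simp add: exact_marginals_def)
    qed
  next
    case False
    \<comment> \<open>With no vertex of degree three the support is a Hamiltonian cycle of 1-edges
      and there is no root. Using it once with probability 1/2 + \<theta>/10 and twice otherwise has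
      mean 3/2 - \<theta>/10.\<close>
    let ?t = "1/2 + \<theta>/10"
    define p where "p = map_pmf (\<lambda>b (e :: nat set). if b then 1 else 2 :: nat) (bernoulli_pmf ?t)"
    have t: "0 \<le> ?t" "?t \<le> 1" using theta by auto
    have nc: "\<not> cubic v" if "v \<in> ?V" for v using False that by blast
    have x1: "x e = 1" if e: "e \<in> ?E" for e
    proof -
      obtain a b where ab: "e = {a, b}" "a \<in> ?V" by (rule edge_ends[OF e])
      have "e \<in> dl {a}" using mem_vertex_cut[OF e] ab by simp
      moreover obtain e1 f1 where "dl {a} = {e1, f1}" "x e1 = 1" "x f1 = 1"
        by (rule not_cubicE[OF ab(2) nc[OF ab(2)]])
      ultimately show ?thesis by auto
    qed
    have fp: "finite (set_pmf p)" unfolding p_def by (simp add: finite_subset[of _ UNIV])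
    have ev: "even (sum F (dl {v}))" if F: "F \<in> set_pmf p" and v: "v \<in> ?V" for F v
    proof -
      obtain e1 f1 where "e1 \<noteq> f1" "dl {v} = {e1, f1}" by (rule not_cubicE[OF v nc[OF v]])
      moreover obtain b where "F = (\<lambda>e. if b then 1 else 2)" using F by (auto simp: p_def)
      ultimately show ?thesis by simp
    qed
    have conn: "\<exists>e\<in>dl S. 0 < F e" if F: "F \<in> set_pmf p" and S: "S \<subseteq> ?V" "S \<noteq> {}" "S \<noteq> ?V" for F S
    proof -
      have "dl S \<noteq> {}" using cut_ge[OF S] by auto
      moreover obtain b where "F = (\<lambda>e. if b then 1 else 2)" using F by (auto simp: p_def)
      ultimately show ?thesis by auto
    qed
    have m: "mean p (\<lambda>F. real (F e)) = target x \<theta> e" if "e \<in> ?E" for e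
      using t x1[OF that] by (simp add: p_def target_def)
    show ?thesis
      by (intro exI[of _ p] conjI ballI allI impI fp ev conn m)
  qed
  then obtain p where p: "finite (set_pmf p)" "\<And>F v. F \<in> set_pmf p \<Longrightarrow> v \<in> ?V \<Longrightarrow> even (sum F (dl {v}))"
      "\<And>F S. F \<in> set_pmf p \<Longrightarrow> S \<subseteq> ?V \<Longrightarrow> S \<noteq> {} \<Longrightarrow> S \<noteq> ?V \<Longrightarrow> \<exists>e\<in>dl S. 0 < F e"
      "\<And>e. e \<in> ?E \<Longrightarrow> mean p (\<lambda>F. real (F e)) = target x \<theta> e"
    by (elim exE conjE) metis
  \<comment> \<open>The decomposition says nothing about multiplicities outside the support, so they
    are set to zero.\<close>
  define cl :: "(nat set \<Rightarrow> nat) \<Rightarrow> nat set \<Rightarrow> nat" where "cl F = (\<lambda>e. if e \<in> ?E then F e else 0)" for F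
  show ?thesis
  proof (rule TSP_if_pmf[of "map_pmf cl p"])
    show "finite (set_pmf (map_pmf cl p))" using p(1) by simp
    show "y e = mean (map_pmf cl p) (\<lambda>F. real (F e))" if "e \<in> En n" for e
      using y[OF that] p(4)[of e] by (cases "e \<in> ?E") (simp_all add: cl_def)
    fix F' assume "F' \<in> set_pmf (map_pmf cl p)"
    then obtain F where F: "F \<in> set_pmf p" "F' = cl F" by auto
    have cE: "cl F e = F e" if "e \<in> dl U" for e U using that cut_sub[of ?E ?g U] by (auto simp: cl_def)
    show "is_tour n F'"
    proof (rule is_tour_if_cuts)
      show "F' e = 0" if "e \<notin> ?E" for e using that by (simp add: F cl_def)
      show "even (sum F' (dl {v}))" if "v \<in> ?V" for v
        using p(2)[OF F(1) that] cE by (simp add: F(2) cong: sum.cong)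
      show "\<exists>e\<in>dl S. 0 < F' e" if "S \<subseteq> ?V" "S \<noteq> {}" "S \<noteq> ?V" for S
        using p(3)[OF F(1) that] cE by (auto simp: F(2))
    qed
  qed
qed

end
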